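(* On the Poincaré disk, $$L^2_+(\mathcal G_H)=\overline{I_0\big(x^{1/2}L^2(\mathbb D)\big)}^{L^2}\ \stackrel{\perp}{\oplus}\ \mathrm{span}_{L^2}\big(\widehat{I_{p,2q}}:p\ge0,q\ge1\big)\ \stackrel{\perp}{\oplus}\ \mathrm{span}_{L^2}\big(\overline{\widehat{I_{p,2q}}}:p\ge0,q\ge1\big),$$ where the sums are $L^2(\mathcal G_H)$-orthogonal, and the families $\{\widehat{I_{p,2q}}\}_{p\ge0,q\ge1}$ and $\{\overline{\widehat{I_{p,2q}}}\}_{p\ge0,q\ge1}$ are each $L^2(\mathcal G_H)$-orthonormal. (Here $\mathrm{span}_{L^2}$ denotes the closed linear span.)
   Context: Poincaré disk: $\mathbb D=\{|z|\le1\}$ with metric $g=c^{-2}|dz|^2$, $c(z)=\frac{1-|z|^2}{2}$, bdf $x=\frac{1-|z|^2}{1+|z|^2}$; $L^2(\mathbb D)$ is with respect to the hyperbolic area $dV_H$, and $x^{\delta}L^2(\mathbb D)=\{x^\delta u:u\in L^2(\mathbb D)\}$. The geodesic space is $\mathcal G_H=(\mathbb R/2\pi\mathbb Z)_\beta\times\mathbb R_a$, the geodesic labeled $(\beta,a)$ being $z_{\beta,a}(t)=e^{i\beta}\frac{(2+ia)\tanh(t/2)+ia}{ia\tanh(t/2)-2+ia}$, $t\in\mathbb R$ (unit speed); $L^2(\mathcal G_H)$ uses $d\beta\,da$. The antipodal scattering relation $\mathcal S_A(\beta,a)=(\beta+\pi+2\tan^{-1}a,-a)$ reverses orientation of geodesics;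 $L^2_\pm(\mathcal G_H)=\{h\in L^2(\mathcal G_H):h\circ\mathcal S_A=\pm h\}$. $I_0f(\beta,a)=\int_{\mathbb R}f(z_{\beta,a}(t))dt$. For integers $p\ge0$, $q\ge1$, $I_{p,q}(\beta,a)=\int_{\mathbb R}z_{\beta,a}(t)^p\,\dot z_{\beta,a}(t)^q\,dt$ (the X-ray transform of the symmetric tensor $z^p\,dz^q$), which lies in $L^2(\mathcal G_H)$, and $\widehat{I_{p,q}}=I_{p,q}/\|I_{p,q}\|_{L^2(\mathcal G_H)}$. *)

theory Defs
  imports "HOL-Analysis.Analysis"
begin

text \<open>Open unit disk (the boundary circle is a null set for the area measure).\<close>
definition disk :: "complex set" where
  "disk = ball 0 1"

text \<open>Hyperbolic area measure dV_H = c^{-2} dLeb, c(z) = (1-|z|^2)/2.\<close>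
definition hyp_area :: "complex measure" where
  "hyp_area = density (restrict_space lborel disk)
      (\<lambda>z. ennreal (4 / (1 - (cmod z)\<^sup>2)\<^sup>2))"

definition bdf :: "complex \<Rightarrow> real" where
  "bdf z = (1 - (cmod z)\<^sup>2) / (1 + (cmod z)\<^sup>2)"

definition L2_disk :: "(complex \<Rightarrow> complex) set" where
  "L2_disk = {u. u \<in> borel_measurable hyp_area \<and>
                 integrable hyp_area (\<lambda>z. (cmod (u z))\<^sup>2)}"

definition xhalf_L2 :: "(complex \<Rightarrow> complex) set" where
  "xhalf_L2 = {(\<lambda>z. complex_of_real (sqrt (bdf z)) * u z) | u. u \<in> L2_disk}"

definition geod :: "real \<Rightarrow> real \<Rightarrow> real \<Rightarrow> complex" where
  "geod \<beta> a t = cis \<beta> *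
     (((2 + \<i> * of_real a) * of_real (tanh (t/2)) + \<i> * of_real a) /
      (\<i> * of_real a * of_real (tanh (t/2)) - 2 + \<i> * of_real a))"

text \<open>X-ray transform I_0 (Bochner integral; 0 where f is not integrable along the geodesic).\<close>
definition I0 :: "(complex \<Rightarrow> complex) \<Rightarrow> real \<times> real \<Rightarrow> complex" where
  "I0 f = (\<lambda>(\<beta>, a). \<integral> t. f (geod \<beta> a t) \<partial>lborel)"

definition Ipq :: "nat \<Rightarrow> nat \<Rightarrow> real \<times> real \<Rightarrow> complex" where
  "Ipq p q = (\<lambda>(\<beta>, a). \<integral> t. (geod \<beta> a t) ^ p *
                 (vector_derivative (geod \<beta> a) (at t)) ^ q \<partial>lborel)"

text \<open>(R/2piZ) x R is represented by the fundamental domain [0,2pi) x R.\<close>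
definition GH :: "(real \<times> real) set" where
  "GH = {0..<2*pi} \<times> UNIV"

definition GH_measure :: "(real \<times> real) measure" where
  "GH_measure = restrict_space lborel GH"

definition L2_GH :: "(real \<times> real \<Rightarrow> complex) set" where
  "L2_GH = {h. h \<in> borel_measurable GH_measure \<and>
               integrable GH_measure (\<lambda>y. (cmod (h y))\<^sup>2)}"

definition inner_GH :: "(real \<times> real \<Rightarrow> complex) \<Rightarrow> (real \<times> real \<Rightarrow> complex) \<Rightarrow> complex" where
  "inner_GH f g = (\<integral> y. f y * cnj (g y) \<partial>GH_measure)"

definition norm_GH :: "(real \<times> real \<Rightarrow> complex) \<Rightarrow> real" where
  "norm_GH h = sqrt (\<integral> y. (cmod (h y))\<^sup>2 \<partial>GH_measure)"

definition wrap :: "real \<Rightarrow> real" where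
  "wrap b = b - 2 * pi * of_int \<lfloor>b / (2 * pi)\<rfloor>"

definition SA :: "real \<times> real \<Rightarrow> real \<times> real" where
  "SA = (\<lambda>(\<beta>, a). (wrap (\<beta> + pi + 2 * arctan a), - a))"

definition L2_plus :: "(real \<times> real \<Rightarrow> complex) set" where
  "L2_plus = {h \<in> L2_GH. AE y in GH_measure. h (SA y) = h y}"

definition L2_closure :: "(real \<times> real \<Rightarrow> complex) set \<Rightarrow> (real \<times> real \<Rightarrow> complex) set" where
  "L2_closure S = {h \<in> L2_GH. \<forall>e>0. \<exists>g\<in>S. g \<in> L2_GH \<and> norm_GH (\<lambda>y. h y - g y) < e}"

definition lin_span :: "'i set \<Rightarrow> ('i \<Rightarrow> real \<times> real \<Rightarrow> complex) \<Rightarrow> (real \<times> real \<Rightarrow> complex) set" where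
  "lin_span J F = {(\<lambda>y. \<Sum>i\<in>T. c i * F i y) | T c. finite T \<and> T \<subseteq> J}"

definition closed_span :: "'i set \<Rightarrow> ('i \<Rightarrow> real \<times> real \<Rightarrow> complex) \<Rightarrow> (real \<times> real \<Rightarrow> complex) set" where
  "closed_span J F = L2_closure (lin_span J F)"

definition orthonormal_family :: "'i set \<Rightarrow> ('i \<Rightarrow> real \<times> real \<Rightarrow> complex) \<Rightarrow> bool" where
  "orthonormal_family J F \<longleftrightarrow> (\<forall>i\<in>J. F i \<in> L2_GH) \<and>
     (\<forall>i\<in>J. \<forall>j\<in>J. inner_GH (F i) (F j) = (if i = j then 1 else 0))"

definition orthogonal_sets :: "(real \<times> real \<Rightarrow> complex) set \<Rightarrow> (real \<times> real \<Rightarrow> complex) set \<Rightarrow> bool" where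
  "orthogonal_sets A B \<longleftrightarrow> (\<forall>f\<in>A. \<forall>g\<in>B. inner_GH f g = 0)"

definition Ipq_hat :: "nat \<Rightarrow> nat \<Rightarrow> real \<times> real \<Rightarrow> complex" where
  "Ipq_hat p q = (\<lambda>y. Ipq p q y / complex_of_real (norm_GH (Ipq p q)))"

definition index_set :: "(nat \<times> nat) set" where
  "index_set = {(p, q). q \<ge> 1}"

end

theory Submission
  imports Defs "HOL-Computational_Algebra.Polynomial"
begin

text \<open>Label a geodesic by its endpoints \<open>zm\<close>, \<open>zp\<close> on the unit circle and write \<open>chord = zp - zm\<close>.
  Since \<open>d\<beta> da\<close> is a multiple of \<open>|chord|^{-2}\<close> times the invariant measure of the torus, the functions
  \<open>chord zp^j zm^k\<close> with integers \<open>j\<close>, \<open>k\<close> form an orthogonal basis of \<open>L^2\<close> of the space of geodesics,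
  and evenness under the scattering relation becomes antisymmetry of the coefficients in \<open>(j, k)\<close>. The
  three summands of the decomposition are the parts with both indices nonnegative (the transforms of
  \<open>z^p dz^{2q}\<close>), both negative (their conjugates), and of mixed sign (the transforms of functions).

  For the tensors, the integrals along geodesics are path independent, and \<open>I_{p,q} / chord\<close> is a homogeneous
  polynomial in \<open>zm\<close>, \<open>zp\<close> divisible by \<open>chord^{q-1}\<close> whose coefficients are values of a polynomial of degree
  \<open>q - 1\<close>; pairing with a multiple of \<open>chord^{q'-1}\<close> is a higher finite difference, hence zero.
  For functions, geodesics are straight chords in the Klein model, where repeated integration by parts computes the
  transform of \<open>x^2\<close> times a monomial. By Stone--Weierstrass the resulting moments determine how the measure
  on geodesics pushes forward to the disk, which gives the orthogonality for all of \<open>x^{1/2} L^2\<close>.\<close>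

subsection \<open>Complex measures determined by moments\<close>

text \<open>Evenness and the three summands are all encoded by which coefficients in
  \<open>ebasis\<close> vanish, so each closure only has to be identified with a set
  \<open>spectral P\<close>. The delicate one is the closure of the image of
  \<open>xhalf_L2\<close>: \<open>I0\<close> takes the value 0 where the integral diverges, so this
  image is not visibly a linear space, and \<open>I0 f\<close> need not be square integrable a
  priori. Density is therefore proved with a smaller linear class, \<open>nice\<close>, while
  orthogonality is proved by duality for one \<open>f\<close> at a time. The exponent 1/2 enters
  there: up to the factor 8 pi, the weight |chord|^2 on geodesics corresponds to x dV_H on the disk,
  and for f = x^(1/2) u the integral of x |f| is that of x^(3/2) |u|, finite because x^3 and |u|^2
  are integrable for dV_H. Test functions must then be bounded by a multiple of |chord|^2. This
  holds for \<open>ebasis_even j k\<close> with nonnegative indices, since an antisymmetric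
  polynomial in the endpoints contains a second factor \<open>chord\<close>; pairs of negative
  indices follow by conjugation.\<close>

lemma integrable_mult_bounded:
  fixes f g :: "'a \<Rightarrow> complex"
  assumes f: "integrable M f" and g: "g \<in> borel_measurable M"
    and b: "\<And>x. x \<in> space M \<Longrightarrow> cmod (g x) \<le> B"
  shows "integrable M (\<lambda>x. f x * g x)"
proof (rule Bochner_Integration.integrable_bound)
  show "integrable M (\<lambda>x. B * cmod (f x))"
    using f by simp
  show "(\<lambda>x. f x * g x) \<in> borel_measurable M"
    using f g by measurable
  show "AE x in M. norm (f x * g x) \<le> norm (B * cmod (f x))"
  proof (rule AE_I2)
    fix x assume "x \<in> space M"
    from b[OF this] have "cmod (f x) * cmod (g x) \<le> cmod (f x) * B"
      by (intro mult_left_mono) auto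
    also have "\<dots> \<le> \<bar>B * cmod (f x)\<bar>"
      by (simp add: mult.commute)
    finally show "norm (f x * g x) \<le> norm (B * cmod (f x))"
      by (simp add: norm_mult)
  qed
qed

text \<open>Stone-Weierstrass produces real polynomials in four real coordinates, whereas the
  moments are given for powers of two complex coordinates and their conjugates. This class
  translates between the two and supports induction from monomials.\<close>

inductive torus_poly :: "(complex \<times> complex \<Rightarrow> complex) \<Rightarrow> bool" where
  monomial: "torus_poly (\<lambda>p. fst p ^ a * cnj (fst p) ^ b * (snd p ^ c * cnj (snd p) ^ d))"
| plus: "torus_poly f \<Longrightarrow> torus_poly g \<Longrightarrow> torus_poly (\<lambda>p. f p + g p)"
| scale: "torus_poly f \<Longrightarrow> torus_poly (\<lambda>p. c * f p)"

lemma torus_poly_mult: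
  assumes "torus_poly f" "torus_poly g"
  shows "torus_poly (\<lambda>p. f p * g p)"
  using assms(1)
proof induction
  case (monomial a b c d)
  show ?case
    using assms(2)
  proof induction
    case (monomial a' b' c' d')
    show ?case
      using torus_poly.monomial[of "a + a'" "b + b'" "c + c'" "d + d'"]
      by (simp add: power_add mult_ac)
  next
    case (plus f g)
    then show ?case
      using torus_poly.plus by (simp add: distrib_left)
  next
    case (scale f e)
    then show ?case
      using torus_poly.scale[OF scale.IH, of e] by (simp add: mult_ac)
  qed
next
  case (plus f g)
  then show ?case
    using torus_poly.plus by (simp add: distrib_right)
next
  case (scale f c)
  then show ?case
    using torus_poly.scale[OF scale.IH, of c] by (simp add: mult_ac)
qed

lemma torus_poly_const: "torus_poly (\<lambda>p. c)"
  using torus_poly.scale[OF torus_poly.monomial[of 0 0 0 0], of c] by simp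

lemma torus_poly_real_polynomial:
  assumes "real_polynomial_function p"
  shows "torus_poly (\<lambda>x. complex_of_real (p x))"
  using assms
proof induction
  case (linear f)
  interpret bounded_linear f by fact
  have m: "torus_poly fst" "torus_poly (\<lambda>p. cnj (fst p))" "torus_poly snd"
    "torus_poly (\<lambda>p. cnj (snd p))"
    using torus_poly.monomial[of 1 0 0 0] torus_poly.monomial[of 0 1 0 0]
      torus_poly.monomial[of 0 0 1 0] torus_poly.monomial[of 0 0 0 1] by simp_all
  \<comment> \<open>A linear form is determined by its values on the four real basis vectors; real
    and imaginary parts are then written through a coordinate and its conjugate.\<close>
  have star: "f p = Re (fst p) * f (1, 0) + Im (fst p) * f (\<i>, 0) + Re (snd p) * f (0, 1)
      + Im (snd p) * f (0, \<i>)" for p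
  proof -
    have "p = Re (fst p) *\<^sub>R (1, 0) + Im (fst p) *\<^sub>R (\<i>, 0) + Re (snd p) *\<^sub>R (0, 1)
        + Im (snd p) *\<^sub>R (0, \<i>)"
      by (simp add: prod_eq_iff complex_eq_iff)
    then have "f p = f (Re (fst p) *\<^sub>R (1, 0) + Im (fst p) *\<^sub>R (\<i>, 0) + Re (snd p) *\<^sub>R (0, 1)
        + Im (snd p) *\<^sub>R (0, \<i>))"
      by simp
    then show ?thesis
      by (simp add: add scaleR del: scaleR_Pair add_Pair)
  qed
  have starc: "complex_of_real (f p) = complex_of_real (Re (fst p)) * f (1, 0)
      + complex_of_real (Im (fst p)) * f (\<i>, 0) + complex_of_real (Re (snd p)) * f (0, 1)
      + complex_of_real (Im (snd p)) * f (0, \<i>)" for p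
    unfolding star[of p] by simp
  have ReIm: "complex_of_real (Re z) = (z + cnj z) / 2" "complex_of_real (Im z) = (z - cnj z) / (2 * \<i>)" for z
    by (simp_all add: complex_eq_iff)
  have alg: "(z + z') / 2 * a + (z - z') / (2 * \<i>) * b + (w + w') / 2 * c + (w - w') / (2 * \<i>) * d
      = (a / 2 + b / (2 * \<i>)) * z + (a / 2 - b / (2 * \<i>)) * z'
      + ((c / 2 + d / (2 * \<i>)) * w + (c / 2 - d / (2 * \<i>)) * w')" for a b c d z z' w w' :: complex
    by (simp add: add_divide_distrib diff_divide_distrib ring_distribs mult_ac)
  have "complex_of_real (f p) = (f (1, 0) / 2 + f (\<i>, 0) / (2 * \<i>)) * fst p
      + (f (1, 0) / 2 - f (\<i>, 0) / (2 * \<i>)) * cnj (fst p)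
      + ((f (0, 1) / 2 + f (0, \<i>) / (2 * \<i>)) * snd p
      + (f (0, 1) / 2 - f (0, \<i>) / (2 * \<i>)) * cnj (snd p))" for p
    unfolding starc[of p] ReIm of_real_divide of_real_numeral by (rule alg)
  then have "(\<lambda>p. complex_of_real (f p)) = (\<lambda>p. (f (1, 0) / 2 + f (\<i>, 0) / (2 * \<i>)) * fst p
      + (f (1, 0) / 2 - f (\<i>, 0) / (2 * \<i>)) * cnj (fst p)
      + ((f (0, 1) / 2 + f (0, \<i>) / (2 * \<i>)) * snd p
      + (f (0, 1) / 2 - f (0, \<i>) / (2 * \<i>)) * cnj (snd p)))"
    by (rule ext)
  then show ?case
    by (rule ssubst) (intro torus_poly.plus torus_poly.scale m)
next
  case (const c)
  then show ?case by (rule torus_poly_const)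
next
  case (add f g)
  then show ?case using torus_poly.plus by simp
next
  case (mult f g)
  then show ?case using torus_poly_mult by simp
qed

lemma continuous_on_real_polynomial:
  "real_polynomial_function p \<Longrightarrow> continuous_on S p"
  by (meson continuous_on_polymonial_function real_polynomial_function_eq)

text \<open>Two complex measures are compared after push-forward into a common ball. The source
  spaces are independent because the flow over all geodesics is later compared with the hyperbolic
  disk; vanishing results take the zero density on one side.\<close>

context
  fixes M1 :: "'a measure" and M2 :: "'b measure"
    and f1 :: "'a \<Rightarrow> complex" and f2 :: "'b \<Rightarrow> complex"
    and T1 :: "'a \<Rightarrow> complex \<times> complex" and T2 :: "'b \<Rightarrow> complex \<times> complex"
    and R :: real
  assumes f1: "integrable M1 f1" and f2: "integrable M2 f2"
    and T1 [measurable]: "T1 \<in> borel_measurable M1" and T2 [measurable]: "T2 \<in> borel_measurable M2"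
    and R1: "\<And>x. x \<in> space M1 \<Longrightarrow> norm (T1 x) \<le> R"
    and R2: "\<And>x. x \<in> space M2 \<Longrightarrow> norm (T2 x) \<le> R"
    and moments: "\<And>a b c d.
      (\<integral>x. f1 x * (fst (T1 x) ^ a * cnj (fst (T1 x)) ^ b * (snd (T1 x) ^ c * cnj (snd (T1 x)) ^ d)) \<partial>M1)
    = (\<integral>x. f2 x * (fst (T2 x) ^ a * cnj (fst (T2 x)) ^ b * (snd (T2 x) ^ c * cnj (snd (T2 x)) ^ d)) \<partial>M2)"
begin

lemma f_measurable [measurable]: "f1 \<in> borel_measurable M1" "f2 \<in> borel_measurable M2"
  using f1 f2 by auto

lemma moments_integrable:
  fixes T :: "'c \<Rightarrow> complex \<times> complex"
  assumes T: "T \<in> borel_measurable M" "\<And>x. x \<in> space M \<Longrightarrow> norm (T x) \<le> R"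
    and f: "integrable M f" and g: "continuous_on UNIV g"
  shows "integrable M (\<lambda>x. f x * (g (T x) :: complex))"
proof -
  have "compact (g ` cball 0 R)"
    by (intro compact_continuous_image continuous_on_subset[OF g]) auto
  then obtain B where B: "\<And>y. y \<in> cball 0 R \<Longrightarrow> cmod (g y) \<le> B"
    by (meson bounded_iff compact_imp_bounded imageI)
  have "(\<lambda>x. g (T x)) \<in> borel_measurable M"
    using borel_measurable_continuous_on[OF g T(1)] .
  then show ?thesis
    by (rule integrable_mult_bounded[OF f, where B = B]) (use T(2) B in auto)
qed

lemma torus_poly_continuous: "torus_poly g \<Longrightarrow> continuous_on UNIV g"
  by (induction rule: torus_poly.induct) (intro continuous_intros | assumption)+

lemma moments_torus_poly:
  assumes "torus_poly g"
  shows "(\<integral>x. f1 x * g (T1 x) \<partial>M1) = (\<integral>x. f2 x * g (T2 x) \<partial>M2)"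
  using assms
proof induction
  case (monomial a b c d)
  then show ?case using moments by simp
next
  case (plus f g)
  have "integrable M1 (\<lambda>x. f1 x * f (T1 x))" "integrable M2 (\<lambda>x. f2 x * f (T2 x))"
    "integrable M1 (\<lambda>x. f1 x * g (T1 x))" "integrable M2 (\<lambda>x. f2 x * g (T2 x))"
    using f1 f2 R1 R2 by (intro moments_integrable torus_poly_continuous plus.hyps; simp)+
  with plus.IH show ?case
    by (simp add: distrib_left)
next
  case (scale f c)
  have "(\<integral>x. f1 x * (c * f (T1 x)) \<partial>M1) = c * (\<integral>x. f1 x * f (T1 x) \<partial>M1)"
    by (simp flip: integral_mult_right_zero add: mult_ac)
  moreover have "(\<integral>x. f2 x * (c * f (T2 x)) \<partial>M2) = c * (\<integral>x. f2 x * f (T2 x) \<partial>M2)"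
    by (simp flip: integral_mult_right_zero add: mult_ac)
  ultimately show ?case
    using scale.IH by simp
qed

lemma moments_approx:
  fixes T :: "'c \<Rightarrow> complex \<times> complex"
  assumes T: "T \<in> borel_measurable M" "\<And>x. x \<in> space M \<Longrightarrow> norm (T x) \<le> R"
    and f: "integrable M f"
    and g: "continuous_on UNIV g" and p: "continuous_on UNIV p"
    and e: "\<And>y. y \<in> cball 0 R \<Longrightarrow> \<bar>g y - p y\<bar> < e"
  shows "cmod ((\<integral>x. f x * complex_of_real (g (T x)) \<partial>M) - (\<integral>x. f x * complex_of_real (p (T x)) \<partial>M))
      \<le> e * (\<integral>x. cmod (f x) \<partial>M)"
proof -
  have i: "integrable M (\<lambda>x. f x * complex_of_real (g (T x)))"
    "integrable M (\<lambda>x. f x * complex_of_real (p (T x)))"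
    using moments_integrable[OF T f, of "\<lambda>y. of_real (g y)"]
      moments_integrable[OF T f, of "\<lambda>y. of_real (p y)"] g p
    by (auto intro!: continuous_intros)
  have "(\<integral>x. f x * complex_of_real (g (T x)) \<partial>M) - (\<integral>x. f x * complex_of_real (p (T x)) \<partial>M)
      = (\<integral>x. f x * complex_of_real (g (T x) - p (T x)) \<partial>M)"
    using i by (simp add: right_diff_distrib)
  also have "cmod \<dots> \<le> (\<integral>x. cmod (f x * complex_of_real (g (T x) - p (T x))) \<partial>M)"
    by (rule integral_norm_bound)
  also have "\<dots> \<le> (\<integral>x. e * cmod (f x) \<partial>M)"
  proof (rule integral_mono)
    show "integrable M (\<lambda>x. cmod (f x * complex_of_real (g (T x) - p (T x))))"
      using i by (intro integrable_norm) (simp add: right_diff_distrib)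
    show "integrable M (\<lambda>x. e * cmod (f x))"
      using f by simp
    fix x assume "x \<in> space M"
    then have "\<bar>g (T x) - p (T x)\<bar> \<le> e"
      using e[of "T x"] T(2) by force
    then show "cmod (f x * complex_of_real (g (T x) - p (T x))) \<le> e * cmod (f x)"
      by (simp add: norm_mult mult.commute[of e] mult_left_mono del: of_real_diff)
  qed
  finally show ?thesis
    by simp
qed

lemma moments_continuous:
  assumes g: "continuous_on UNIV (g :: complex \<times> complex \<Rightarrow> real)"
  shows "(\<integral>x. f1 x * complex_of_real (g (T1 x)) \<partial>M1) = (\<integral>x. f2 x * complex_of_real (g (T2 x)) \<partial>M2)"
    (is "?L = ?R")
proof (rule ccontr)
  assume ne: "?L \<noteq> ?R"
  \<comment> \<open>The summand 1 keeps \<open>C\<close> positive, so that \<open>e\<close> makes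
    sense even if both densities vanish.\<close>
  define C where "C = (\<integral>x. cmod (f1 x) \<partial>M1) + (\<integral>x. cmod (f2 x) \<partial>M2) + 1"
  have C: "C \<ge> 1"
    unfolding C_def by simp
  define e where "e = cmod (?L - ?R) / C"
  have e: "e > 0"
    using ne C unfolding e_def by (intro divide_pos_pos) auto
  obtain p where p: "real_polynomial_function p" "\<And>y. y \<in> cball 0 R \<Longrightarrow> \<bar>g y - p y\<bar> < e"
    using Stone_Weierstrass_real_polynomial_function[OF compact_cball continuous_on_subset[OF g] e]
    by (metis subset_UNIV)
  note pc = continuous_on_real_polynomial[OF p(1)]
  have eq: "(\<integral>x. f1 x * complex_of_real (p (T1 x)) \<partial>M1) = (\<integral>x. f2 x * complex_of_real (p (T2 x)) \<partial>M2)"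
    using moments_torus_poly[OF torus_poly_real_polynomial[OF p(1)]] .
  have "cmod (?L - ?R) \<le> cmod (?L - (\<integral>x. f1 x * complex_of_real (p (T1 x)) \<partial>M1))
      + cmod (?R - (\<integral>x. f2 x * complex_of_real (p (T2 x)) \<partial>M2))"
    using eq by (metis (no_types, lifting) norm_minus_commute norm_triangle_sub norm_diff_triangle_le order_refl)
  also have "\<dots> \<le> e * (\<integral>x. cmod (f1 x) \<partial>M1) + e * (\<integral>x. cmod (f2 x) \<partial>M2)"
    using p(2) by (intro add_mono moments_approx f1 f2 T1 T2 R1 R2 g pc)
  also have "\<dots> < e * C"
    using e unfolding C_def by (simp add: algebra_simps)
  also have "\<dots> = cmod (?L - ?R)"
    unfolding e_def using C by simp
  finally show False by simp
qed

lemma moments_open: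
  assumes U: "open U"
  shows "(\<integral>x. f1 x * indicator U (T1 x) \<partial>M1) = (\<integral>x. f2 x * indicator U (T2 x) \<partial>M2)"
\<comment> \<open>The whole space is separate since \<open>infdist\<close> to the empty complement
  is 0, which would make every \<open>h n\<close> vanish; there the claim is the moment with all
  exponents 0.\<close>
proof (cases "U = UNIV")
  case True
  then show ?thesis
    using moments[of 0 0 0 0] by simp
next
  case False
  define h where "h n y = min 1 (real n * infdist y (- U))" for n y
  have hc: "continuous_on UNIV (h n)" for n
    unfolding h_def by (intro continuous_intros)
  have lim: "(\<lambda>n. complex_of_real (h n y)) \<longlonglongrightarrow> indicator U y" for y
  proof (cases "y \<in> U")
    case True
    then have "infdist y (- U) > 0"
      using U False by (intro infdist_pos_not_in_closed) auto
    then obtain N where N: "real N * infdist y (- U) > 1"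
      using reals_Archimedean3 by blast
    have "\<forall>\<^sub>F n in sequentially. complex_of_real (h n y) = indicator U y"
    proof (rule eventually_sequentiallyI[of N])
      fix n assume "N \<le> n"
      then have "real N * infdist y (- U) \<le> real n * infdist y (- U)"
        by (intro mult_right_mono) (auto simp: infdist_nonneg)
      then show "complex_of_real (h n y) = indicator U y"
        using N True unfolding h_def by simp
    qed
    then show ?thesis
      by (rule tendsto_eventually)
  next
    case False
    then have "infdist y (- U) = 0"
      by simp
    then show ?thesis
      using False unfolding h_def by simp
  qed
  have conv: "(\<lambda>n. \<integral>x. f x * complex_of_real (h n (T x)) \<partial>M) \<longlonglongrightarrow> (\<integral>x. f x * indicator U (T x) \<partial>M)"
    if [measurable]: "T \<in> borel_measurable M" and f: "integrable M f" for f :: "'c \<Rightarrow> complex" and T M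
  proof (rule integral_dominated_convergence)
    have [measurable]: "f \<in> borel_measurable M"
      using f by simp
    have [measurable]: "h n \<in> borel_measurable borel" for n
      using hc by (simp add: borel_measurable_continuous_onI)
    have [measurable]: "U \<in> sets borel"
      using U by simp
    show "(\<lambda>x. f x * indicator U (T x)) \<in> borel_measurable M"
      by measurable
    show "(\<lambda>x. f x * complex_of_real (h n (T x))) \<in> borel_measurable M" for n
      by measurable
    show "integrable M (\<lambda>x. cmod (f x))"
      using f by simp
    show "AE x in M. (\<lambda>n. f x * complex_of_real (h n (T x))) \<longlonglongrightarrow> f x * indicator U (T x)"
      by (intro AE_I2 tendsto_mult lim tendsto_const)
    have "\<bar>h n y\<bar> \<le> 1" for n y
      unfolding h_def by (simp add: infdist_nonneg abs_le_iff)
    then show "AE x in M. norm (f x * complex_of_real (h n (T x))) \<le> cmod (f x)" for n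
      by (intro AE_I2) (simp add: norm_mult mult_left_le)
  qed
  have "(\<lambda>n. \<integral>x. f1 x * complex_of_real (h n (T1 x)) \<partial>M1) \<longlonglongrightarrow> (\<integral>x. f2 x * indicator U (T2 x) \<partial>M2)"
    unfolding moments_continuous[OF hc] by (rule conv[OF T2 f2])
  with conv[OF T1 f1] show ?thesis
    by (rule LIMSEQ_unique)
qed

text \<open>Dynkin's argument from the open sets: complements use that the total integrals agree,
  which is the moment with exponents 0, and countable disjoint unions pass to the limit by dominated
  convergence.\<close>

lemma moments_determine:
  assumes "A \<in> sets borel"
  shows "(\<integral>x. f1 x * indicator A (T1 x) \<partial>M1) = (\<integral>x. f2 x * indicator A (T2 x) \<partial>M2)"
proof -
  have ind: "integrable M (\<lambda>x. f x * indicator A (T x) :: complex)"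
    if [measurable]: "T \<in> borel_measurable M" "A \<in> sets borel" and f: "integrable M f"
    for f and T :: "'c \<Rightarrow> complex \<times> complex" and M A
  proof (rule integrable_mult_bounded[OF f, where B = 1])
    show "(\<lambda>x. indicator A (T x)) \<in> borel_measurable M"
      by measurable
  qed (simp add: indicator_def)
  have "Int_stable {S :: (complex \<times> complex) set. open S}"
    by (auto simp: Int_stable_def)
  moreover have "{S :: (complex \<times> complex) set. open S} \<subseteq> Pow UNIV"
    by simp
  moreover have "A \<in> sigma_sets UNIV {S. open S}"
    using assms by (simp add: borel_def)
  ultimately show ?thesis
  proof (induction rule: sigma_sets_induct_disjoint)
    case (basic A)
    then show ?case using moments_open by auto
  next
    case empty
    then show ?case by simp
  next
    case (compl A)
    have A: "A \<in> sets borel"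
      using compl(1) by (simp add: borel_def)
    have *: "f x * indicator (UNIV - A) (T x) = f x - f x * indicator A (T x)"
      for f :: "'c \<Rightarrow> complex" and T x
      by (simp add: indicator_def)
    have *: "(\<integral>x. f x * indicator (UNIV - A) (T x) \<partial>M) = (\<integral>x. f x \<partial>M) - (\<integral>x. f x * indicator A (T x) \<partial>M)"
      if "T \<in> borel_measurable M" "integrable M f" for f :: "'c \<Rightarrow> complex" and T M
      unfolding * using that ind[OF that(1) A that(2)] by simp
    show ?case
      unfolding *[OF T1 f1] *[OF T2 f2] compl.IH
      using moments[of 0 0 0 0] by simp
  next
    case (union A)
    have A: "A i \<in> sets borel" for i
      using union(2) by (auto simp: borel_def)
    have conv: "(\<lambda>n. \<integral>x. f x * indicator (\<Union>i<n. A i) (T x) \<partial>M) \<longlonglongrightarrow> (\<integral>x. f x * indicator (\<Union>i. A i) (T x) \<partial>M)"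
      if [measurable]: "T \<in> borel_measurable M" and f: "integrable M f" for f :: "'c \<Rightarrow> complex" and T M
    proof (rule integral_dominated_convergence)
      have [measurable]: "f \<in> borel_measurable M" "(\<Union>i. A i) \<in> sets borel"
        "(\<Union>i<n. A i) \<in> sets borel" for n
        using f A by auto
      show "(\<lambda>x. f x * indicator (\<Union>i. A i) (T x)) \<in> borel_measurable M"
        "(\<lambda>x. f x * indicator (\<Union>i<n. A i) (T x)) \<in> borel_measurable M" for n
        by measurable
      show "integrable M (\<lambda>x. cmod (f x))"
        using f by simp
      show "AE x in M. (\<lambda>n. f x * indicator (\<Union>i<n. A i) (T x)) \<longlonglongrightarrow> f x * indicator (\<Union>i. A i) (T x)"
        by (intro AE_I2 tendsto_mult LIMSEQ_indicator_UN tendsto_const)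
      show "AE x in M. norm (f x * indicator (\<Union>i<n. A i) (T x)) \<le> cmod (f x)" for n
        by (intro AE_I2) (auto simp: norm_mult indicator_def)
    qed
    have fin: "(\<integral>x. f x * indicator (\<Union>i<n. A i) (T x) \<partial>M) = (\<Sum>i<n. \<integral>x. f x * indicator (A i) (T x) \<partial>M)"
      if T: "T \<in> borel_measurable M" and f: "integrable M f" for f :: "'c \<Rightarrow> complex" and T M n
    proof -
      have "indicator (\<Union>i<n. A i) y = (\<Sum>i<n. indicator (A i) y :: complex)" for y
        using union(1) by (intro indicator_UN_disjoint) (auto simp: disjoint_family_on_def)
      then have *: "f x * indicator (\<Union>i<n. A i) (T x) = (\<Sum>i<n. f x * indicator (A i) (T x))" for x
        by (simp only: sum_distrib_left)
      show ?thesis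
        unfolding * by (intro Bochner_Integration.integral_sum ind T A f)
    qed
    have "(\<lambda>n. \<integral>x. f1 x * indicator (\<Union>i<n. A i) (T1 x) \<partial>M1) \<longlonglongrightarrow> (\<integral>x. f2 x * indicator (\<Union>i. A i) (T2 x) \<partial>M2)"
      unfolding fin[OF T1 f1] union.IH fin[OF T2 f2, symmetric] by (rule conv[OF T2 f2])
    with conv[OF T1 f1] show ?case
      by (rule LIMSEQ_unique)
  qed
qed

end

text \<open>A planar map becomes a map into a ball of radius 2 by adding the constant coordinate 1,
  whose powers leave every moment unchanged.\<close>

lemma moments_determine_plane:
  fixes T1 :: "'a \<Rightarrow> complex" and T2 :: "'b \<Rightarrow> complex"
  assumes f1: "integrable M1 f1" and f2: "integrable M2 f2"
    and T1: "T1 \<in> borel_measurable M1" "\<And>x. cmod (T1 x) \<le> 1"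
    and T2: "T2 \<in> borel_measurable M2" "\<And>x. cmod (T2 x) \<le> 1"
    and moments: "\<And>a b. (\<integral>x. f1 x * (T1 x ^ a * cnj (T1 x) ^ b) \<partial>M1) = (\<integral>x. f2 x * (T2 x ^ a * cnj (T2 x) ^ b) \<partial>M2)"
    and E: "E \<in> sets borel"
  shows "(\<integral>x. f1 x * indicator E (T1 x) \<partial>M1) = (\<integral>x. f2 x * indicator E (T2 x) \<partial>M2)"
proof -
  have p: "(\<lambda>w::complex. (w, 1::complex)) \<in> borel_measurable borel"
    by (intro borel_measurable_continuous_onI continuous_intros)
  have nb: "norm (w, 1 :: complex) \<le> 2" if "cmod w \<le> 1" for w :: complex
    using norm_Pair_le[of w "1 :: complex"] that by simp
  have "E \<times> UNIV \<in> sets (borel :: (complex \<times> complex) measure)"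
    using E by (simp add: borel_Times)
  then have "(\<integral>x. f1 x * indicator (E \<times> UNIV) (T1 x, 1 :: complex) \<partial>M1)
      = (\<integral>x. f2 x * indicator (E \<times> UNIV) (T2 x, 1 :: complex) \<partial>M2)"
    using measurable_compose[OF T1(1) p] measurable_compose[OF T2(1) p] nb[OF T1(2)] nb[OF T2(2)] moments
    by (intro moments_determine[OF f1 f2, where R = 2]) simp_all
  then show ?thesis
    by (simp add: indicator_times)
qed

text \<open>The real and imaginary parts and their negatives are each tested on the set where they
  are positive.\<close>

lemma AE_zero_if_set_integrals_zero:
  fixes f :: "'a \<Rightarrow> complex"
  assumes f: "integrable M f"
    and z: "\<And>A. A \<in> sets M \<Longrightarrow> (\<integral>x. f x * indicator A x \<partial>M) = 0"
  shows "AE x in M. f x = 0"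
proof -
  have [measurable]: "f \<in> borel_measurable M"
    using f by simp
  have pos: "AE x in M. g x \<le> 0"
    if g: "integrable M g" and gz: "\<And>A. A \<in> sets M \<Longrightarrow> (\<integral>x. g x * indicator A x \<partial>M) = 0"
    for g :: "'a \<Rightarrow> real"
  proof -
    have [measurable]: "g \<in> borel_measurable M"
      using g by simp
    define A where "A = {x \<in> space M. g x > 0}"
    have A: "A \<in> sets M"
      unfolding A_def by measurable
    have "integrable M (\<lambda>x. g x * indicator A x)"
      using integrable_real_mult_indicator[OF A g] by simp
    moreover have "AE x in M. 0 \<le> g x * indicator A x"
      by (auto simp: A_def indicator_def)
    ultimately have "AE x in M. g x * indicator A x = 0"
      using integral_nonneg_eq_0_iff_AE gz[OF A] by blast
    then show ?thesis
      by (rule AE_mp) (auto intro!: AE_I2 simp: A_def indicator_def split: if_splits)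
  qed
  have ind: "integrable M (\<lambda>x. f x * indicator A x)" if "A \<in> sets M" for A
    using that by (intro integrable_mult_bounded[OF f, where B = 1]) (auto simp: indicator_def)
  have re: "(\<integral>x. Re (f x) * indicator A x \<partial>M) = 0" if A: "A \<in> sets M" for A
  proof -
    have "(\<integral>x. Re (f x * indicator A x) \<partial>M) = 0"
      by (subst integral_Re[OF ind[OF A]]) (simp add: z[OF A])
    moreover have "Re (f x * indicator A x) = Re (f x) * indicator A x" for x
      by (simp add: indicator_def)
    ultimately show ?thesis
      by simp
  qed
  have im: "(\<integral>x. Im (f x) * indicator A x \<partial>M) = 0" if A: "A \<in> sets M" for A
  proof -
    have "(\<integral>x. Im (f x * indicator A x) \<partial>M) = 0"
      by (subst integral_Im[OF ind[OF A]]) (simp add: z[OF A])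
    moreover have "Im (f x * indicator A x) = Im (f x) * indicator A x" for x
      by (simp add: indicator_def)
    ultimately show ?thesis
      by simp
  qed
  have "AE x in M. Re (f x) \<le> 0" "AE x in M. - Re (f x) \<le> 0"
    "AE x in M. Im (f x) \<le> 0" "AE x in M. - Im (f x) \<le> 0"
    using f re im by (intro pos; simp)+
  then show ?thesis
    by eventually_elim (simp add: complex_eq_iff)
qed

section \<open>Integration over the line and over the space of geodesics\<close>

lemma line_FTC_nonneg:
  fixes f F :: "real \<Rightarrow> real"
  assumes F: "\<And>x. (F has_real_derivative f x) (at x)"
    and f: "continuous_on UNIV f" and pos: "\<And>x. f x \<ge> 0"
    and A: "(F \<longlongrightarrow> A) at_bot" and B: "(F \<longlongrightarrow> B) at_top"
  shows "integrable lborel f" "(\<integral>x. f x \<partial>lborel) = B - A"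
proof -
  have A': "((F \<circ> real_of_ereal) \<longlongrightarrow> A) (at_right (-\<infinity>))"
    and B': "((F \<circ> real_of_ereal) \<longlongrightarrow> B) (at_left \<infinity>)"
    using A B by (simp_all only: ereal_tendsto_simps)
  have f': "isCont f x" for x
    using f by (simp add: continuous_on_eq_continuous_at)
  have e: "einterval (-\<infinity>) \<infinity> = UNIV"
    by (auto simp: einterval_def)
  have "set_integrable lborel (einterval (-\<infinity>) \<infinity>) f" "(LBINT x=-\<infinity>..\<infinity>. f x) = B - A"
    using F f' pos A' B' by (intro interval_integral_FTC_nonneg[where F = F]; simp)+
  then show "integrable lborel f" "(\<integral>x. f x \<partial>lborel) = B - A"
    unfolding e interval_lebesgue_integral_def set_integrable_def set_lebesgue_integral_def by simp_all
qed

lemma line_FTC: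
  fixes f F :: "real \<Rightarrow> complex"
  assumes F: "\<And>x. (F has_vector_derivative f x) (at x)"
    and f: "continuous_on UNIV f" and i: "integrable lborel f"
    and A: "(F \<longlongrightarrow> A) at_bot" and B: "(F \<longlongrightarrow> B) at_top"
  shows "(\<integral>x. f x \<partial>lborel) = B - A"
proof -
  have A': "((F \<circ> real_of_ereal) \<longlongrightarrow> A) (at_right (-\<infinity>))"
    and B': "((F \<circ> real_of_ereal) \<longlongrightarrow> B) (at_left \<infinity>)"
    using A B by (simp_all only: ereal_tendsto_simps)
  have f': "isCont f x" for x
    using f by (simp add: continuous_on_eq_continuous_at)
  have e: "einterval (-\<infinity>) \<infinity> = UNIV"
    by (auto simp: einterval_def)
  have "(LBINT x=-\<infinity>..\<infinity>. f x) = B - A"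
    using F f' A' B' i
    by (intro interval_integral_FTC_integrable[where F = F]) (simp_all add: e set_integrable_def)
  then show ?thesis
    unfolding e interval_lebesgue_integral_def set_lebesgue_integral_def by simp
qed

lemma GH_measurable [measurable]: "GH \<in> sets borel"
  unfolding GH_def by (simp add: borel_Times)

lemma borel_measurable_GH: "f \<in> borel_measurable borel \<Longrightarrow> f \<in> borel_measurable GH_measure"
  unfolding GH_measure_def by (rule measurable_restrict_space1) simp

lemma sigma_finite_GH: "sigma_finite_measure GH_measure"
  unfolding GH_measure_def
  by (rule sigma_finite_measure_restrict_space) (simp_all add: sigma_finite_lborel)

interpretation GH: sigma_finite_measure GH_measure
  by (rule sigma_finite_GH)

lemma borel_measurable_GH_ind:
  fixes f :: "real \<times> real \<Rightarrow> ennreal"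
  shows "f \<in> borel_measurable GH_measure \<Longrightarrow> (\<lambda>y. f y * indicator GH y) \<in> borel_measurable (lborel \<Otimes>\<^sub>M lborel)"
  unfolding GH_measure_def by (subst (asm) borel_measurable_restrict_space_iff_ennreal) (simp_all add: lborel_prod)

lemma nn_integral_GH:
  assumes f: "f \<in> borel_measurable GH_measure"
  shows "(\<integral>\<^sup>+y. f y \<partial>GH_measure) = (\<integral>\<^sup>+a. (\<integral>\<^sup>+b. f (b, a) * indicator {0..<2*pi} b \<partial>lborel) \<partial>lborel)"
proof -
  have "(\<integral>\<^sup>+y. f y \<partial>GH_measure) = (\<integral>\<^sup>+y. f y * indicator GH y \<partial>(lborel \<Otimes>\<^sub>M lborel))"
    unfolding GH_measure_def lborel_prod by (subst nn_integral_restrict_space) simp_all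
  also have "\<dots> = (\<integral>\<^sup>+a. (\<integral>\<^sup>+b. f (b, a) * indicator GH (b, a) \<partial>lborel) \<partial>lborel)"
    using borel_measurable_GH_ind[OF f] by (subst lborel_pair.nn_integral_snd[symmetric]) auto
  finally show ?thesis
    by (simp add: GH_def indicator_times)
qed

text \<open>Fubini for separated variables. The fundamental domain is half open; the closed
  interval, suited to the fundamental theorem of calculus, differs from it by a null point.\<close>

lemma GH_integral_product:
  fixes f g :: "real \<Rightarrow> complex"
  assumes f: "continuous_on {0..2*pi} f" and fm [measurable]: "f \<in> borel_measurable borel"
    and g: "integrable lborel g"
  shows "integrable GH_measure (\<lambda>(b, a). f b * g a)"
    "(\<integral>y. (case y of (b, a) \<Rightarrow> f b * g a) \<partial>GH_measure)
      = integral\<^sup>L lborel (\<lambda>b. indicator {0..2*pi} b *\<^sub>R f b) * integral\<^sup>L lborel g"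
proof -
  have gm [measurable]: "g \<in> borel_measurable borel"
    using g by auto
  have f1: "integrable lborel (\<lambda>b. indicator {0..2*pi} b *\<^sub>R f b)"
    using borel_integrable_atLeastAtMost'[OF f] by (simp add: set_integrable_def)
  have ae: "AE b in lborel. indicator {0..2*pi} b *\<^sub>R f b = indicator {0..<2*pi} b *\<^sub>R f b"
    using AE_lborel_singleton[of "2*pi"] by eventually_elim (auto simp: indicator_def)
  have f2: "integrable lborel (\<lambda>b. indicator {0..<2*pi} b *\<^sub>R f b)"
    using f1 by (rule integrable_cong_AE_imp) (use ae in auto)
  have f3: "(\<integral>b. indicator {0..<2*pi} b *\<^sub>R f b \<partial>lborel) = (\<integral>b. indicator {0..2*pi} b *\<^sub>R f b \<partial>lborel)"
    by (intro integral_cong_AE) (use ae in auto)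
  have fn: "integrable lborel (\<lambda>b. indicator {0..<2*pi} b * cmod (f b))"
    using integrable_norm[OF f2] by simp
  have i: "integrable (lborel \<Otimes>\<^sub>M lborel) (\<lambda>(b, a). (indicator {0..<2*pi} b *\<^sub>R f b) * g a)"
    by (rule lborel_pair.Fubini_integrable)
      (use fn f2 g in \<open>simp_all add: norm_mult mult.assoc[symmetric]\<close>)
  have eq: "indicator GH y *\<^sub>R (case y of (b, a) \<Rightarrow> f b * g a)
      = (\<lambda>(b, a). (indicator {0..<2*pi} b *\<^sub>R f b) * g a) y" for y
    by (cases y) (simp add: GH_def indicator_def)
  show "integrable GH_measure (\<lambda>(b, a). f b * g a)"
    unfolding GH_measure_def
    by (subst integrable_restrict_space) (use i in \<open>simp_all add: eq lborel_prod\<close>)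
  have "(\<integral>y. (case y of (b, a) \<Rightarrow> f b * g a) \<partial>GH_measure)
      = (\<integral>y. (\<lambda>(b, a). (indicator {0..<2*pi} b *\<^sub>R f b) * g a) y \<partial>(lborel \<Otimes>\<^sub>M lborel))"
    unfolding GH_measure_def lborel_prod eq[symmetric]
    by (subst integral_restrict_space) simp_all
  also have "\<dots> = (\<integral>b. (\<integral>a. (indicator {0..<2*pi} b *\<^sub>R f b) * g a \<partial>lborel) \<partial>lborel)"
    using lborel_pair.integral_fst'[OF i] by simp
  also have "\<dots> = (\<integral>b. indicator {0..<2*pi} b *\<^sub>R f b \<partial>lborel) * integral\<^sup>L lborel g"
    by (simp only: integral_mult_right_zero integral_mult_left_zero)
  finally show "(\<integral>y. (case y of (b, a) \<Rightarrow> f b * g a) \<partial>GH_measure)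
      = integral\<^sup>L lborel (\<lambda>b. indicator {0..2*pi} b *\<^sub>R f b) * integral\<^sup>L lborel g"
    unfolding f3 .
qed

subsection \<open>Endpoints of geodesics\<close>

definition zm :: "real \<times> real \<Rightarrow> complex" where
  "zm y = cis (fst y)"

text \<open>The limit of the geodesic as t tends to infinity, \<open>zm\<close> being the one at
  minus infinity (see \<open>geod_path\<close>). Its angle is the first component of
  \<open>SA\<close> before wrapping, so \<open>SA\<close> exchanges the endpoints.\<close>

definition zp :: "real \<times> real \<Rightarrow> complex" where
  "zp y = cis (fst y + pi + 2 * arctan (snd y))"

definition chord :: "real \<times> real \<Rightarrow> complex" where
  "chord y = zp y - zm y"

lemma norm_zm [simp]: "cmod (zm y) = 1" and norm_zp [simp]: "cmod (zp y) = 1"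
  by (simp_all add: zm_def zp_def)

lemma zm_nonzero [simp]: "zm y \<noteq> 0" and zp_nonzero [simp]: "zp y \<noteq> 0"
  by (simp_all add: zm_def zp_def)

lemma cnj_zm: "cnj (zm y) = inverse (zm y)" and cnj_zp: "cnj (zp y) = inverse (zp y)"
  by (simp_all add: zm_def zp_def cis_cnj)

lemma one_minus_ia_nonzero [simp]: "1 - \<i> * complex_of_real a \<noteq> 0"
  by (simp add: complex_eq_iff)

lemma cis_2_arctan: "cis (2 * arctan a) = (1 + \<i> * of_real a) / (1 - \<i> * of_real a)"
proof -
  have "cis (2 * arctan a) = cis (arctan a) / cis (- arctan a)"
    by (simp add: cis_divide)
  also have "cis (arctan a) = (1 + \<i> * of_real a) / sqrt (1 + a\<^sup>2)"
    by (simp add: complex_eq_iff cos_arctan sin_arctan)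
  also have "cis (- arctan a) = (1 - \<i> * of_real a) / sqrt (1 + a\<^sup>2)"
    by (simp add: complex_eq_iff cos_arctan sin_arctan)
  finally show ?thesis
    by (simp add: add_nonneg_eq_0_iff)
qed

lemma zp_eq: "zp y = - zm y * (1 + \<i> * of_real (snd y)) / (1 - \<i> * of_real (snd y))"
  by (simp add: zp_def zm_def cis_2_arctan flip: cis_mult)

lemma chord_eq: "chord y = - 2 * zm y / (1 - \<i> * of_real (snd y))"
  unfolding chord_def zp_eq by (simp add: field_simps)

lemma chord_nonzero [simp]: "chord y \<noteq> 0"
  unfolding chord_eq by simp

lemma norm_chord_sq: "(cmod (chord y))\<^sup>2 = 4 / (1 + (snd y)\<^sup>2)"
  unfolding chord_eq by (simp add: norm_divide norm_mult power_divide cmod_power2)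

text \<open>Conjugation inverts points of the unit circle, so the chord turns into 1/zp - 1/zm. The
  factor 1/(zp zm) is what later sends the index pair (j, k) to (-j - 1, -k - 1) under
  conjugation.\<close>

lemma cnj_chord: "cnj (chord y) = - chord y / (zp y * zm y)"
  unfolding chord_def by (simp add: cnj_zm cnj_zp field_simps)

lemma norm_chord_le: "cmod (chord y) \<le> 2"
  unfolding chord_def using norm_triangle_ineq4[of "zp y" "zm y"] by simp

lemma continuous_zm: "continuous_on S zm" and continuous_zp: "continuous_on S zp"
  and continuous_chord: "continuous_on S chord"
  unfolding zm_def zp_def chord_def by (intro continuous_intros)+

lemma measurable_ends [measurable]: "zm \<in> borel_measurable borel" "zp \<in> borel_measurable borel"
  "chord \<in> borel_measurable borel"
  using continuous_zm continuous_zp continuous_chord by (auto intro: borel_measurable_continuous_onI)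

lemma has_vector_derivative_cis:
  assumes "(g has_real_derivative g') (at x within S)"
  shows "((\<lambda>x. c * cis (g x)) has_vector_derivative c * (complex_of_real g' * (\<i> * cis (g x)))) (at x within S)"
  by (rule has_vector_derivative_mult_right)
    (use assms in \<open>auto simp: has_vector_derivative_complex_iff intro!: derivative_eq_intros\<close>)

lemma integral_cis_period:
  "integral\<^sup>L lborel (\<lambda>b. indicator {0..2*pi} b *\<^sub>R cis (of_int n * b)) = (if n = 0 then 2 * pi else 0)"
proof (cases "n = 0")
  case False
  have "integral\<^sup>L lborel (\<lambda>b. indicator {0..2*pi} b *\<^sub>R cis (of_int n * b))
      = cis (of_int n * (2 * pi)) / (\<i> * of_int n) - cis (of_int n * 0) / (\<i> * of_int n)"
  proof (rule integral_FTC_atLeastAtMost)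
    show "((\<lambda>b. cis (of_int n * b) / (\<i> * of_int n)) has_vector_derivative cis (of_int n * x)) (at x within {0..2*pi})" for x
    proof -
      have "((\<lambda>b. of_int n * b) has_real_derivative of_int n) (at x within {0..2*pi})"
        by (auto intro!: derivative_eq_intros)
      from has_vector_derivative_cis[OF this, of "1 / (\<i> * of_int n)"] show ?thesis
        using False by simp
    qed
  qed (auto intro!: continuous_intros)
  also have "cis (of_int n * (2 * pi)) = 1"
    using cis_multiple_2pi[of "of_int n"] by (simp add: mult_ac)
  finally show ?thesis
    using False by simp
qed (simp add: scaleR_conv_of_real)

text \<open>In the variable 2 arctan a the weight, which is |chord|^2, becomes twice the arc length
  of the circle. For n \<noteq> 0 the primitive takes the same limit at both ends, because these are
  a full turn apart.\<close>

lemma integral_cis_arctan: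
  "integrable lborel (\<lambda>a. (4 / (1 + a\<^sup>2)) *\<^sub>R cis (of_int n * (2 * arctan a)))"
  "(\<integral>a. (4 / (1 + a\<^sup>2)) *\<^sub>R cis (of_int n * (2 * arctan a)) \<partial>lborel) = (if n = 0 then 4 * pi else 0)"
proof -
  have c: "continuous_on UNIV (\<lambda>a::real. 4 / (1 + a\<^sup>2))"
    by (intro continuous_intros) (auto simp: add_nonneg_eq_0_iff)
  have bot: "((\<lambda>x. arctan x) \<longlongrightarrow> - (pi / 2)) at_bot" and top: "((\<lambda>x. arctan x) \<longlongrightarrow> pi / 2) at_top"
    by (simp_all add: tendsto_arctan_at_bot tendsto_arctan_at_top)
  have F: "((\<lambda>a. 4 * arctan a) has_real_derivative 4 / (1 + a\<^sup>2)) (at a)" for a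
    by (auto intro!: derivative_eq_intros simp: divide_inverse)
  have i: "integrable lborel (\<lambda>a::real. 4 / (1 + a\<^sup>2))"
    and e: "(\<integral>a. 4 / (1 + a\<^sup>2) \<partial>lborel) = 4 * (pi / 2) - 4 * (- (pi / 2))"
    by (rule line_FTC_nonneg[OF F c _ tendsto_mult_left[OF bot] tendsto_mult_left[OF top]];
        simp add: add_nonneg_nonneg)+
  have cc: "continuous_on UNIV (\<lambda>a. (4 / (1 + a\<^sup>2)) *\<^sub>R cis (of_int n * (2 * arctan a)))"
    by (intro continuous_intros) (auto simp: add_nonneg_eq_0_iff)
  show int: "integrable lborel (\<lambda>a. (4 / (1 + a\<^sup>2)) *\<^sub>R cis (of_int n * (2 * arctan a)))"
    by (rule Bochner_Integration.integrable_bound[OF i])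
      (use cc in \<open>auto intro!: borel_measurable_continuous_onI\<close>)
  show "(\<integral>a. (4 / (1 + a\<^sup>2)) *\<^sub>R cis (of_int n * (2 * arctan a)) \<partial>lborel) = (if n = 0 then 4 * pi else 0)"
  proof (cases "n = 0")
    case True
    have "(\<integral>a. (4 / (1 + a\<^sup>2)) *\<^sub>R (1::complex) \<partial>lborel) = (\<integral>a. 4 / (1 + a\<^sup>2) \<partial>lborel) *\<^sub>R 1"
      by (rule integral_scaleR_left) (use i in simp)
    then show ?thesis
      using True e by (simp add: scaleR_conv_of_real)
  next
    case False
    define F where "F a = 2 / (\<i> * of_int n) * cis (of_int n * (2 * arctan a))" for a
    have "(\<integral>a. (4 / (1 + a\<^sup>2)) *\<^sub>R cis (of_int n * (2 * arctan a)) \<partial>lborel)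
        = 2 / (\<i> * of_int n) * cis (of_int n * (2 * (pi / 2)))
        - 2 / (\<i> * of_int n) * cis (of_int n * (2 * (- (pi / 2))))"
    proof (rule line_FTC[OF _ cc int])
      show "(F has_vector_derivative (4 / (1 + a\<^sup>2)) *\<^sub>R cis (of_int n * (2 * arctan a))) (at a)" for a
      proof -
        have "((\<lambda>a. of_int n * (2 * arctan a)) has_real_derivative of_int n * (2 * (1 / (1 + a\<^sup>2)))) (at a)"
          by (auto intro!: derivative_eq_intros simp: divide_inverse)
        from has_vector_derivative_cis[OF this, of "2 / (\<i> * of_int n)"]
        have "((\<lambda>a. 2 / (\<i> * of_int n) * cis (of_int n * (2 * arctan a))) has_vector_derivative
          2 / (\<i> * of_int n) * (complex_of_real (of_int n * (2 * (1 / (1 + a\<^sup>2)))) * (\<i> * cis (of_int n * (2 * arctan a))))) (at a)" .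
        moreover have "2 / (\<i> * of_int n) * (complex_of_real (of_int n * (2 * X)) * (\<i> * w)) = (4 * X) *\<^sub>R w"
          for X w
          using False by (simp add: scaleR_conv_of_real field_simps)
        ultimately have "((\<lambda>a. 2 / (\<i> * of_int n) * cis (of_int n * (2 * arctan a))) has_vector_derivative
          (4 * (1 / (1 + a\<^sup>2))) *\<^sub>R cis (of_int n * (2 * arctan a))) (at a)"
          by metis
        then show ?thesis
          unfolding F_def by simp
      qed
      show "(F \<longlongrightarrow> 2 / (\<i> * of_int n) * cis (of_int n * (2 * (- (pi / 2))))) at_bot"
        unfolding F_def by (intro tendsto_intros bot)
      show "(F \<longlongrightarrow> 2 / (\<i> * of_int n) * cis (of_int n * (2 * (pi / 2)))) at_top"
        unfolding F_def by (intro tendsto_intros top)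
    qed
    also have "cis (of_int n * (2 * (pi / 2))) = cis (of_int n * (2 * (- (pi / 2)))) * cis (2 * pi * of_int n)"
      by (simp add: cis_mult algebra_simps)
    finally show ?thesis
      using False by simp
  qed
qed

definition ebasis :: "int \<Rightarrow> int \<Rightarrow> real \<times> real \<Rightarrow> complex" where
  "ebasis j k y = chord y * zp y powi j * zm y powi k"

text \<open>Separates the variables: the angle \<open>fst y\<close> carries the total degree j + k,
  while \<open>snd y\<close> enters through j alone.\<close>

lemma ends_powi: "zp y powi j * zm y powi k
    = cis (of_int (j + k) * fst y) * ((-1) powi j * cis (of_int j * (2 * arctan (snd y))))"
proof -
  have "zp y powi j * zm y powi k = cis (of_int j * (fst y + pi + 2 * arctan (snd y)) + of_int k * fst y)"
    by (simp add: zp_def zm_def cis_power_int cis_mult)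
  also have "(-1 :: complex) powi j = cis (of_int j * pi)"
    using cis_power_int[of pi j] by simp
  then have "cis (of_int j * (fst y + pi + 2 * arctan (snd y)) + of_int k * fst y)
    = cis (of_int (j + k) * fst y) * ((-1) powi j * cis (of_int j * (2 * arctan (snd y))))"
    by (simp add: cis_mult algebra_simps)
  finally show ?thesis .
qed

text \<open>The constant is 2 pi from the angle times 4 pi from the integral of |chord|^2 over the
  second variable.\<close>

lemma integral_chord_ends:
  "integrable GH_measure (\<lambda>y. complex_of_real ((cmod (chord y))\<^sup>2) * zp y powi j * zm y powi k)"
  "(\<integral>y. complex_of_real ((cmod (chord y))\<^sup>2) * zp y powi j * zm y powi k \<partial>GH_measure)
    = (if j = 0 \<and> k = 0 then 8 * pi\<^sup>2 else 0)"
proof -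
  define f where "f b = cis (of_int (j + k) * b) * (-1) powi j" for b
  define g where "g a = (4 / (1 + a\<^sup>2)) *\<^sub>R cis (of_int j * (2 * arctan a))" for a
  have eq: "complex_of_real ((cmod (chord y))\<^sup>2) * zp y powi j * zm y powi k
      = (case y of (b, a) \<Rightarrow> f b * g a)" for y
    unfolding mult.assoc ends_powi norm_chord_sq
    by (cases y) (simp add: f_def g_def scaleR_conv_of_real mult_ac)
  have f: "continuous_on S f" for S
    unfolding f_def by (intro continuous_intros)
  have fm: "f \<in> borel_measurable borel"
    using f by (rule borel_measurable_continuous_onI)
  have g: "integrable lborel g"
    unfolding g_def by (rule integral_cis_arctan)
  note p = GH_integral_product[OF f fm g]
  show "integrable GH_measure (\<lambda>y. complex_of_real ((cmod (chord y))\<^sup>2) * zp y powi j * zm y powi k)"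
    unfolding eq using p(1) by simp
  have "integral\<^sup>L lborel (\<lambda>b. indicator {0..2*pi} b *\<^sub>R f b)
      = integral\<^sup>L lborel (\<lambda>b. indicator {0..2*pi} b *\<^sub>R cis (of_int (j + k) * b)) * (-1) powi j"
    unfolding f_def by (simp flip: integral_mult_left_zero)
  also have "\<dots> = (if j + k = 0 then 2 * pi else 0) * (-1) powi j"
    unfolding integral_cis_period by simp
  finally have fi: "integral\<^sup>L lborel (\<lambda>b. indicator {0..2*pi} b *\<^sub>R f b) = (if j + k = 0 then 2 * pi else 0) * (-1) powi j" .
  have gi: "integral\<^sup>L lborel g = (if j = 0 then 4 * pi else 0)"
    unfolding g_def integral_cis_arctan(2) by simp
  show "(\<integral>y. complex_of_real ((cmod (chord y))\<^sup>2) * zp y powi j * zm y powi k \<partial>GH_measure)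
    = (if j = 0 \<and> k = 0 then 8 * pi\<^sup>2 else 0)"
    unfolding eq p(2) fi gi by (auto simp: power2_eq_square)
qed

lemma borel_measurable_cnj [measurable (raw)]:
  "f \<in> borel_measurable M \<Longrightarrow> (\<lambda>x. cnj (f x)) \<in> borel_measurable M"
  by (rule borel_measurable_continuous_on[where f = cnj]) (intro continuous_intros)

subsection \<open>The Hilbert space of square integrable functions on geodesics\<close>

definition nsq :: "(real \<times> real \<Rightarrow> complex) \<Rightarrow> real" where
  "nsq h = (\<integral>y. (cmod (h y))\<^sup>2 \<partial>GH_measure)"

lemma norm_GH_nsq: "norm_GH h = sqrt (nsq h)"
  by (simp add: norm_GH_def nsq_def)

lemma nsq_nonneg [simp]: "nsq h \<ge> 0"
  by (simp add: nsq_def)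

lemma norm_GH_nonneg [simp]: "norm_GH h \<ge> 0"
  by (simp add: norm_GH_nsq)

lemma norm_GH_sq: "(norm_GH h)\<^sup>2 = nsq h"
  by (simp add: norm_GH_nsq)

lemma L2_measurable [measurable_dest]: "h \<in> L2_GH \<Longrightarrow> h \<in> borel_measurable GH_measure"
  by (simp add: L2_GH_def)

lemma L2_integrable: "h \<in> L2_GH \<Longrightarrow> integrable GH_measure (\<lambda>y. (cmod (h y))\<^sup>2)"
  by (simp add: L2_GH_def)

lemma L2_scale: "h \<in> L2_GH \<Longrightarrow> (\<lambda>y. c * h y) \<in> L2_GH"
  by (auto simp: L2_GH_def norm_mult power_mult_distrib)

lemma L2_cnj: "h \<in> L2_GH \<Longrightarrow> (\<lambda>y. cnj (h y)) \<in> L2_GH"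
  by (auto simp: L2_GH_def intro!: borel_measurable_cnj)

lemma norm_add_sq_le: "(norm (x + y))\<^sup>2 \<le> 2 * (norm x)\<^sup>2 + 2 * (norm y)\<^sup>2"
proof -
  have "(norm (x + y))\<^sup>2 \<le> (norm x + norm y)\<^sup>2"
    by (intro power_mono norm_triangle_ineq) simp
  also have "\<dots> \<le> 2 * (norm x)\<^sup>2 + 2 * (norm y)\<^sup>2"
    using sum_squares_bound[of "norm x" "norm y"] by (simp add: power2_sum)
  finally show ?thesis .
qed

lemma L2_add:
  assumes "f \<in> L2_GH" "g \<in> L2_GH"
  shows "(\<lambda>y. f y + g y) \<in> L2_GH"
proof -
  have [measurable]: "f \<in> borel_measurable GH_measure" "g \<in> borel_measurable GH_measure"
    using assms by (auto simp: L2_GH_def)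
  have "integrable GH_measure (\<lambda>y. (cmod (f y + g y))\<^sup>2)"
  proof (rule Bochner_Integration.integrable_bound)
    show "integrable GH_measure (\<lambda>y. 2 * (cmod (f y))\<^sup>2 + 2 * (cmod (g y))\<^sup>2)"
      using assms by (auto simp: L2_GH_def)
    show "AE y in GH_measure. norm ((cmod (f y + g y))\<^sup>2) \<le> norm (2 * (cmod (f y))\<^sup>2 + 2 * (cmod (g y))\<^sup>2)"
      by (intro AE_I2) (simp add: norm_add_sq_le)
  qed measurable
  then show ?thesis
    by (simp add: L2_GH_def)
qed

lemma L2_diff:
  assumes "f \<in> L2_GH" "g \<in> L2_GH"
  shows "(\<lambda>y. f y - g y) \<in> L2_GH"
  using L2_add[OF assms(1) L2_scale[OF assms(2), of "-1"]] by simp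

lemma L2_zero: "(\<lambda>y. 0) \<in> L2_GH"
  by (simp add: L2_GH_def)

lemma L2_sum: "(\<And>i. i \<in> T \<Longrightarrow> F i \<in> L2_GH) \<Longrightarrow> (\<lambda>y. \<Sum>i\<in>T. F i y) \<in> L2_GH"
  by (induction T rule: infinite_finite_induct) (auto simp: L2_zero L2_add)

lemma L2_mult_integrable:
  assumes "f \<in> L2_GH" "g \<in> L2_GH"
  shows "integrable GH_measure (\<lambda>y. f y * g y)"
proof (rule Bochner_Integration.integrable_bound)
  show "integrable GH_measure (\<lambda>y. (cmod (f y))\<^sup>2 + (cmod (g y))\<^sup>2)"
    using assms by (auto simp: L2_GH_def)
  show "(\<lambda>y. f y * g y) \<in> borel_measurable GH_measure"
    using assms by (auto simp: L2_GH_def)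
  have "cmod (f y) * cmod (g y) \<le> (cmod (f y))\<^sup>2 + (cmod (g y))\<^sup>2" for y
    using sum_squares_bound[of "cmod (f y)" "cmod (g y)"]
      mult_nonneg_nonneg[OF norm_ge_zero norm_ge_zero, of "f y" "g y"]
    by linarith
  then show "AE y in GH_measure. norm (f y * g y) \<le> norm ((cmod (f y))\<^sup>2 + (cmod (g y))\<^sup>2)"
    by (intro AE_I2) (simp add: norm_mult)
qed

lemma inner_GH_add: "f \<in> L2_GH \<Longrightarrow> g \<in> L2_GH \<Longrightarrow> h \<in> L2_GH \<Longrightarrow>
    inner_GH (\<lambda>y. f y + g y) h = inner_GH f h + inner_GH g h"
  unfolding inner_GH_def by (simp add: distrib_right L2_mult_integrable L2_cnj)

lemma inner_GH_diff: "f \<in> L2_GH \<Longrightarrow> g \<in> L2_GH \<Longrightarrow> h \<in> L2_GH \<Longrightarrow>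
    inner_GH (\<lambda>y. f y - g y) h = inner_GH f h - inner_GH g h"
  unfolding inner_GH_def by (simp add: left_diff_distrib L2_mult_integrable L2_cnj)

lemma inner_GH_scale: "inner_GH (\<lambda>y. c * f y) h = c * inner_GH f h"
  unfolding inner_GH_def by (simp add: mult.assoc)

lemma inner_GH_commute: "inner_GH g f = cnj (inner_GH f g)"
  unfolding inner_GH_def Bochner_Integration.integral_cnj[symmetric] by (simp add: mult.commute del: Bochner_Integration.integral_cnj)

lemma inner_GH_cnj: "inner_GH (\<lambda>y. cnj (f y)) (\<lambda>y. cnj (g y)) = cnj (inner_GH f g)"
  unfolding inner_GH_def Bochner_Integration.integral_cnj[symmetric] by (simp del: Bochner_Integration.integral_cnj)

lemma inner_GH_sum:
  assumes "\<And>i. i \<in> T \<Longrightarrow> F i \<in> L2_GH" "h \<in> L2_GH"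
  shows "inner_GH (\<lambda>y. \<Sum>i\<in>T. F i y) h = (\<Sum>i\<in>T. inner_GH (F i) h)"
  using assms
proof (induction T rule: infinite_finite_induct)
  case (insert i T)
  then show ?case
    by (simp add: inner_GH_add L2_sum)
qed (simp_all add: inner_GH_def)

lemma inner_GH_self: "inner_GH h h = complex_of_real (nsq h)"
  unfolding inner_GH_def nsq_def complex_norm_square[symmetric] by (rule integral_complex_of_real)

lemma nsq_scale: "nsq (\<lambda>y. c * h y) = (cmod c)\<^sup>2 * nsq h"
  unfolding nsq_def by (simp add: norm_mult power_mult_distrib)

lemma norm_GH_scale: "norm_GH (\<lambda>y. c * h y) = cmod c * norm_GH h"
  by (simp add: norm_GH_nsq nsq_scale real_sqrt_mult)

lemma nsq_diff:
  assumes f: "f \<in> L2_GH" and g: "g \<in> L2_GH"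
  shows "nsq (\<lambda>y. f y - g y) = nsq f + nsq g - 2 * Re (inner_GH f g)"
proof -
  note d = L2_diff[OF f g]
  have "complex_of_real (nsq (\<lambda>y. f y - g y)) = inner_GH f (\<lambda>y. f y - g y) - inner_GH g (\<lambda>y. f y - g y)"
    unfolding inner_GH_self[symmetric] by (rule inner_GH_diff[OF f g d])
  also have "\<dots> = cnj (inner_GH f f - inner_GH g f) - cnj (inner_GH f g - inner_GH g g)"
    unfolding inner_GH_commute[of _ "\<lambda>y. f y - g y"] inner_GH_diff[OF f g f] inner_GH_diff[OF f g g] ..
  also have "\<dots> = complex_of_real (nsq f) + complex_of_real (nsq g) - (inner_GH f g + cnj (inner_GH f g))"
    unfolding inner_GH_commute[of g f] inner_GH_self by simp
  finally show ?thesis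
    by (simp add: complex_eq_iff)
qed

lemma nsq_eq_0_AE:
  assumes "h \<in> L2_GH" "nsq h = 0"
  shows "AE y in GH_measure. h y = 0"
proof -
  have "AE y in GH_measure. (cmod (h y))\<^sup>2 = 0"
    using integral_nonneg_eq_0_iff_AE[OF L2_integrable[OF assms(1)]] assms(2) by (simp add: nsq_def)
  then show ?thesis by simp
qed

lemma inner_GH_AE_cong:
  assumes "f \<in> L2_GH" "g \<in> L2_GH" "h \<in> L2_GH" "AE y in GH_measure. f y = g y"
  shows "inner_GH f h = inner_GH g h"
  unfolding inner_GH_def
  by (rule integral_cong_AE) (use assms in \<open>auto simp: L2_GH_def intro!: borel_measurable_times borel_measurable_cnj\<close>)

lemma Cauchy_Schwarz_GH:
  assumes f: "f \<in> L2_GH" and g: "g \<in> L2_GH"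
  shows "cmod (inner_GH f g) \<le> norm_GH f * norm_GH g"
proof (cases "nsq g = 0")
  case True
  then have "AE y in GH_measure. g y = 0"
    using nsq_eq_0_AE g by blast
  then have "inner_GH g f = inner_GH (\<lambda>y. 0) f"
    by (intro inner_GH_AE_cong g f L2_zero)
  then have "inner_GH f g = 0"
    by (subst inner_GH_commute) (simp add: inner_GH_def)
  then show ?thesis by simp
next
  case False
  then have pos: "nsq g > 0"
    using nsq_nonneg[of g] by linarith
  define c where "c = inner_GH f g / complex_of_real (nsq g)"
  have "0 \<le> nsq (\<lambda>y. f y - c * g y)"
    by simp
  also have "\<dots> = nsq f + (cmod c)\<^sup>2 * nsq g - 2 * Re (inner_GH f (\<lambda>y. c * g y))"
    using nsq_diff[OF f L2_scale[OF g]] by (simp add: nsq_scale)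
  also have "inner_GH f (\<lambda>y. c * g y) = cnj c * inner_GH f g"
    by (subst inner_GH_commute) (simp add: inner_GH_scale inner_GH_commute[of g f])
  also have "cnj c * inner_GH f g = complex_of_real ((cmod (inner_GH f g))\<^sup>2 / nsq g)"
    unfolding c_def of_real_divide complex_norm_square by (simp add: mult.commute)
  also have "(cmod c)\<^sup>2 * nsq g = (cmod (inner_GH f g))\<^sup>2 / nsq g"
    unfolding c_def using pos by (simp add: norm_divide power_divide power2_eq_square)
  finally have "(cmod (inner_GH f g))\<^sup>2 / nsq g \<le> nsq f"
    by simp
  then have "(cmod (inner_GH f g))\<^sup>2 \<le> nsq f * nsq g"
    using pos by (simp add: field_simps)
  also have "\<dots> = (norm_GH f * norm_GH g)\<^sup>2"
    by (simp add: power_mult_distrib norm_GH_sq)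
  finally show ?thesis
    by (rule power2_le_imp_le) simp
qed

lemma norm_GH_uminus: "norm_GH (\<lambda>y. - h y) = norm_GH h"
  using norm_GH_scale[of "-1" h] by simp

lemma norm_GH_diff_commute: "norm_GH (\<lambda>y. f y - g y) = norm_GH (\<lambda>y. g y - f y)"
  using norm_GH_uminus[of "\<lambda>y. f y - g y"] by simp

lemma L2_ebasis: "ebasis j k \<in> L2_GH"
proof -
  have "(cmod (ebasis j k y))\<^sup>2 = Re (complex_of_real ((cmod (chord y))\<^sup>2) * zp y powi 0 * zm y powi 0)" for y
    by (simp add: ebasis_def norm_mult norm_power_int)
  then have "integrable GH_measure (\<lambda>y. (cmod (ebasis j k y))\<^sup>2)"
    using integral_chord_ends(1)[of 0 0] by (simp only: integrable_Re)
  moreover have "ebasis j k \<in> borel_measurable borel"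
  proof (rule borel_measurable_continuous_onI)
    show "continuous_on UNIV (ebasis j k)"
      unfolding ebasis_def by (intro continuous_intros continuous_zm continuous_zp continuous_chord) simp_all
  qed
  ultimately show ?thesis
    by (simp add: L2_GH_def borel_measurable_GH)
qed

lemma chord_eq_ebasis: "chord = ebasis 0 0"
  by (simp add: ebasis_def fun_eq_iff)

lemma chord_L2: "chord \<in> L2_GH"
  unfolding chord_eq_ebasis by (rule L2_ebasis)

lemma inner_ebasis:
  "inner_GH (ebasis j k) (ebasis j' k') = (if j = j' \<and> k = k' then 8 * pi\<^sup>2 else 0)"
proof -
  have "ebasis j k y * cnj (ebasis j' k' y)
      = complex_of_real ((cmod (chord y))\<^sup>2) * zp y powi (j - j') * zm y powi (k - k')" for y
    by (simp only: ebasis_def complex_norm_square complex_cnj_mult complex_cnj_power_int cnj_zp cnj_zm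
        power_int_inverse power_int_minus[symmetric] power_int_diff zp_nonzero zm_nonzero
        divide_inverse simp_thms refl mult_ac not_False_eq_True)
  then show ?thesis
    unfolding inner_GH_def using integral_chord_ends(2)[of "j - j'" "k - k'"] by simp
qed

text \<open>Inverts \<open>cis\<close> on the fundamental domain by a Borel formula: the half-angle
  tangent gives the angle in (-pi, pi), the lower half circle is moved up by 2 pi, and the point -1,
  where the tangent is infinite, is listed by hand.\<close>

lemma cis_half_tan:
  assumes "0 \<le> b" "b < 2 * pi"
  shows "(if Re (cis b) = - 1 then pi else 2 * arctan (Im (cis b) / (1 + Re (cis b)))
      + (if Im (cis b) < 0 then 2 * pi else 0)) = b"
proof (cases "b = pi")
  case False
  have half: "tan (b / 2) = sin b / (1 + cos b)"
    using tan_half[of "b/2"] by (simp add: add.commute)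
  consider "b < pi" | "b > pi" using False by linarith
  then show ?thesis
  proof cases
    case 1
    have "cos b > cos pi"
      using 1 assms by (intro cos_monotone_0_pi) auto
    moreover have "sin b \<ge> 0"
      using 1 assms by (intro sin_ge_zero) auto
    moreover have "arctan (tan (b / 2)) = b / 2"
      using 1 assms by (intro arctan_tan) auto
    ultimately show ?thesis
      using half by simp
  next
    case 2
    have "cos (2 * pi - b) > cos pi"
      using 2 assms by (intro cos_monotone_0_pi) auto
    then have "cos b > - 1"
      by (simp add: cos_diff)
    moreover have "sin b < 0"
      using 2 assms by (intro sin_lt_zero) auto
    moreover have "arctan (tan (b / 2 - pi)) = b / 2 - pi"
      using 2 assms by (intro arctan_tan) auto
    moreover have "tan (b / 2 - pi) = tan (b / 2)"
      by (simp add: tan_def sin_diff cos_diff)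
    ultimately show ?thesis
      using half by simp
  qed
qed simp

text \<open>The product of h with the conjugate chord is integrable and all its moments in the
  endpoints vanish, so its integral over every set pulled back from the torus is zero. The endpoint
  map has a Borel left inverse on \<open>GH\<close>, so every measurable set is of this kind, and
  \<open>chord\<close> has no zeros.\<close>

lemma ebasis_total:
  assumes h: "h \<in> L2_GH" and z: "\<And>j k. inner_GH h (ebasis j k) = 0"
  shows "AE y in GH_measure. h y = 0"
proof -
  define f where "f y = h y * cnj (chord y)" for y
  have fi: "integrable GH_measure f"
    unfolding f_def by (rule L2_mult_integrable[OF h L2_cnj[OF chord_L2]])
  define T where "T y = (zp y, zm y)" for y
  have "T \<in> borel_measurable borel"
    unfolding T_def by measurable
  then have Tm: "T \<in> borel_measurable GH_measure"
    by (rule borel_measurable_GH)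
  have zero: "(\<integral>y. f y * indicator A (T y) \<partial>GH_measure) = 0" if A: "A \<in> sets borel" for A
  proof -
    have "(\<integral>y. f y * indicator A (T y) \<partial>GH_measure) = (\<integral>y. 0 * indicator A (T y) \<partial>GH_measure)"
    proof (rule moments_determine[OF fi _ Tm Tm _ _ _ A, where R = 2])
      show "norm (T y) \<le> 2" for y
        using norm_Pair_le[of "zp y" "zm y"] by (simp add: T_def)
      then show "norm (T y) \<le> 2" for y .
      fix a b c d :: nat
      \<comment> \<open>On the circle conjugates are inverses, so the exponents of each endpoint
        combine into one integer power; the conjugation on the right reverses its sign.\<close>
      have *: "f y * (fst (T y) ^ a * cnj (fst (T y)) ^ b * (snd (T y) ^ c * cnj (snd (T y)) ^ d))
          = h y * cnj (ebasis (int b - int a) (int d - int c) y)" for y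
        by (simp add: f_def T_def ebasis_def cnj_zp cnj_zm power_int_diff power_inverse
            complex_cnj_power_int power_int_inverse field_simps)
      show "(\<integral>y. f y * (fst (T y) ^ a * cnj (fst (T y)) ^ b * (snd (T y) ^ c * cnj (snd (T y)) ^ d)) \<partial>GH_measure)
        = (\<integral>y. 0 * (fst (T y) ^ a * cnj (fst (T y)) ^ b * (snd (T y) ^ c * cnj (snd (T y)) ^ d)) \<partial>GH_measure)"
        unfolding * using z by (simp add: inner_GH_def)
    qed simp
    then show ?thesis by simp
  qed
  define g where "g w = (if Re w = - 1 then pi else 2 * arctan (Im w / (1 + Re w))
      + (if Im w < 0 then 2 * pi else 0))" for w
  \<comment> \<open>\<open>g\<close> recovers the angle of \<open>zm\<close>, and the half-angle
    tangent of \<open>- zp / zm\<close> recovers the second coordinate.\<close>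
  define S where "S p = (g (snd p), Im (- fst p / snd p) / (1 + Re (- fst p / snd p)))" for p
  have [measurable]: "g \<in> borel_measurable borel"
    unfolding g_def by measurable
  have [measurable]: "(fst :: complex \<times> complex \<Rightarrow> complex) \<in> borel_measurable borel"
    "(snd :: complex \<times> complex \<Rightarrow> complex) \<in> borel_measurable borel"
    by (intro borel_measurable_continuous_onI continuous_intros)+
  have Sm: "S \<in> borel_measurable borel"
    unfolding S_def by (intro borel_measurable_Pair) measurable
  have ST: "S (T y) = y" if "y \<in> GH" for y
  proof -
    have "- zp y / zm y = cis (2 * arctan (snd y))"
      by (simp add: zp_eq zm_def cis_2_arctan)
    then have "Im (- zp y / zm y) / (1 + Re (- zp y / zm y)) = tan (arctan (snd y))"
      using tan_half[of "arctan (snd y)"] by (simp add: add.commute del: tan_arctan)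
    moreover have "g (zm y) = fst y"
      unfolding g_def zm_def using that by (intro cis_half_tan) (auto simp: GH_def)
    ultimately show ?thesis
      unfolding S_def T_def by (simp add: prod_eq_iff tan_arctan)
  qed
  have "AE y in GH_measure. f y = 0"
  proof (rule AE_zero_if_set_integrals_zero[OF fi])
    fix B assume B: "B \<in> sets GH_measure"
    then have "B \<in> sets borel"
      using GH_measurable by (auto simp: GH_measure_def sets_restrict_space)
    then have A: "S -` B \<in> sets borel"
      using Sm by (simp add: measurable_def)
    have "(\<integral>y. f y * indicator B y \<partial>GH_measure) = (\<integral>y. f y * indicator (S -` B) (T y) \<partial>GH_measure)"
      by (rule Bochner_Integration.integral_cong) (auto simp: GH_measure_def space_restrict_space ST indicator_def)
    then show "(\<integral>y. f y * indicator B y \<partial>GH_measure) = 0"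
      using zero[OF A] by simp
  qed
  then show ?thesis
    by (rule AE_mp) (simp add: f_def)
qed


section \<open>Completeness and Fourier series\<close>

lemma L2_real: "f \<in> L2_GH \<Longrightarrow> (\<lambda>y. complex_of_real (cmod (f y))) \<in> L2_GH"
  by (auto simp: L2_GH_def)

lemma integral_norm_mult_le:
  assumes "f \<in> L2_GH" "g \<in> L2_GH"
  shows "(\<integral>y. cmod (f y) * cmod (g y) \<partial>GH_measure) \<le> norm_GH f * norm_GH g"
proof -
  have "inner_GH (\<lambda>y. complex_of_real (cmod (f y))) (\<lambda>y. complex_of_real (cmod (g y)))
      = complex_of_real (\<integral>y. cmod (f y) * cmod (g y) \<partial>GH_measure)"
    unfolding inner_GH_def integral_complex_of_real[symmetric] by simp
  then have "\<bar>\<integral>y. cmod (f y) * cmod (g y) \<partial>GH_measure\<bar>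
      \<le> norm_GH (\<lambda>y. complex_of_real (cmod (f y))) * norm_GH (\<lambda>y. complex_of_real (cmod (g y)))"
    using Cauchy_Schwarz_GH[OF L2_real L2_real, OF assms] by simp
  then show ?thesis
    by (simp add: norm_GH_def)
qed

text \<open>Riesz-Fischer: a subsequence with geometrically small steps converges almost everywhere,
  and Fatou's lemma bounds the distance to the limit. The space of geodesics has infinite measure,
  so the sum of the steps is controlled in L^1 after multiplication with \<open>chord\<close>, a
  square integrable function without zeros.\<close>

lemma L2_complete:
  fixes S :: "nat \<Rightarrow> real \<times> real \<Rightarrow> complex"
  assumes S: "\<And>n. S n \<in> L2_GH"
    and Cauchy: "\<And>e. e > 0 \<Longrightarrow> \<exists>N. \<forall>m\<ge>N. \<forall>n\<ge>N. norm_GH (\<lambda>y. S m y - S n y) < e"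
  obtains g where "g \<in> L2_GH" "\<And>e. e > 0 \<Longrightarrow> \<exists>N. \<forall>n\<ge>N. norm_GH (\<lambda>y. g y - S n y) \<le> e"
proof -
  have [measurable]: "S n \<in> borel_measurable GH_measure" for n
    using S by auto
  define Q where "Q k N \<longleftrightarrow> (\<forall>m\<ge>N. \<forall>n\<ge>N. norm_GH (\<lambda>y. S m y - S n y) < (1/2) ^ k)" for k and N :: nat
  have "\<exists>N. Q k N" for k
    unfolding Q_def using Cauchy[of "(1/2)^k"] by simp
  then obtain s where s: "Q k (s k)" for k
    by metis
  \<comment> \<open>Partial sums make the indices monotone while keeping \<open>r k\<close> at least
    \<open>s k\<close>.\<close>
  define r where "r k = (\<Sum>i\<le>k. s i)" for k
  have r_mono: "r k \<le> r (Suc k)" and r_ge: "r k \<ge> s k" for k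
    unfolding r_def by (simp_all add: member_le_sum)
  have r_close: "norm_GH (\<lambda>y. S (r (Suc k)) y - S (r k) y) \<le> (1/2) ^ k" for k
    using s[of k] r_mono[of k] r_ge[of k] unfolding Q_def by (meson le_trans less_imp_le order_refl)
  define D where "D k y = S (r (Suc k)) y - S (r k) y" for k y
  have DL2: "D k \<in> L2_GH" for k
    unfolding D_def by (intro L2_diff S)
  have [measurable]: "D k \<in> borel_measurable GH_measure" for k
    using DL2 by auto
  have [measurable]: "chord \<in> borel_measurable GH_measure"
    using chord_L2 by (rule L2_measurable)
  have Dint: "integrable GH_measure (\<lambda>y. cmod (D k y) * cmod (chord y))" for k
    using integrable_norm[OF L2_mult_integrable[OF DL2 chord_L2]] by (simp add: norm_mult)
  have "(\<integral>\<^sup>+y. (\<Sum>k. ennreal (cmod (D k y) * cmod (chord y))) \<partial>GH_measure)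
      = (\<Sum>k. \<integral>\<^sup>+y. ennreal (cmod (D k y) * cmod (chord y)) \<partial>GH_measure)"
    by (rule nn_integral_suminf) measurable
  also have "\<dots> \<le> (\<Sum>k. ennreal ((1/2) ^ k * norm_GH chord))"
  proof (intro suminf_le allI)
    fix k
    have "(\<integral>\<^sup>+y. ennreal (cmod (D k y) * cmod (chord y)) \<partial>GH_measure)
        = ennreal (\<integral>y. cmod (D k y) * cmod (chord y) \<partial>GH_measure)"
      by (rule nn_integral_eq_integral[OF Dint]) simp
    also have "\<dots> \<le> ennreal ((1/2) ^ k * norm_GH chord)"
    proof (rule ennreal_leI)
      have "norm_GH (D k) * norm_GH chord \<le> (1/2) ^ k * norm_GH chord"
        using r_close[of k] unfolding D_def[abs_def] by (intro mult_right_mono) simp_all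
      with integral_norm_mult_le[OF DL2[of k] chord_L2]
      show "(\<integral>y. cmod (D k y) * cmod (chord y) \<partial>GH_measure) \<le> (1/2) ^ k * norm_GH chord"
        by linarith
    qed
    finally show "(\<integral>\<^sup>+y. ennreal (cmod (D k y) * cmod (chord y)) \<partial>GH_measure)
      \<le> ennreal ((1/2) ^ k * norm_GH chord)" .
  qed auto
  also have "\<dots> < \<infinity>"
  proof -
    have "summable (\<lambda>k. (1/2::real) ^ k * norm_GH chord)"
      by (intro summable_mult2 summable_geometric) simp
    then show ?thesis
      by (subst suminf_ennreal2) auto
  qed
  finally have "AE y in GH_measure. (\<Sum>k. ennreal (cmod (D k y) * cmod (chord y))) \<noteq> \<infinity>"
    by (intro nn_integral_PInf_AE) auto
  then have conv: "AE y in GH_measure. convergent (\<lambda>k. S (r k) y)"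
  proof eventually_elim
    case (elim y)
    have "summable (\<lambda>k. cmod (D k y) * cmod (chord y))"
      by (rule summable_suminf_not_top) (use elim in auto)
    then have "summable (\<lambda>k. cmod (D k y) * cmod (chord y) * (1 / cmod (chord y)))"
      by (rule summable_mult2)
    then have "summable (\<lambda>k. cmod (D k y))"
      by simp
    then have "summable (\<lambda>k. D k y)"
      by (rule summable_norm_cancel)
    then have "convergent (\<lambda>n. \<Sum>k<n. D k y)"
      by (simp add: summable_iff_convergent)
    then have "convergent (\<lambda>n. S (r 0) y + (\<Sum>k<n. D k y))"
      by (intro convergent_add convergent_const)
    moreover have "S (r 0) y + (\<Sum>k<n. D k y) = S (r n) y" for n
      unfolding D_def by (subst sum_lessThan_telescope) simp
    ultimately show ?case
      by simp
  qed
  define g where "g y = lim (\<lambda>k. S (r k) y)" for y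
  have [measurable]: "g \<in> borel_measurable GH_measure"
    unfolding g_def by measurable
  have lim: "AE y in GH_measure. (\<lambda>k. S (r k) y) \<longlonglongrightarrow> g y"
    using conv by eventually_elim (simp add: g_def convergent_LIMSEQ_iff)
  have r_large: "\<forall>\<^sub>F k in sequentially. r k \<ge> N" if "\<And>k. r k \<ge> k" for N
    by (rule eventually_sequentiallyI[of N]) (meson that le_trans)
  have close: "(\<lambda>y. g y - S n y) \<in> L2_GH \<and> norm_GH (\<lambda>y. g y - S n y) \<le> e"
    if e: "e > 0" and N: "\<forall>\<^sub>F k in sequentially. norm_GH (\<lambda>y. S (r k) y - S n y) < e" for e n
  proof -
    have "(\<integral>\<^sup>+y. ennreal ((cmod (g y - S n y))\<^sup>2) \<partial>GH_measure)
        = (\<integral>\<^sup>+y. liminf (\<lambda>k. ennreal ((cmod (S (r k) y - S n y))\<^sup>2)) \<partial>GH_measure)"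
    proof (rule nn_integral_cong_AE)
      show "AE y in GH_measure. ennreal ((cmod (g y - S n y))\<^sup>2) = liminf (\<lambda>k. ennreal ((cmod (S (r k) y - S n y))\<^sup>2))"
        using lim
      proof eventually_elim
        case (elim y)
        have "(\<lambda>k. ennreal ((cmod (S (r k) y - S n y))\<^sup>2)) \<longlonglongrightarrow> ennreal ((cmod (g y - S n y))\<^sup>2)"
          by (intro tendsto_intros elim)
        from lim_imp_Liminf[OF sequentially_bot this] show ?case
          by simp
      qed
    qed
    also have "\<dots> \<le> liminf (\<lambda>k. \<integral>\<^sup>+y. ennreal ((cmod (S (r k) y - S n y))\<^sup>2) \<partial>GH_measure)"
      by (rule nn_integral_liminf) measurable
    also have "\<dots> \<le> liminf (\<lambda>k::nat. ennreal (e\<^sup>2))"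
    proof (rule Liminf_mono)
      show "\<forall>\<^sub>F k in sequentially. (\<integral>\<^sup>+y. ennreal ((cmod (S (r k) y - S n y))\<^sup>2) \<partial>GH_measure) \<le> ennreal (e\<^sup>2)"
        using N
      proof eventually_elim
        case (elim k)
        have "(\<integral>\<^sup>+y. ennreal ((cmod (S (r k) y - S n y))\<^sup>2) \<partial>GH_measure)
            = ennreal (nsq (\<lambda>y. S (r k) y - S n y))"
          unfolding nsq_def by (rule nn_integral_eq_integral[OF L2_integrable[OF L2_diff[OF S S]]]) simp
        also have "\<dots> \<le> ennreal (e\<^sup>2)"
          unfolding norm_GH_sq[symmetric] using elim by (intro ennreal_leI power_mono) auto
        finally show ?case .
      qed
    qed
    also have "\<dots> = ennreal (e\<^sup>2)"
      by (simp add: Liminf_const)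
    finally have le: "(\<integral>\<^sup>+y. ennreal ((cmod (g y - S n y))\<^sup>2) \<partial>GH_measure) \<le> ennreal (e\<^sup>2)" .
    then have i: "integrable GH_measure (\<lambda>y. (cmod (g y - S n y))\<^sup>2)"
      by (intro integrableI_bounded) (auto simp: le_less_trans[OF _ ennreal_less_top])
    have "ennreal (nsq (\<lambda>y. g y - S n y)) \<le> ennreal (e\<^sup>2)"
      unfolding nsq_def using le nn_integral_eq_integral[OF i] by simp
    then have "nsq (\<lambda>y. g y - S n y) \<le> e\<^sup>2"
      by (simp add: ennreal_le_iff)
    then have "norm_GH (\<lambda>y. g y - S n y) \<le> e"
      unfolding norm_GH_nsq using e by (intro real_le_lsqrt) auto
    then show ?thesis
      using i by (simp add: L2_GH_def)
  qed
  have ev: "\<exists>N. \<forall>n\<ge>N. \<forall>\<^sub>F k in sequentially. norm_GH (\<lambda>y. S (r k) y - S n y) < e" if e: "e > 0" for e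
  proof -
    obtain k0 where k0: "(1/2::real) ^ k0 < e"
      using real_arch_pow_inv[OF e, of "1/2"] by auto
    have "mono r"
      using r_mono by (simp add: mono_iff_le_Suc)
    have "norm_GH (\<lambda>y. S (r k) y - S n y) < e" if "n \<ge> s k0" "k \<ge> k0" for n k
    proof -
      have "r k \<ge> s k0"
        using monoD[OF \<open>mono r\<close> that(2)] r_ge[of k0] by simp
      then show ?thesis
        using s[of k0] that(1) k0 unfolding Q_def by (meson less_trans)
    qed
    then show ?thesis
      by (intro exI[of _ "s k0"]) (auto intro: eventually_sequentiallyI[of k0])
  qed
  obtain n where "\<forall>\<^sub>F k in sequentially. norm_GH (\<lambda>y. S (r k) y - S n y) < 1"
    using ev[of 1] by auto
  then have "(\<lambda>y. g y - S n y) \<in> L2_GH"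
    using close[of 1 n] by simp
  then have "g \<in> L2_GH"
    using L2_add[OF _ S[of n]] by fastforce
  moreover have "\<exists>N. \<forall>n\<ge>N. norm_GH (\<lambda>y. g y - S n y) \<le> e" if "e > 0" for e
    using ev[OF that] close[OF that] by blast
  ultimately show ?thesis
    using that by blast
qed

lemma nsq_ebasis_sum:
  assumes "finite T"
  shows "nsq (\<lambda>y. \<Sum>(j,k)\<in>T. c j k * ebasis j k y) = 8 * pi\<^sup>2 * (\<Sum>(j,k)\<in>T. (cmod (c j k))\<^sup>2)"
    and "inner_GH (\<lambda>y. \<Sum>(j,k)\<in>T. c j k * ebasis j k y) (ebasis j' k')
      = (if (j', k') \<in> T then c j' k' * (8 * pi\<^sup>2) else 0)"
proof -
  let ?s = "\<lambda>y. \<Sum>(j,k)\<in>T. c j k * ebasis j k y"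
  have L: "(\<lambda>y. case i of (j, k) \<Rightarrow> c j k * ebasis j k y) \<in> L2_GH" for i
    by (cases i) (simp add: L2_scale L2_ebasis)
  have *: "inner_GH (\<lambda>y. case i of (j, k) \<Rightarrow> c j k * ebasis j k y) h
      = (case i of (j, k) \<Rightarrow> c j k * inner_GH (ebasis j k) h)" for i h
    by (cases i) (simp add: inner_GH_scale)
  show coef: "inner_GH ?s (ebasis j' k') = (if (j', k') \<in> T then c j' k' * (8 * pi\<^sup>2) else 0)" for j' k'
  proof -
    have "inner_GH ?s (ebasis j' k') = (\<Sum>(j,k)\<in>T. c j k * inner_GH (ebasis j k) (ebasis j' k'))"
      by (subst inner_GH_sum[OF L L2_ebasis]) (simp add: *)
    also have "\<dots> = (\<Sum>i\<in>T. if i = (j', k') then c j' k' * (8 * pi\<^sup>2) else 0)"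
      by (intro sum.cong refl) (auto simp: inner_ebasis split: if_splits)
    finally show ?thesis
      using assms by simp
  qed
  have "complex_of_real (nsq ?s) = inner_GH ?s ?s"
    by (simp add: inner_GH_self)
  also have "\<dots> = (\<Sum>(j,k)\<in>T. c j k * inner_GH (ebasis j k) ?s)"
    by (subst inner_GH_sum[OF L L2_sum[OF L]]) (simp add: *)
  also have "\<dots> = (\<Sum>(j,k)\<in>T. complex_of_real (8 * pi\<^sup>2 * (cmod (c j k))\<^sup>2))"
  proof (intro sum.cong refl)
    fix i assume "i \<in> T"
    then show "(case i of (j, k) \<Rightarrow> c j k * inner_GH (ebasis j k) ?s)
        = (case i of (j, k) \<Rightarrow> complex_of_real (8 * pi\<^sup>2 * (cmod (c j k))\<^sup>2))"
      by (cases i) (simp add: inner_GH_commute[of "ebasis _ _" ?s] coef complex_norm_square mult_ac del: of_real_power)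
  qed
  also have "\<dots> = complex_of_real (8 * pi\<^sup>2 * (\<Sum>(j,k)\<in>T. (cmod (c j k))\<^sup>2))"
    by (simp add: sum_distrib_left split_def)
  finally show "nsq ?s = 8 * pi\<^sup>2 * (\<Sum>(j,k)\<in>T. (cmod (c j k))\<^sup>2)"
    using of_real_eq_iff by blast
qed

definition fourier_sum :: "(real \<times> real \<Rightarrow> complex) \<Rightarrow> (int \<times> int) set \<Rightarrow> real \<times> real \<Rightarrow> complex" where
  "fourier_sum h T = (\<lambda>y. \<Sum>(j,k)\<in>T. (inner_GH h (ebasis j k) / (8 * pi\<^sup>2)) * ebasis j k y)"

lemma L2_fourier_sum: "fourier_sum h T \<in> L2_GH"
  unfolding fourier_sum_def by (rule L2_sum) (auto simp: L2_scale L2_ebasis simp del: times_divide_eq_left)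

text \<open>The boxes are finite, exhaust the lattice and are invariant under exchange of the two
  indices; the last property turns partial sums of even functions into combinations of
  \<open>ebasis_even\<close>.\<close>

definition lattice_box :: "nat \<Rightarrow> (int \<times> int) set" where
  "lattice_box n = {- int n..int n} \<times> {- int n..int n}"

text \<open>By orthogonality the squared norms of the partial sums increase, and Bessel's inequality
  bounds them, so the sums are Cauchy. Coefficients pass to the limit by Cauchy-Schwarz.\<close>

lemma fourier_projection:
  assumes h: "h \<in> L2_GH"
  obtains g where "g \<in> L2_GH"
    "\<And>j k. inner_GH g (ebasis j k) = (if (j, k) \<in> P then inner_GH h (ebasis j k) else 0)"
    "\<And>e. e > 0 \<Longrightarrow> \<exists>N. \<forall>n\<ge>N. norm_GH (\<lambda>y. g y - fourier_sum h (P \<inter> lattice_box n) y) \<le> e"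
proof -
  define T where "T n = P \<inter> lattice_box n" for n
  define c where "c j k = inner_GH h (ebasis j k) / (8 * pi\<^sup>2)" for j k
  define b where "b n = 8 * pi\<^sup>2 * (\<Sum>(j,k)\<in>T n. (cmod (c j k))\<^sup>2)" for n
  have fin: "finite (T n)" for n
    unfolding T_def lattice_box_def by auto
  have Tmono: "T m \<subseteq> T n" if "m \<le> n" for m n
    using that unfolding T_def lattice_box_def by auto
  have F: "fourier_sum h A = (\<lambda>y. \<Sum>(j,k)\<in>A. c j k * ebasis j k y)" for A
    unfolding fourier_sum_def c_def ..
  have diff: "nsq (\<lambda>y. fourier_sum h (T n) y - fourier_sum h (T m) y) = b n - b m" if "m \<le> n" for m n
  proof -
    have *: "fourier_sum h (T n) y - fourier_sum h (T m) y = (\<Sum>(j,k)\<in>T n - T m. c j k * ebasis j k y)" for y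
      unfolding F by (rule sum_diff[OF fin Tmono[OF that], symmetric])
    show ?thesis
      unfolding b_def *
      using nsq_ebasis_sum(1)[of "T n - T m" c] fin sum_diff[OF fin Tmono[OF that], of "\<lambda>(j,k). (cmod (c j k))\<^sup>2"]
      by (simp add: right_diff_distrib)
  qed
  have incb: "b m \<le> b n" if "m \<le> n" for m n
    using diff[OF that] nsq_nonneg by (metis diff_ge_0_iff_ge)
  have bessel: "b n \<le> nsq h" for n
  proof -
    have "inner_GH (fourier_sum h (T n)) h = (\<Sum>(j,k)\<in>T n. c j k * inner_GH (ebasis j k) h)"
      unfolding F by (subst inner_GH_sum) (auto simp: split_def inner_GH_scale L2_scale L2_ebasis h)
    also have "\<dots> = (\<Sum>(j,k)\<in>T n. complex_of_real (8 * pi\<^sup>2 * (cmod (c j k))\<^sup>2))"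
    proof (intro sum.cong refl)
      fix i assume "i \<in> T n"
      have "inner_GH (ebasis j k) h = complex_of_real (8 * pi\<^sup>2) * cnj (c j k)" for j k
        unfolding c_def by (subst inner_GH_commute) simp
      then show "(case i of (j, k) \<Rightarrow> c j k * inner_GH (ebasis j k) h)
          = (case i of (j, k) \<Rightarrow> complex_of_real (8 * pi\<^sup>2 * (cmod (c j k))\<^sup>2))"
        by (cases i) (simp add: complex_norm_square mult_ac del: of_real_power)
    qed
    also have "\<dots> = complex_of_real (b n)"
      by (simp add: b_def sum_distrib_left split_def)
    finally have "inner_GH h (fourier_sum h (T n)) = complex_of_real (b n)"
      by (subst inner_GH_commute) simp
    then have "nsq (\<lambda>y. h y - fourier_sum h (T n) y) = nsq h + nsq (fourier_sum h (T n)) - 2 * b n"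
      using nsq_diff[OF h L2_fourier_sum] by simp
    moreover have "nsq (fourier_sum h (T n)) = b n"
      unfolding F b_def by (rule nsq_ebasis_sum(1)[OF fin])
    ultimately show ?thesis
      using nsq_nonneg[of "\<lambda>y. h y - fourier_sum h (T n) y"] by linarith
  qed
  have "convergent b"
  proof (rule Bseq_mono_convergent)
    have "b n \<ge> 0" for n
      unfolding b_def by (intro mult_nonneg_nonneg sum_nonneg) auto
    then show "Bseq b"
      using bessel by (intro BseqI'[of b "nsq h"]) simp
    show "\<forall>m n. m \<le> n \<longrightarrow> b m \<le> b n"
      using incb by blast
  qed
  then have "Cauchy b"
    by (rule convergent_Cauchy)
  have "\<exists>N. \<forall>m\<ge>N. \<forall>n\<ge>N. norm_GH (\<lambda>y. fourier_sum h (T m) y - fourier_sum h (T n) y) < e"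
    if e: "e > 0" for e
  proof -
    obtain N where N: "\<And>m n. m \<ge> N \<Longrightarrow> n \<ge> N \<Longrightarrow> \<bar>b m - b n\<bar> < e\<^sup>2"
      using \<open>Cauchy b\<close> e by (metis CauchyD real_norm_def zero_less_power)
    have "norm_GH (\<lambda>y. fourier_sum h (T m) y - fourier_sum h (T n) y) < e" if "m \<ge> N" "n \<ge> N" for m n
    proof (cases "m \<le> n")
      case True
      have "nsq (\<lambda>y. fourier_sum h (T n) y - fourier_sum h (T m) y) < e\<^sup>2"
        unfolding diff[OF True] using N[OF that] by linarith
      then show ?thesis
        unfolding norm_GH_diff_commute[of "fourier_sum h (T m)"] norm_GH_nsq using e
        by (intro real_less_lsqrt) auto
    next
      case False
      then have "nsq (\<lambda>y. fourier_sum h (T m) y - fourier_sum h (T n) y) < e\<^sup>2"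
        using diff[of n m] N[OF that] by linarith
      then show ?thesis
        unfolding norm_GH_nsq using e by (intro real_less_lsqrt) auto
    qed
    then show ?thesis by blast
  qed
  then obtain g where g: "g \<in> L2_GH" and lim: "\<And>e. e > 0 \<Longrightarrow> \<exists>N. \<forall>n\<ge>N. norm_GH (\<lambda>y. g y - fourier_sum h (T n) y) \<le> e"
    using L2_complete[of "\<lambda>n. fourier_sum h (T n)"] L2_fourier_sum by metis
  have coef: "inner_GH g (ebasis j k) = (if (j, k) \<in> P then inner_GH h (ebasis j k) else 0)" (is "_ = ?c") for j k
  proof -
    have "cmod (inner_GH g (ebasis j k) - ?c) \<le> 0 + e" if e: "e > 0" for e
    proof -
      have "8 * pi\<^sup>2 > 0" by simp
      have ne: "norm_GH (ebasis j k) > 0"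
        using inner_ebasis[of j k j k] unfolding inner_GH_self norm_GH_nsq
        by (simp flip: of_real_eq_iff add: complex_eq_iff)
      obtain N where N: "\<And>n. n \<ge> N \<Longrightarrow> norm_GH (\<lambda>y. g y - fourier_sum h (T n) y) \<le> e / norm_GH (ebasis j k)"
        using lim[of "e / norm_GH (ebasis j k)"] e ne by auto
      \<comment> \<open>Large enough that the box contains (j, k), so the partial sum already has
        the final coefficient.\<close>
      define n where "n = max N (nat (max \<bar>j\<bar> \<bar>k\<bar>))"
      have "(j, k) \<in> T n \<longleftrightarrow> (j, k) \<in> P"
        unfolding T_def lattice_box_def n_def by auto
      then have "inner_GH (fourier_sum h (T n)) (ebasis j k) = ?c"
        unfolding F nsq_ebasis_sum(2)[OF fin] by (simp add: c_def)
      then have "cmod (inner_GH g (ebasis j k) - ?c) = cmod (inner_GH (\<lambda>y. g y - fourier_sum h (T n) y) (ebasis j k))"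
        by (simp only: inner_GH_diff[OF g L2_fourier_sum L2_ebasis])
      also have "\<dots> \<le> norm_GH (\<lambda>y. g y - fourier_sum h (T n) y) * norm_GH (ebasis j k)"
        by (rule Cauchy_Schwarz_GH[OF L2_diff[OF g L2_fourier_sum] L2_ebasis])
      also have "\<dots> \<le> e / norm_GH (ebasis j k) * norm_GH (ebasis j k)"
        by (intro mult_right_mono N) (auto simp: n_def)
      finally show ?thesis
        using ne by simp
    qed
    then have "cmod (inner_GH g (ebasis j k) - ?c) \<le> 0"
      by (rule field_le_epsilon)
    then show ?thesis by simp
  qed
  show ?thesis
    by (rule that[OF g coef lim[unfolded T_def]])
qed

subsection \<open>The antipodal scattering relation\<close>

lemma wrap_range: "wrap b \<in> {0..<2*pi}"
proof -
  have "of_int \<lfloor>b / (2 * pi)\<rfloor> \<le> b / (2 * pi)" "b / (2 * pi) < of_int \<lfloor>b / (2 * pi)\<rfloor> + 1"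
    by linarith+
  then have "of_int \<lfloor>b / (2 * pi)\<rfloor> * (2 * pi) \<le> b / (2 * pi) * (2 * pi)"
    "b / (2 * pi) * (2 * pi) < (of_int \<lfloor>b / (2 * pi)\<rfloor> + 1) * (2 * pi)"
    by (intro mult_right_mono mult_strict_right_mono; simp)+
  then show ?thesis
    by (simp add: wrap_def algebra_simps)
qed

lemma wrap_unique:
  assumes "x \<in> {0..<2*pi}" "b = x + 2 * pi * of_int n"
  shows "wrap b = x"
proof -
  have "b / (2 * pi) = x / (2 * pi) + of_int n"
    using assms(2) by (simp add: add_divide_distrib)
  moreover have "0 \<le> x / (2 * pi)" "x / (2 * pi) < 1"
    using assms(1) by simp_all
  ultimately have "\<lfloor>b / (2 * pi)\<rfloor> = n"
    by (intro floor_unique) linarith+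
  then show ?thesis
    using assms(2) by (simp add: wrap_def)
qed

lemma wrap_add_wrap: "wrap (b + c) = wrap (b + wrap c)"
proof -
  have "b + c = wrap (b + wrap c) + 2 * pi * of_int (\<lfloor>c / (2 * pi)\<rfloor> + \<lfloor>(b + wrap c) / (2 * pi)\<rfloor>)"
    by (simp add: wrap_def algebra_simps)
  then show ?thesis
    by (intro wrap_unique wrap_range)
qed

lemma cis_wrap: "cis (wrap b) = cis b"
proof -
  have "cis b = cis (wrap b + 2 * pi * of_int \<lfloor>b / (2 * pi)\<rfloor>)"
    by (simp add: wrap_def)
  then show ?thesis
    unfolding cis_mult[symmetric] by simp
qed

lemma wrap_measurable [measurable]: "wrap \<in> borel_measurable borel"
  unfolding wrap_def by measurable

text \<open>Translation modulo the period cuts the period interval at 2 pi - d; the two pieces are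
  translated by d and by d - 2 pi and exchange their order.\<close>

lemma nn_integral_wrap_shift:
  assumes G [measurable]: "G \<in> borel_measurable borel"
  shows "(\<integral>\<^sup>+b. G (wrap (b + c)) * indicator {0..<2*pi} b \<partial>lborel)
    = (\<integral>\<^sup>+b. G b * indicator {0..<2*pi} b \<partial>lborel)"
proof -
  define d where "d = wrap c"
  have d: "0 \<le> d" "d < 2 * pi"
    using wrap_range[of c] by (auto simp: d_def)
  have 1: "wrap (b + d) = b + d" if "0 \<le> b" "b < 2 * pi - d" for b
    using that d by (intro wrap_unique[where n = 0]) auto
  have 2: "wrap (b + d) = b + d - 2 * pi" if "2 * pi - d \<le> b" "b < 2 * pi" for b
    using that d by (intro wrap_unique[where n = 1]) auto
  have "(\<integral>\<^sup>+b. G (wrap (b + c)) * indicator {0..<2*pi} b \<partial>lborel)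
      = (\<integral>\<^sup>+b. G (b + d) * indicator {0..<2*pi-d} b + G (b + d - 2 * pi) * indicator {2*pi-d..<2*pi} b \<partial>lborel)"
  proof (rule nn_integral_cong)
    fix b
    show "G (wrap (b + c)) * indicator {0..<2*pi} b
        = G (b + d) * indicator {0..<2*pi-d} b + G (b + d - 2 * pi) * indicator {2*pi-d..<2*pi} b"
      unfolding wrap_add_wrap[of b c] d_def[symmetric]
      using 1[of b] 2[of b] d by (auto simp: indicator_def)
  qed
  also have "\<dots> = (\<integral>\<^sup>+b. G (b + d) * indicator {0..<2*pi-d} b \<partial>lborel)
      + (\<integral>\<^sup>+b. G (b + d - 2 * pi) * indicator {2*pi-d..<2*pi} b \<partial>lborel)"
    by (rule nn_integral_add) measurable
  also have "(\<integral>\<^sup>+b. G (b + d) * indicator {0..<2*pi-d} b \<partial>lborel) = (\<integral>\<^sup>+b. G b * indicator {d..<2*pi} b \<partial>lborel)"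
    by (subst nn_integral_real_affine[where c = 1 and t = d and f = "\<lambda>b. G b * indicator {d..<2*pi} b"])
      (auto intro!: nn_integral_cong simp: indicator_def add.commute)
  also have "(\<integral>\<^sup>+b. G (b + d - 2 * pi) * indicator {2*pi-d..<2*pi} b \<partial>lborel) = (\<integral>\<^sup>+b. G b * indicator {0..<d} b \<partial>lborel)"
    by (subst nn_integral_real_affine[where c = 1 and t = "d - 2 * pi" and f = "\<lambda>b. G b * indicator {0..<d} b"])
      (auto intro!: nn_integral_cong simp: indicator_def algebra_simps)
  also have "(\<integral>\<^sup>+b. G b * indicator {d..<2*pi} b \<partial>lborel) + (\<integral>\<^sup>+b. G b * indicator {0..<d} b \<partial>lborel)
      = (\<integral>\<^sup>+b. G b * indicator {d..<2*pi} b + G b * indicator {0..<d} b \<partial>lborel)"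
    by (rule nn_integral_add[symmetric]) measurable
  also have "\<dots> = (\<integral>\<^sup>+b. G b * indicator {0..<2*pi} b \<partial>lborel)"
    by (rule nn_integral_cong) (use d in \<open>auto simp: indicator_def\<close>)
  finally show ?thesis .
qed

lemma SA_measurable: "SA \<in> measurable GH_measure GH_measure"
proof -
  have "SA \<in> borel_measurable borel"
    unfolding SA_def borel_prod[symmetric] by measurable
  then have "SA \<in> measurable GH_measure borel"
    by (rule borel_measurable_GH)
  moreover have "SA y \<in> GH" for y
    using wrap_range by (cases y) (auto simp: SA_def GH_def)
  ultimately have "SA \<in> measurable GH_measure (restrict_space borel GH)"
    by (intro measurable_restrict_space2) auto
  moreover have "sets (restrict_space borel GH) = sets GH_measure"
    by (simp add: GH_measure_def sets_restrict_space)
  ultimately show ?thesis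
    by (simp cong: measurable_cong_sets)
qed

text \<open>For fixed second coordinate the map rotates the first one, and it reflects the second;
  both preserve Lebesgue measure. Integrating over the angle first absorbs the dependence of the
  rotation on a.\<close>

lemma distr_SA: "distr GH_measure GH_measure SA = GH_measure"
proof (rule measure_eqI)
  fix B assume "B \<in> sets (distr GH_measure GH_measure SA)"
  then have B: "B \<in> sets GH_measure" by simp
  then have Bb [measurable]: "B \<in> sets borel"
    using GH_measurable by (auto simp: GH_measure_def sets_restrict_space)
  have Bi: "indicator B \<in> borel_measurable GH_measure"
    using B by simp
  have Bp: "B \<in> sets (borel \<Otimes>\<^sub>M borel)"
    unfolding borel_prod by (rule Bb)
  have sec [measurable]: "(\<lambda>b. indicator B (b, a) :: ennreal) \<in> borel_measurable borel" for a
    using Bp by measurable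
  have m1 [measurable]: "(\<lambda>a. \<integral>\<^sup>+b. indicator B (b, a) * indicator {0..<2*pi} b \<partial>lborel) \<in> borel_measurable borel"
    using Bp by measurable
  have "emeasure (distr GH_measure GH_measure SA) B = (\<integral>\<^sup>+y. indicator B y \<partial>distr GH_measure GH_measure SA)"
    using B by simp
  also have "\<dots> = (\<integral>\<^sup>+y. indicator B (SA y) \<partial>GH_measure)"
    by (rule nn_integral_distr[OF SA_measurable]) (use Bi in simp)
  also have "\<dots> = (\<integral>\<^sup>+a. (\<integral>\<^sup>+b. indicator B (SA (b, a)) * indicator {0..<2*pi} b \<partial>lborel) \<partial>lborel)"
    by (rule nn_integral_GH[OF measurable_compose[OF SA_measurable Bi]])
  also have "\<dots> = (\<integral>\<^sup>+a. (\<integral>\<^sup>+b. indicator B (b, - a) * indicator {0..<2*pi} b \<partial>lborel) \<partial>lborel)"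
  proof (rule nn_integral_cong)
    fix a
    show "(\<integral>\<^sup>+b. indicator B (SA (b, a)) * indicator {0..<2*pi} b \<partial>lborel)
        = (\<integral>\<^sup>+b. indicator B (b, - a) * indicator {0..<2*pi} b \<partial>lborel)"
      using nn_integral_wrap_shift[of "\<lambda>b. indicator B (b, - a)" "pi + 2 * arctan a"] sec
      by (simp add: SA_def add.assoc)
  qed
  also have "\<dots> = (\<integral>\<^sup>+a. (\<integral>\<^sup>+b. indicator B (b, a) * indicator {0..<2*pi} b \<partial>lborel) \<partial>lborel)"
    by (subst (2) nn_integral_real_affine[where c = "-1" and t = 0]) auto
  also have "\<dots> = (\<integral>\<^sup>+y. indicator B y \<partial>GH_measure)"
    by (rule nn_integral_GH[OF Bi, symmetric])
  finally show "emeasure (distr GH_measure GH_measure SA) B = emeasure GH_measure B"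
    using B by simp
qed simp

lemma integral_SA:
  fixes f :: "real \<times> real \<Rightarrow> complex"
  assumes "f \<in> borel_measurable GH_measure"
  shows "(\<integral>y. f (SA y) \<partial>GH_measure) = (\<integral>y. f y \<partial>GH_measure)"
  using integral_distr[OF SA_measurable assms] by (simp add: distr_SA)

lemma L2_SA:
  assumes h: "h \<in> L2_GH"
  shows "(\<lambda>y. h (SA y)) \<in> L2_GH"
proof -
  have "integrable (distr GH_measure GH_measure SA) (\<lambda>y. (cmod (h y))\<^sup>2)"
    using L2_integrable[OF h] by (simp add: distr_SA)
  then have "integrable GH_measure (\<lambda>y. (cmod (h (SA y)))\<^sup>2)"
    by (rule integrable_distr[OF SA_measurable])
  then show ?thesis
    using measurable_compose[OF SA_measurable L2_measurable[OF h]] by (simp add: L2_GH_def)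
qed

lemma zm_SA: "zm (SA y) = zp y"
  by (cases y) (simp add: zm_def zp_def SA_def cis_wrap)

lemma zp_SA: "zp (SA y) = zm y"
proof (cases y)
  case (Pair b a)
  have "zp (SA y) = cis (wrap (b + pi + 2 * arctan a)) * cis (pi - 2 * arctan a)"
    by (simp add: zp_def SA_def Pair cis_mult arctan_minus algebra_simps)
  also have "\<dots> = cis b * cis (2 * pi)"
    by (simp only: cis_wrap cis_mult) (simp add: algebra_simps)
  finally show ?thesis
    by (simp add: zm_def Pair)
qed

lemma ebasis_SA: "ebasis j k (SA y) = - ebasis k j y"
  by (simp add: ebasis_def chord_def zm_SA zp_SA algebra_simps)

subsection \<open>Spectral subspaces\<close>

text \<open>Division by the chord turns functions that are even under the scattering relation into
  antisymmetric functions of the two endpoints, whence the sign in this definition.\<close>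

definition spectral :: "(int \<times> int) set \<Rightarrow> (real \<times> real \<Rightarrow> complex) set" where
  "spectral P = {h \<in> L2_GH. (\<forall>j k. inner_GH h (ebasis k j) = - inner_GH h (ebasis j k))
     \<and> (\<forall>j k. (j, k) \<notin> P \<longrightarrow> inner_GH h (ebasis j k) = 0)}"

lemma spectralI:
  assumes "h \<in> L2_GH" "\<And>j k. inner_GH h (ebasis k j) = - inner_GH h (ebasis j k)"
    "\<And>j k. (j, k) \<notin> P \<Longrightarrow> inner_GH h (ebasis j k) = 0"
  shows "h \<in> spectral P"
  using assms unfolding spectral_def by blast

lemma spectral_L2: "h \<in> spectral P \<Longrightarrow> h \<in> L2_GH"
  and spectral_anti: "h \<in> spectral P \<Longrightarrow> inner_GH h (ebasis k j) = - inner_GH h (ebasis j k)"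
  and spectral_supp: "h \<in> spectral P \<Longrightarrow> (j, k) \<notin> P \<Longrightarrow> inner_GH h (ebasis j k) = 0"
  unfolding spectral_def by blast+

lemma spectral_mono:
  assumes "h \<in> spectral P" "P \<subseteq> Q"
  shows "h \<in> spectral Q"
  by (rule spectralI[OF spectral_L2[OF assms(1)] spectral_anti[OF assms(1)]])
    (use assms spectral_supp in blast)

text \<open>Antisymmetric in the indices, hence by \<open>ebasis_SA\<close> unchanged under
  \<open>SA\<close>.\<close>

definition ebasis_even :: "int \<Rightarrow> int \<Rightarrow> real \<times> real \<Rightarrow> complex" where
  "ebasis_even j k = (\<lambda>y. ebasis j k y - ebasis k j y)"

definition subspace_fun :: "(real \<times> real \<Rightarrow> complex) set \<Rightarrow> bool" where
  "subspace_fun S \<longleftrightarrow> (\<lambda>y. 0) \<in> S \<and> (\<forall>f\<in>S. \<forall>g\<in>S. (\<lambda>y. f y + g y) \<in> S) \<and> (\<forall>c. \<forall>f\<in>S. (\<lambda>y. c * f y) \<in> S)"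

lemma subspace_fun_sum:
  assumes "subspace_fun S" "\<And>i. i \<in> T \<Longrightarrow> F i \<in> S"
  shows "(\<lambda>y. \<Sum>i\<in>T. F i y) \<in> S"
  using assms(2) by (induction T rule: infinite_finite_induct) (use assms(1) in \<open>auto simp: subspace_fun_def\<close>)

lemma subspace_fun_scale: "subspace_fun S \<Longrightarrow> f \<in> S \<Longrightarrow> (\<lambda>y. c * f y) \<in> S"
  by (simp add: subspace_fun_def)

lemma subspace_fun_add: "subspace_fun S \<Longrightarrow> f \<in> S \<Longrightarrow> g \<in> S \<Longrightarrow> (\<lambda>y. f y + g y) \<in> S"
  by (simp add: subspace_fun_def)

lemma subspace_fun_scale_if: "subspace_fun S \<Longrightarrow> (c \<noteq> 0 \<Longrightarrow> f \<in> S) \<Longrightarrow> (\<lambda>y. c * f y) \<in> S"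
  by (cases "c = 0") (simp_all add: subspace_fun_def)

lemma subspace_fun_diff:
  assumes "subspace_fun S" "f \<in> S" "g \<in> S"
  shows "(\<lambda>y. f y - g y) \<in> S"
proof -
  have "(\<lambda>y. f y + (- 1) * g y) \<in> S"
    by (intro subspace_fun_add subspace_fun_scale assms)
  then show ?thesis by simp
qed

lemma L2_ebasis_even: "ebasis_even j k \<in> L2_GH"
  unfolding ebasis_even_def by (intro L2_diff L2_ebasis)

lemma inner_ebasis_even:
  "inner_GH (ebasis_even j k) (ebasis j' k')
    = (if j = j' \<and> k = k' then 8 * pi\<^sup>2 else 0) - (if k = j' \<and> j = k' then 8 * pi\<^sup>2 else 0)"
  unfolding ebasis_even_def by (subst inner_GH_diff) (auto simp: L2_ebasis inner_ebasis)

lemma ebasis_even_spectral: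
  assumes "(j, k) \<in> P" "(k, j) \<in> P"
  shows "ebasis_even j k \<in> spectral P"
proof (rule spectralI[OF L2_ebasis_even])
  fix j' k'
  show "inner_GH (ebasis_even j k) (ebasis k' j') = - inner_GH (ebasis_even j k) (ebasis j' k')"
    unfolding inner_ebasis_even conj_commute[of "j = k'" "k = j'"] conj_commute[of "k = k'" "j = j'"]
    by (simp only: of_real_minus[symmetric] minus_diff_eq)
  assume "(j', k') \<notin> P"
  then have "\<not> (j = j' \<and> k = k')" "\<not> (k = j' \<and> j = k')"
    using assms by metis+
  then show "inner_GH (ebasis_even j k) (ebasis j' k') = 0"
    unfolding inner_ebasis_even by (simp only: if_False) simp
qed

lemma subspace_spectral: "subspace_fun (spectral P)"
proof -
  have 0: "inner_GH (\<lambda>y. 0) h = 0" for h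
    by (simp add: inner_GH_def)
  show ?thesis
    unfolding subspace_fun_def
  proof (intro conjI ballI allI)
    show "(\<lambda>y. 0) \<in> spectral P"
      by (rule spectralI) (simp_all add: L2_zero 0)
  next
    fix f g assume f: "f \<in> spectral P" and g: "g \<in> spectral P"
    note fg = spectral_L2[OF f] spectral_L2[OF g]
    show "(\<lambda>y. f y + g y) \<in> spectral P"
    proof (rule spectralI[OF L2_add[OF fg]])
      fix j k
      show "inner_GH (\<lambda>y. f y + g y) (ebasis k j) = - inner_GH (\<lambda>y. f y + g y) (ebasis j k)"
        unfolding inner_GH_add[OF fg L2_ebasis] spectral_anti[OF f, of k j] spectral_anti[OF g, of k j]
        by simp
      assume "(j, k) \<notin> P"
      then show "inner_GH (\<lambda>y. f y + g y) (ebasis j k) = 0"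
        unfolding inner_GH_add[OF fg L2_ebasis] using f g by (simp add: spectral_supp)
    qed
  next
    fix c f assume f: "f \<in> spectral P"
    show "(\<lambda>y. c * f y) \<in> spectral P"
    proof (rule spectralI[OF L2_scale[OF spectral_L2[OF f]]])
      fix j k
      show "inner_GH (\<lambda>y. c * f y) (ebasis k j) = - inner_GH (\<lambda>y. c * f y) (ebasis j k)"
        unfolding inner_GH_scale spectral_anti[OF f, of k j] by simp
      assume "(j, k) \<notin> P"
      then show "inner_GH (\<lambda>y. c * f y) (ebasis j k) = 0"
        unfolding inner_GH_scale using f by (simp add: spectral_supp)
    qed
  qed
qed

lemma norm_ebasis: "norm_GH (ebasis j k) = sqrt (8 * pi\<^sup>2)"
proof -
  have "complex_of_real (nsq (ebasis j k)) = complex_of_real (8 * pi\<^sup>2)"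
    unfolding inner_GH_self[symmetric] inner_ebasis by simp
  then show ?thesis
    unfolding norm_GH_nsq of_real_eq_iff by simp
qed

text \<open>Each coefficient is a continuous functional, with the same bound sqrt (8 pi^2) for all
  index pairs, so the linear conditions defining \<open>spectral P\<close> survive limits.\<close>

lemma spectral_closed:
  assumes h: "h \<in> L2_GH"
    and approx: "\<And>e. e > 0 \<Longrightarrow> \<exists>g\<in>spectral P. norm_GH (\<lambda>y. h y - g y) < e"
  shows "h \<in> spectral P"
proof -
  have close: "\<exists>g\<in>spectral P. \<forall>j k. cmod (inner_GH h (ebasis j k) - inner_GH g (ebasis j k)) \<le> e"
    if e: "e > 0" for e
  proof -
    have "e / sqrt (8 * pi\<^sup>2) > 0"
      using e by simp
    from approx[OF this] obtain g where g: "g \<in> spectral P" "norm_GH (\<lambda>y. h y - g y) < e / sqrt (8 * pi\<^sup>2)"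
      by blast
    have gL: "g \<in> L2_GH"
      using g(1) by (rule spectral_L2)
    have "cmod (inner_GH h (ebasis j k) - inner_GH g (ebasis j k)) \<le> e" for j k
    proof -
      have "cmod (inner_GH h (ebasis j k) - inner_GH g (ebasis j k)) \<le> norm_GH (\<lambda>y. h y - g y) * sqrt (8 * pi\<^sup>2)"
        using Cauchy_Schwarz_GH[OF L2_diff[OF h gL] L2_ebasis] inner_GH_diff[OF h gL L2_ebasis]
        by (simp add: norm_ebasis)
      also have "\<dots> \<le> e / sqrt (8 * pi\<^sup>2) * sqrt (8 * pi\<^sup>2)"
        using g(2) by (intro mult_right_mono) auto
      finally show ?thesis
        by simp
    qed
    with g(1) show ?thesis by blast
  qed
  have "inner_GH h (ebasis k j) + inner_GH h (ebasis j k) = 0" for j k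
  proof -
    have "cmod (inner_GH h (ebasis k j) + inner_GH h (ebasis j k)) \<le> 0 + e" if e: "e > 0" for e
    proof -
      obtain g where g: "g \<in> spectral P" "\<And>j k. cmod (inner_GH h (ebasis j k) - inner_GH g (ebasis j k)) \<le> e / 2"
        using close[of "e / 2"] e by auto
      have eq: "inner_GH h (ebasis k j) + inner_GH h (ebasis j k)
          = (inner_GH h (ebasis k j) - inner_GH g (ebasis k j)) + (inner_GH h (ebasis j k) - inner_GH g (ebasis j k))"
        using spectral_anti[OF g(1), of k j] by simp
      have "cmod (inner_GH h (ebasis k j) + inner_GH h (ebasis j k))
          \<le> cmod (inner_GH h (ebasis k j) - inner_GH g (ebasis k j)) + cmod (inner_GH h (ebasis j k) - inner_GH g (ebasis j k))"
        by (subst eq) (rule norm_triangle_ineq)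
      then show ?thesis
        using g(2)[of j k] g(2)[of k j] by linarith
    qed
    then have "cmod (inner_GH h (ebasis k j) + inner_GH h (ebasis j k)) \<le> 0"
      by (rule field_le_epsilon)
    then show ?thesis by simp
  qed
  moreover have "inner_GH h (ebasis j k) = 0" if "(j, k) \<notin> P" for j k
  proof -
    have "cmod (inner_GH h (ebasis j k)) \<le> 0 + e" if e: "e > 0" for e
    proof -
      obtain g where g: "g \<in> spectral P" "\<And>j k. cmod (inner_GH h (ebasis j k) - inner_GH g (ebasis j k)) \<le> e"
        using close[of e] e by auto
      then show ?thesis
        using g(2)[of j k] spectral_supp[OF g(1) \<open>(j, k) \<notin> P\<close>] by simp
    qed
    then have "cmod (inner_GH h (ebasis j k)) \<le> 0"
      by (rule field_le_epsilon)
    then show ?thesis by simp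
  qed
  ultimately show ?thesis
    using h by (intro spectralI) (simp_all add: eq_neg_iff_add_eq_0)
qed

lemma L2_eqI:
  assumes "f \<in> L2_GH" "g \<in> L2_GH" "\<And>j k. inner_GH f (ebasis j k) = inner_GH g (ebasis j k)"
  shows "AE y in GH_measure. f y = g y"
proof -
  have "AE y in GH_measure. f y - g y = 0"
    by (rule ebasis_total[OF L2_diff[OF assms(1,2)]]) (simp add: inner_GH_diff assms L2_ebasis)
  then show ?thesis by simp
qed

text \<open>The partial sums converge to the projection on P, which has the same coefficients as h
  and so agrees with it almost everywhere by totality.\<close>

lemma spectral_approx:
  assumes h: "h \<in> spectral P" and e: "e > 0"
  shows "\<exists>n. norm_GH (\<lambda>y. h y - fourier_sum h (P \<inter> lattice_box n) y) < e"
proof -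
  have hL: "h \<in> L2_GH"
    using h by (rule spectral_L2)
  obtain g where g: "g \<in> L2_GH"
    "\<And>j k. inner_GH g (ebasis j k) = (if (j, k) \<in> P then inner_GH h (ebasis j k) else 0)"
    "\<And>e. e > 0 \<Longrightarrow> \<exists>N. \<forall>n\<ge>N. norm_GH (\<lambda>y. g y - fourier_sum h (P \<inter> lattice_box n) y) \<le> e"
    using fourier_projection[OF hL, of P] by blast
  have ae: "AE y in GH_measure. h y = g y"
    by (rule L2_eqI[OF hL g(1)]) (auto simp: g(2) spectral_supp[OF h])
  obtain n where n: "norm_GH (\<lambda>y. g y - fourier_sum h (P \<inter> lattice_box n) y) \<le> e / 2"
    using g(3)[of "e / 2"] e by auto
  have "(\<integral>y. (cmod (h y - fourier_sum h (P \<inter> lattice_box n) y))\<^sup>2 \<partial>GH_measure)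
      = (\<integral>y. (cmod (g y - fourier_sum h (P \<inter> lattice_box n) y))\<^sup>2 \<partial>GH_measure)"
    by (rule integral_cong_AE) (use ae L2_measurable[OF hL] L2_measurable[OF g(1)] L2_measurable[OF L2_fourier_sum] in auto)
  then have "norm_GH (\<lambda>y. h y - fourier_sum h (P \<inter> lattice_box n) y) \<le> e / 2"
    using n by (simp add: norm_GH_def)
  then show ?thesis
    using e by (intro exI[of _ n]) simp
qed

text \<open>The linear set S supplies the dense combinations, while of S' only the square integrable
  members are constrained. Two sets are allowed for the sake of the image of \<open>xhalf_L2\<close>
  under \<open>I0\<close>, of which only a part is visibly linear.\<close>

lemma L2_closure_eq_spectral:
  assumes S: "subspace_fun S" "S \<subseteq> S'" and sym: "\<And>j k. (j, k) \<in> P \<Longrightarrow> (k, j) \<in> P"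
    and inS: "\<And>j k. (j, k) \<in> P \<Longrightarrow> ebasis_even j k \<in> S"
    and sub: "\<And>f. f \<in> S' \<Longrightarrow> f \<in> L2_GH \<Longrightarrow> f \<in> spectral P"
  shows "L2_closure S' = spectral P"
proof
  show "L2_closure S' \<subseteq> spectral P"
  proof
    fix h assume h: "h \<in> L2_closure S'"
    show "h \<in> spectral P"
    proof (rule spectral_closed)
      show "h \<in> L2_GH"
        using h by (simp add: L2_closure_def)
      fix e :: real assume "e > 0"
      then obtain g where "g \<in> S'" "g \<in> L2_GH" "norm_GH (\<lambda>y. h y - g y) < e"
        using h unfolding L2_closure_def by blast
      then show "\<exists>g\<in>spectral P. norm_GH (\<lambda>y. h y - g y) < e"
        using sub by blast
    qed
  qed
  show "spectral P \<subseteq> L2_closure S'"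
  proof
    fix h assume h: "h \<in> spectral P"
    have fs: "fourier_sum h T \<in> S'" if T: "T = P \<inter> lattice_box n" for T n
    proof -
      define c where "c j k = inner_GH h (ebasis j k) / (8 * pi\<^sup>2)" for j k
      have c: "c k j = - c j k" for j k
        unfolding c_def spectral_anti[OF h, of k j] by simp
      \<comment> \<open>Averaging the sum with its index-exchanged copy replaces each
        \<open>ebasis\<close> by half an \<open>ebasis_even\<close>, since the coefficients are
        antisymmetric.\<close>
      have swap: "(\<Sum>(j,k)\<in>T. c j k * ebasis j k y) = (\<Sum>(j,k)\<in>T. c k j * ebasis k j y)" for y
        by (rule sum.reindex_bij_witness[where i = prod.swap and j = prod.swap]) (auto simp: T sym lattice_box_def)
      have "fourier_sum h T y = (\<Sum>(j,k)\<in>T. c j k / 2 * ebasis_even j k y)" for y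
      proof -
        have "2 * fourier_sum h T y = (\<Sum>(j,k)\<in>T. c j k * ebasis j k y) + (\<Sum>(j,k)\<in>T. c k j * ebasis k j y)"
          unfolding fourier_sum_def c_def[symmetric] using swap[of y] by simp
        also have "\<dots> = (\<Sum>(j,k)\<in>T. c j k * ebasis_even j k y)"
          unfolding sum.distrib[symmetric]
        proof (intro sum.cong refl)
          fix i
          show "(case i of (j, k) \<Rightarrow> c j k * ebasis j k y) + (case i of (j, k) \<Rightarrow> c k j * ebasis k j y)
              = (case i of (j, k) \<Rightarrow> c j k * ebasis_even j k y)"
          proof (cases i)
            case (Pair j k)
            show ?thesis
              unfolding Pair prod.case c[of k j] by (simp add: ebasis_even_def right_diff_distrib)
          qed
        qed
        finally have "fourier_sum h T y = (\<Sum>(j,k)\<in>T. c j k * ebasis_even j k y) / 2"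
          by (simp add: eq_divide_eq mult.commute)
        then show ?thesis
          by (simp add: sum_divide_distrib split_def)
      qed
      then have "fourier_sum h T = (\<lambda>y. \<Sum>i\<in>T. (case i of (j, k) \<Rightarrow> c j k / 2 * ebasis_even j k y))"
        by (simp add: fun_eq_iff)
      also have "\<dots> \<in> S"
        by (rule subspace_fun_sum[OF S(1)]) (auto intro!: subspace_fun_scale[OF S(1)] inS simp: T simp del: times_divide_eq_left)
      finally show ?thesis
        using S(2) by blast
    qed
    show "h \<in> L2_closure S'"
      unfolding L2_closure_def
    proof (intro CollectI conjI allI impI)
      show "h \<in> L2_GH"
        using h by (rule spectral_L2)
      fix e :: real assume "e > 0"
      from spectral_approx[OF h this] obtain n
        where "norm_GH (\<lambda>y. h y - fourier_sum h (P \<inter> lattice_box n) y) < e" ..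
      then show "\<exists>g\<in>S'. g \<in> L2_GH \<and> norm_GH (\<lambda>y. h y - g y) < e"
        by (intro bexI[OF _ fs[OF refl]] conjI L2_fourier_sum)
    qed
  qed
qed

text \<open>The function g is approximated by its partial sums, which only involve indices in Q,
  where all coefficients of f vanish. The summand 1 added to the norm of f guards against division
  by zero.\<close>

lemma spectral_orthogonal:
  assumes f: "f \<in> spectral P" and g: "g \<in> spectral Q" and PQ: "P \<inter> Q = {}"
  shows "inner_GH f g = 0"
proof -
  have fL: "f \<in> L2_GH" and gL: "g \<in> L2_GH"
    using f g by (auto intro: spectral_L2)
  have "cmod (inner_GH g f) \<le> 0 + e" if e: "e > 0" for e
  proof -
    have pos: "e / (norm_GH f + 1) > 0"
      using e norm_GH_nonneg[of f] by (intro divide_pos_pos) linarith+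
    then obtain n where n: "norm_GH (\<lambda>y. g y - fourier_sum g (Q \<inter> lattice_box n) y) < e / (norm_GH f + 1)"
      using spectral_approx[OF g] by blast
    define s where "s = fourier_sum g (Q \<inter> lattice_box n)"
    have sL: "s \<in> L2_GH"
      unfolding s_def by (rule L2_fourier_sum)
    have "inner_GH s f = (\<Sum>(j,k)\<in>Q \<inter> lattice_box n.
        inner_GH g (ebasis j k) / (8 * pi\<^sup>2) * inner_GH (ebasis j k) f)"
      unfolding s_def fourier_sum_def
      by (subst inner_GH_sum)
        (auto simp: split_def inner_GH_scale L2_scale L2_ebasis fL simp del: times_divide_eq_left)
    also have "\<dots> = 0"
    proof (intro sum.neutral ballI)
      fix i assume i: "i \<in> Q \<inter> lattice_box n"
      then have "inner_GH f (ebasis (fst i) (snd i)) = 0"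
        using PQ by (intro spectral_supp[OF f]) auto
      then have "inner_GH (ebasis (fst i) (snd i)) f = 0"
        by (subst inner_GH_commute) simp
      then show "(case i of (j, k) \<Rightarrow> inner_GH g (ebasis j k) / (8 * pi\<^sup>2) * inner_GH (ebasis j k) f) = 0"
        by (simp add: split_def)
    qed
    finally have "inner_GH g f = inner_GH (\<lambda>y. g y - s y) f"
      using inner_GH_diff[OF gL sL fL] by simp
    also have "cmod \<dots> \<le> norm_GH (\<lambda>y. g y - s y) * norm_GH f"
      by (rule Cauchy_Schwarz_GH[OF L2_diff[OF gL sL] fL])
    also have "\<dots> \<le> e / (norm_GH f + 1) * (norm_GH f + 1)"
      using n pos unfolding s_def by (intro mult_mono) auto
    also have "\<dots> = e"
      using norm_GH_nonneg[of f] by (simp add: add_nonneg_eq_0_iff)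
    finally show ?thesis by simp
  qed
  then have "cmod (inner_GH g f) \<le> 0"
    by (rule field_le_epsilon)
  then show ?thesis
    by (subst inner_GH_commute) simp
qed

text \<open>Since \<open>SA\<close> preserves the measure and turns \<open>ebasis j k\<close> into
  minus \<open>ebasis k j\<close>, composition with \<open>SA\<close> exchanges coefficients with a
  sign. By totality, evenness almost everywhere is the same as antisymmetry of the
  coefficients.\<close>

lemma L2_plus_eq_spectral: "L2_plus = spectral UNIV"
proof (intro set_eqI iffI)
  have swap: "inner_GH (\<lambda>y. h (SA y)) (ebasis j k) = - inner_GH h (ebasis k j)" if h: "h \<in> L2_GH" for h j k
  proof -
    have "inner_GH (\<lambda>y. h (SA y)) (ebasis j k) = (\<integral>y. - (h (SA y) * cnj (ebasis k j (SA y))) \<partial>GH_measure)"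
      unfolding inner_GH_def ebasis_SA by simp
    also have "\<dots> = - (\<integral>y. h (SA y) * cnj (ebasis k j (SA y)) \<partial>GH_measure)"
      by (rule integral_minus)
    also have "(\<integral>y. h (SA y) * cnj (ebasis k j (SA y)) \<partial>GH_measure) = inner_GH h (ebasis k j)"
      unfolding inner_GH_def
      using integral_SA[OF borel_measurable_integrable[OF L2_mult_integrable[OF h L2_cnj[OF L2_ebasis]]]] .
    finally show ?thesis .
  qed
  fix h
  {
    assume "h \<in> L2_plus"
    then have h: "h \<in> L2_GH" and ae: "AE y in GH_measure. h (SA y) = h y"
      by (auto simp: L2_plus_def)
    have "inner_GH h (ebasis k j) = - inner_GH h (ebasis j k)" for j k
      using inner_GH_AE_cong[OF L2_SA[OF h] h L2_ebasis ae] swap[OF h] by (metis minus_equation_iff)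
    from spectralI[OF h this, of UNIV] show "h \<in> spectral UNIV"
      by simp
  next
    assume hs: "h \<in> spectral UNIV"
    then have h: "h \<in> L2_GH"
      by (rule spectral_L2)
    have "inner_GH (\<lambda>y. h (SA y)) (ebasis j k) = inner_GH h (ebasis j k)" for j k
      unfolding swap[OF h] spectral_anti[OF hs, of k j] by simp
    from L2_eqI[OF L2_SA[OF h] h this] show "h \<in> L2_plus"
      using h by (simp add: L2_plus_def)
  }
qed

lemma spectral_projection:
  assumes h: "h \<in> spectral UNIV" and sym: "\<And>j k. (j, k) \<in> P \<Longrightarrow> (k, j) \<in> P"
  obtains g where "g \<in> spectral P"
    "\<And>j k. (j, k) \<in> P \<Longrightarrow> inner_GH g (ebasis j k) = inner_GH h (ebasis j k)"
proof -
  have hL: "h \<in> L2_GH"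
    using h by (rule spectral_L2)
  obtain g where g: "g \<in> L2_GH"
    "\<And>j k. inner_GH g (ebasis j k) = (if (j, k) \<in> P then inner_GH h (ebasis j k) else 0)"
    using fourier_projection[OF hL, of P] by metis
  have "g \<in> spectral P"
  proof (rule spectralI[OF g(1)])
    fix j k
    show "inner_GH g (ebasis k j) = - inner_GH g (ebasis j k)"
      unfolding g(2) using sym[of j k] sym[of k j] spectral_anti[OF h, of k j] by auto
  qed (simp add: g(2))
  with that g(2) show ?thesis by simp
qed

text \<open>The part outside P and Q is taken as the exact remainder of h after subtracting the two
  projections, so the equality is one of functions and not only almost everywhere.\<close>

lemma spectral_decomposition:
  assumes P: "\<And>j k. (j, k) \<in> P \<Longrightarrow> (k, j) \<in> P" and Q: "\<And>j k. (j, k) \<in> Q \<Longrightarrow> (k, j) \<in> Q"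
    and PQ: "P \<inter> Q = {}"
  shows "spectral UNIV = {(\<lambda>y. f y + g y + k y) | f g k. f \<in> spectral (- P - Q) \<and> g \<in> spectral P \<and> k \<in> spectral Q}"
proof (intro set_eqI iffI)
  fix h assume h: "h \<in> spectral UNIV"
  then have hL: "h \<in> L2_GH"
    by (rule spectral_L2)
  obtain g where g: "g \<in> spectral P" "\<And>j k. (j, k) \<in> P \<Longrightarrow> inner_GH g (ebasis j k) = inner_GH h (ebasis j k)"
    using spectral_projection[OF h P] by metis
  obtain k where k: "k \<in> spectral Q" "\<And>i j. (i, j) \<in> Q \<Longrightarrow> inner_GH k (ebasis i j) = inner_GH h (ebasis i j)"
    using spectral_projection[OF h Q] by metis
  have gL: "g \<in> L2_GH" and kL: "k \<in> L2_GH"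
    using g k by (auto intro: spectral_L2)
  define f where "f y = h y - (g y + k y)" for y
  have fL: "f \<in> L2_GH"
    unfolding f_def by (intro L2_diff L2_add hL gL kL)
  have inner_f: "inner_GH f (ebasis i j) = inner_GH h (ebasis i j) - (inner_GH g (ebasis i j) + inner_GH k (ebasis i j))" for i j
    unfolding f_def by (simp add: inner_GH_diff inner_GH_add L2_add hL gL kL L2_ebasis)
  have "f \<in> spectral (- P - Q)"
  proof (rule spectralI[OF fL])
    fix i j
    show "inner_GH f (ebasis j i) = - inner_GH f (ebasis i j)"
      unfolding inner_f spectral_anti[OF h, of j i] spectral_anti[OF g(1), of j i] spectral_anti[OF k(1), of j i] by simp
    assume "(i, j) \<notin> - P - Q"
    then consider "(i, j) \<in> P" "(i, j) \<notin> Q" | "(i, j) \<in> Q" "(i, j) \<notin> P"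
      using PQ by auto
    then show "inner_GH f (ebasis i j) = 0"
      by cases (simp_all add: inner_f g(2) k(2) spectral_supp[OF g(1)] spectral_supp[OF k(1)])
  qed
  moreover have "h = (\<lambda>y. f y + g y + k y)"
    by (simp add: f_def fun_eq_iff)
  ultimately show "h \<in> {(\<lambda>y. f y + g y + k y) | f g k. f \<in> spectral (- P - Q) \<and> g \<in> spectral P \<and> k \<in> spectral Q}"
    using g(1) k(1) by blast
next
  fix h assume "h \<in> {(\<lambda>y. f y + g y + k y) | f g k. f \<in> spectral (- P - Q) \<and> g \<in> spectral P \<and> k \<in> spectral Q}"
  then obtain f g k where h: "h = (\<lambda>y. f y + g y + k y)"
    and "f \<in> spectral (- P - Q)" "g \<in> spectral P" "k \<in> spectral Q"
    by blast
  then have "f \<in> spectral UNIV" "g \<in> spectral UNIV" "k \<in> spectral UNIV"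
    by (auto elim: spectral_mono)
  then show "h \<in> spectral UNIV"
    unfolding h by (intro subspace_fun_add[OF subspace_spectral])
qed

section \<open>Linear spans and complex conjugation\<close>

lemma lin_span_subspace: "subspace_fun (lin_span J F)"
  unfolding subspace_fun_def
proof (intro conjI ballI allI)
  show "(\<lambda>y. 0) \<in> lin_span J F"
    unfolding lin_span_def by (intro CollectI exI[of _ "{}"] exI[of _ "\<lambda>_. 0"]) simp
next
  fix f g assume "f \<in> lin_span J F" "g \<in> lin_span J F"
  then obtain T c T' c' where f: "f = (\<lambda>y. \<Sum>i\<in>T. c i * F i y)" "finite T" "T \<subseteq> J"
    and g: "g = (\<lambda>y. \<Sum>i\<in>T'. c' i * F i y)" "finite T'" "T' \<subseteq> J"
    unfolding lin_span_def by blast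
  define d where "d i = (if i \<in> T then c i else 0) + (if i \<in> T' then c' i else 0)" for i
  have "f y + g y = (\<Sum>i\<in>T \<union> T'. d i * F i y)" for y
  proof -
    have "f y = (\<Sum>i\<in>T \<union> T'. (if i \<in> T then c i else 0) * F i y)"
      unfolding f(1) using f(2) g(2) by (intro sum.mono_neutral_cong_left) auto
    moreover have "g y = (\<Sum>i\<in>T \<union> T'. (if i \<in> T' then c' i else 0) * F i y)"
      unfolding g(1) using f(2) g(2) by (intro sum.mono_neutral_cong_left) auto
    ultimately show ?thesis
      by (simp add: d_def distrib_right sum.distrib)
  qed
  then show "(\<lambda>y. f y + g y) \<in> lin_span J F"
    unfolding lin_span_def using f(2,3) g(2,3) by (intro CollectI exI[of _ "T \<union> T'"] exI[of _ d]) auto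
next
  fix a f assume "f \<in> lin_span J F"
  then obtain T c where f: "f = (\<lambda>y. \<Sum>i\<in>T. c i * F i y)" "finite T" "T \<subseteq> J"
    unfolding lin_span_def by blast
  then show "(\<lambda>y. a * f y) \<in> lin_span J F"
    unfolding lin_span_def
    by (intro CollectI exI[of _ T] exI[of _ "\<lambda>i. a * c i"]) (simp add: sum_distrib_left mult.assoc)
qed

lemma lin_span_base: "i \<in> J \<Longrightarrow> F i \<in> lin_span J F"
  unfolding lin_span_def by (intro CollectI exI[of _ "{i}"] exI[of _ "\<lambda>_. 1"]) simp

lemma lin_span_minimal:
  assumes "subspace_fun S" "\<And>i. i \<in> J \<Longrightarrow> F i \<in> S"
  shows "lin_span J F \<subseteq> S"
proof
  fix f assume "f \<in> lin_span J F"
  then obtain T c where f: "f = (\<lambda>y. \<Sum>i\<in>T. c i * F i y)" "T \<subseteq> J"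
    unfolding lin_span_def by blast
  show "f \<in> S"
    unfolding f(1) using f(2) assms by (intro subspace_fun_sum subspace_fun_scale) auto
qed

lemma closed_span_eq_spectral:
  assumes "\<And>j k. (j, k) \<in> P \<Longrightarrow> (k, j) \<in> P" "\<And>j k. (j, k) \<in> P \<Longrightarrow> ebasis_even j k \<in> lin_span J F"
    and "\<And>i. i \<in> J \<Longrightarrow> F i \<in> spectral P"
  shows "closed_span J F = spectral P"
  unfolding closed_span_def
proof (rule L2_closure_eq_spectral[OF lin_span_subspace order_refl assms(1,2)])
  have "lin_span J F \<subseteq> spectral P"
    by (rule lin_span_minimal[OF subspace_spectral assms(3)])
  then show "f \<in> spectral P" if "f \<in> lin_span J F" for f
    using that by blast
qed

lemma lin_span_cnj:
  assumes "f \<in> lin_span J F"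
  shows "(\<lambda>y. cnj (f y)) \<in> lin_span J (\<lambda>i y. cnj (F i y))"
proof -
  obtain T c where f: "f = (\<lambda>y. \<Sum>i\<in>T. c i * F i y)" "finite T" "T \<subseteq> J"
    using assms unfolding lin_span_def by blast
  then show ?thesis
    unfolding lin_span_def by (intro CollectI exI[of _ T] exI[of _ "\<lambda>i. cnj (c i)"]) simp
qed

text \<open>The shift by one comes from \<open>cnj_chord\<close>; it maps the pairs of nonnegative
  indices exactly to the pairs of negative ones.\<close>

lemma cnj_ebasis: "cnj (ebasis j k y) = - ebasis (- j - 1) (- k - 1) y"
proof -
  have "ebasis (- j - 1) (- k - 1) y = chord y * (zp y powi (- j) / zp y) * (zm y powi (- k) / zm y)"
    unfolding ebasis_def by (simp add: power_int_diff)
  also have "\<dots> = - cnj (ebasis j k y)"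
    unfolding ebasis_def complex_cnj_mult complex_cnj_power_int cnj_chord cnj_zp cnj_zm
    by (simp add: power_int_minus power_int_inverse divide_inverse mult_ac)
  finally show ?thesis by simp
qed

lemma cnj_ebasis_even: "(\<lambda>y. cnj (ebasis_even j k y)) = ebasis_even (- k - 1) (- j - 1)"
  by (simp add: ebasis_even_def cnj_ebasis fun_eq_iff)

lemma inner_GH_cnj_ebasis:
  "inner_GH (\<lambda>y. cnj (f y)) (ebasis j k) = - cnj (inner_GH f (ebasis (- j - 1) (- k - 1)))"
proof -
  have "ebasis j k = (\<lambda>y. cnj (- ebasis (- j - 1) (- k - 1) y))"
    by (simp add: cnj_ebasis fun_eq_iff)
  then have "inner_GH (\<lambda>y. cnj (f y)) (ebasis j k) = inner_GH (\<lambda>y. cnj (f y)) (\<lambda>y. cnj (- ebasis (- j - 1) (- k - 1) y))"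
    by simp
  also have "\<dots> = cnj (inner_GH f (\<lambda>y. - ebasis (- j - 1) (- k - 1) y))"
    by (rule inner_GH_cnj)
  also have "inner_GH f (\<lambda>y. - ebasis (- j - 1) (- k - 1) y) = - inner_GH f (ebasis (- j - 1) (- k - 1))"
    unfolding inner_GH_def by simp
  finally show ?thesis by simp
qed

lemma spectral_cnj:
  assumes "f \<in> spectral P"
  shows "(\<lambda>y. cnj (f y)) \<in> spectral {(j, k). (- j - 1, - k - 1) \<in> P}"
proof (rule spectralI[OF L2_cnj[OF spectral_L2[OF assms]]])
  fix j k
  show "inner_GH (\<lambda>y. cnj (f y)) (ebasis k j) = - inner_GH (\<lambda>y. cnj (f y)) (ebasis j k)"
    unfolding inner_GH_cnj_ebasis spectral_anti[OF assms, of "- k - 1" "- j - 1"] by simp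
  assume "(j, k) \<notin> {(j, k). (- j - 1, - k - 1) \<in> P}"
  then show "inner_GH (\<lambda>y. cnj (f y)) (ebasis j k) = 0"
    unfolding inner_GH_cnj_ebasis using spectral_supp[OF assms, of "- j - 1" "- k - 1"] by simp
qed

subsection \<open>The X-ray transforms of the tensors z^p dz^q\<close>

text \<open>The position of the geodesic relative to its endpoints, (geod - zm) / chord. It solves
  the logistic equation and runs from 0 to 1; its dependence on a amounts to a complex time shift by
  a logarithm of 1 - i a.\<close>

definition sigma_path :: "real \<Rightarrow> real \<Rightarrow> complex" where
  "sigma_path a t = (1 - \<i> * of_real a) * of_real (exp t) / (1 + (1 - \<i> * of_real a) * of_real (exp t))"

lemma path_den_nonzero: "1 + (1 - \<i> * of_real a) * complex_of_real (exp t) \<noteq> 0"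
proof
  assume "1 + (1 - \<i> * of_real a) * complex_of_real (exp t) = 0"
  then have "Re (1 + (1 - \<i> * of_real a) * complex_of_real (exp t)) = 0"
    by simp
  then have "1 + exp t = 0"
    by simp
  then show False
    using exp_gt_zero[of t] by linarith
qed

lemma norm_path_den: "(cmod (1 + (1 - \<i> * of_real a) * complex_of_real (exp t)))\<^sup>2 = (1 + exp t)\<^sup>2 + a\<^sup>2 * (exp t)\<^sup>2"
  by (simp add: cmod_power2 power_mult_distrib)

text \<open>The exponential form of tanh, with the common factor -2 / (e^t + 1) of numerator and
  denominator cancelled.\<close>

lemma geod_eq:
  "geod b a t = cis b * ((1 - (1 + \<i> * of_real a) * of_real (exp t)) / (1 + (1 - \<i> * of_real a) * of_real (exp t)))"
proof -
  define e where "e = complex_of_real (exp t)"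
  have e1: "e + 1 \<noteq> 0"
  proof
    assume "e + 1 = 0"
    then have "complex_of_real (exp t + 1) = 0" by (simp add: e_def)
    then have "exp t + 1 = 0" by (simp only: of_real_eq_0_iff)
    then show False using exp_gt_zero[of t] by linarith
  qed
  have "(1 - 1 / x) / (1 + 1 / x) = (x - 1) / (x + 1)" if "x > 0" for x :: real
  proof -
    have "1 - 1 / x = (x - 1) / x" "1 + 1 / x = (x + 1) / x"
      using that by (simp_all add: field_simps)
    then show ?thesis
      using that by simp
  qed
  note frac = this
  have "exp (- 2 * (t/2)) = 1 / exp t"
    by (simp add: exp_minus inverse_eq_divide)
  then have "tanh (t/2) = (exp t - 1) / (exp t + 1)"
    unfolding tanh_real_altdef by (simp only: frac[OF exp_gt_zero])
  then have T: "complex_of_real (tanh (t/2)) = (e - 1) / (e + 1)"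
    by (simp add: e_def)
  have d: "1 + (1 - \<i> * of_real a) * e \<noteq> 0"
    unfolding e_def by (rule path_den_nonzero)
  have *: "X * (A / E) + Y = Z / E" if "E \<noteq> 0" "X * A + Y * E = Z" for X A E Y Z :: complex
    unfolding that(2)[symmetric] using that(1) by (simp add: add_divide_distrib)
  have num: "(2 + \<i> * of_real a) * of_real (tanh (t/2)) + \<i> * of_real a
      = - 2 * (1 - (1 + \<i> * of_real a) * e) / (e + 1)"
    unfolding T by (rule *[OF e1]) (simp add: algebra_simps)
  have "\<i> * of_real a * of_real (tanh (t/2)) + (- 2 + \<i> * of_real a)
      = - 2 * (1 + (1 - \<i> * of_real a) * e) / (e + 1)"
    unfolding T by (rule *[OF e1]) (simp add: algebra_simps)
  then have den: "\<i> * of_real a * of_real (tanh (t/2)) - 2 + \<i> * of_real a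
      = - 2 * (1 + (1 - \<i> * of_real a) * e) / (e + 1)"
    by (simp add: algebra_simps)
  have fin: "(- 2 * x / E) / (- 2 * y / E) = x / y" if "E \<noteq> 0" for x y E :: complex
    using that by simp
  show ?thesis
    unfolding geod_def num den e_def[symmetric] fin[OF e1] ..
qed

lemma geod_path: "geod b a t = zm (b, a) + sigma_path a t * chord (b, a)"
proof -
  have "(1 - (1 + \<i> * of_real a) * e) / (1 + (1 - \<i> * of_real a) * e)
      = 1 + ((1 - \<i> * of_real a) * e / (1 + (1 - \<i> * of_real a) * e)) * (- 2 / (1 - \<i> * of_real a))"
    if "1 + (1 - \<i> * of_real a) * e \<noteq> 0" for e :: complex
  proof -
    have *: "N / D = 1 + (w * e / D) * (- 2 / w)" if "w \<noteq> 0" "D \<noteq> 0" "N = D - 2 * e" for N D w :: complex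
      using that by (simp add: diff_divide_distrib)
    show ?thesis
      by (rule *) (use that in \<open>simp_all add: algebra_simps\<close>)
  qed
  note eq = this[OF path_den_nonzero, of t]
  have "c * (1 + S * (- 2 / w)) = c + S * (- 2 * c / w)" for c S w :: complex
    by (simp add: algebra_simps)
  then show ?thesis
    unfolding geod_eq chord_eq sigma_path_def eq zm_def fst_conv snd_conv .
qed

lemma sigma_path_deriv:
  "(sigma_path a has_vector_derivative sigma_path a t * (1 - sigma_path a t)) (at t)"
proof -
  define f where "f z = (1 - \<i> * of_real a) * exp z / (1 + (1 - \<i> * of_real a) * exp z)" for z :: complex
  have d: "1 + (1 - \<i> * of_real a) * exp (complex_of_real t) \<noteq> 0"
    using path_den_nonzero[of a t] by (simp add: exp_of_real)
  have "(f has_field_derivative f (of_real t) * (1 - f (of_real t))) (at (of_real t))"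
    unfolding f_def using d by (auto intro!: derivative_eq_intros simp: divide_simps power2_eq_square) (simp add: algebra_simps)
  from has_vector_derivative_real_field[OF this] show ?thesis
    unfolding sigma_path_def[abs_def] by (simp add: f_def exp_of_real)
qed

lemma norm_sigma_path_le: "cmod (sigma_path a t) \<le> 1"
proof -
  let ?d = "1 + (1 - \<i> * of_real a) * complex_of_real (exp t)"
  have "(cmod ((1 - \<i> * of_real a) * complex_of_real (exp t)))\<^sup>2 = (exp t)\<^sup>2 + a\<^sup>2 * (exp t)\<^sup>2"
    by (simp add: cmod_power2 power_mult_distrib)
  also have "\<dots> \<le> (cmod ?d)\<^sup>2"
    unfolding norm_path_den by (intro add_mono power_mono) auto
  finally have "cmod ((1 - \<i> * of_real a) * complex_of_real (exp t)) \<le> cmod ?d"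
    by (rule power2_le_imp_le) simp
  moreover have "cmod ?d > 0"
    using path_den_nonzero by simp
  ultimately show ?thesis
    unfolding sigma_path_def norm_divide by (simp add: divide_le_eq_1)
qed

lemma sigma_path_continuous: "continuous_on S (sigma_path a)"
  by (rule continuous_on_vector_derivative[OF has_vector_derivative_at_within[OF sigma_path_deriv]])

lemma sigma_path_one_minus: "1 - sigma_path a t = 1 / (1 + (1 - \<i> * of_real a) * of_real (exp t))"
  unfolding sigma_path_def using path_den_nonzero[of a t] by (simp add: divide_simps)

lemma sigma_path_bot: "(sigma_path a \<longlongrightarrow> 0) at_bot"
proof -
  have "((\<lambda>t. (1 - \<i> * of_real a) * complex_of_real (exp t) / (1 + (1 - \<i> * of_real a) * complex_of_real (exp t)))
     \<longlongrightarrow> (1 - \<i> * of_real a) * complex_of_real 0 / (1 + (1 - \<i> * of_real a) * complex_of_real 0)) at_bot"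
    by (intro tendsto_intros exp_at_bot) simp
  then show ?thesis
    by (simp add: sigma_path_def[abs_def])
qed

lemma sigma_path_top: "(sigma_path a \<longlongrightarrow> 1) at_top"
proof -
  have exp0: "((\<lambda>t::real. exp (- t)) \<longlongrightarrow> 0) at_top"
    using filterlim_compose[OF exp_at_bot filterlim_uminus_at_bot_at_top] .
  have "((\<lambda>t. (1 - \<i> * of_real a) / (complex_of_real (exp (- t)) + (1 - \<i> * of_real a)))
     \<longlongrightarrow> (1 - \<i> * of_real a) / (complex_of_real 0 + (1 - \<i> * of_real a))) at_top"
    by (intro tendsto_intros exp0) simp
  moreover have "(1 - \<i> * of_real a) / (complex_of_real (exp (- t)) + (1 - \<i> * of_real a)) = sigma_path a t" for t
  proof -
    have "sigma_path a t = ((1 - \<i> * of_real a) * complex_of_real (exp t)) / ((complex_of_real (exp (- t)) + (1 - \<i> * of_real a)) * complex_of_real (exp t))"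
      unfolding sigma_path_def by (simp add: distrib_right flip: of_real_mult exp_add)
    then show ?thesis by simp
  qed
  ultimately show ?thesis by simp
qed

lemma logistic_integral:
  "integrable lborel (\<lambda>t::real. exp t / (1 + exp t)\<^sup>2)" "(\<integral>t. exp t / (1 + exp t)\<^sup>2 \<partial>lborel) = (1::real)"
proof -
  have nz: "1 + exp t \<noteq> (0::real)" for t
    using exp_gt_zero[of t] by linarith
  have exp0: "((\<lambda>t::real. exp (- t)) \<longlongrightarrow> 0) at_top"
    using filterlim_compose[OF exp_at_bot filterlim_uminus_at_bot_at_top] .
  have F: "((\<lambda>t. exp t / (1 + exp t)) has_real_derivative exp t / (1 + exp t)\<^sup>2) (at t)" for t :: real
    using nz[of t] by (auto intro!: derivative_eq_intros simp: power2_eq_square algebra_simps)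
  have c: "continuous_on UNIV (\<lambda>t::real. exp t / (1 + exp t)\<^sup>2)"
    using nz by (intro continuous_intros) auto
  have "((\<lambda>t::real. exp t / (1 + exp t)) \<longlongrightarrow> 0 / (1 + 0)) at_bot"
    by (intro tendsto_intros exp_at_bot) simp
  then have A: "((\<lambda>t::real. exp t / (1 + exp t)) \<longlongrightarrow> 0) at_bot" by simp
  have "((\<lambda>t::real. 1 / (exp (- t) + 1)) \<longlongrightarrow> 1 / (0 + 1)) at_top"
    by (intro tendsto_intros exp0) simp
  moreover have "1 / (exp (- t) + 1) = exp t / (1 + exp t)" for t :: real
    using nz[of t] by (simp add: exp_minus field_simps)
  ultimately have B: "((\<lambda>t::real. exp t / (1 + exp t)) \<longlongrightarrow> 1) at_top" by simp
  show "integrable lborel (\<lambda>t::real. exp t / (1 + exp t)\<^sup>2)" "(\<integral>t. exp t / (1 + exp t)\<^sup>2 \<partial>lborel) = (1::real)"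
    using line_FTC_nonneg[OF F c _ A B] by simp_all
qed

text \<open>The denominator has modulus at least its real part 1 + e^t, so the speed is dominated by
  a multiple of the logistic density.\<close>

lemma sigma_path_speed_integrable: "integrable lborel (\<lambda>t. sigma_path a t * (1 - sigma_path a t))"
proof (rule Bochner_Integration.integrable_bound)
  show "integrable lborel (\<lambda>t. cmod (1 - \<i> * of_real a) * (exp t / (1 + exp t)\<^sup>2))"
    by (intro integrable_mult_right logistic_integral(1))
  have "continuous_on UNIV (\<lambda>t. sigma_path a t * (1 - sigma_path a t))"
    by (intro continuous_intros sigma_path_continuous)
  then show "(\<lambda>t. sigma_path a t * (1 - sigma_path a t)) \<in> borel_measurable lborel"
    by (simp add: borel_measurable_continuous_onI)
  show "AE t in lborel. norm (sigma_path a t * (1 - sigma_path a t))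
      \<le> norm (cmod (1 - \<i> * of_real a) * (exp t / (1 + exp t)\<^sup>2))"
  proof (rule AE_I2)
    fix t
    let ?d = "1 + (1 - \<i> * of_real a) * complex_of_real (exp t)"
    have pos: "(1 + exp t)\<^sup>2 > 0"
      using exp_gt_zero[of t] by (intro zero_less_power) linarith
    have "norm (sigma_path a t * (1 - sigma_path a t)) = cmod (1 - \<i> * of_real a) * exp t / (cmod ?d)\<^sup>2"
      unfolding sigma_path_one_minus by (simp add: sigma_path_def norm_mult norm_divide power2_eq_square)
    also have "\<dots> \<le> cmod (1 - \<i> * of_real a) * exp t / (1 + exp t)\<^sup>2"
      unfolding norm_path_den using pos by (intro divide_left_mono) (auto intro!: add_pos_nonneg mult_pos_pos)
    finally show "norm (sigma_path a t * (1 - sigma_path a t))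
        \<le> norm (cmod (1 - \<i> * of_real a) * (exp t / (1 + exp t)\<^sup>2))"
      by simp
  qed
qed

text \<open>A primitive on the whole plane makes the integral independent of the path from 0 to 1.\<close>

definition path_value :: "(complex \<Rightarrow> complex) \<Rightarrow> complex \<Rightarrow> bool" where
  "path_value f c \<longleftrightarrow> (\<exists>F. (\<forall>z. (F has_field_derivative f z) (at z)) \<and> F 1 - F 0 = c) \<and> continuous_on UNIV f"

lemma path_value_add: "path_value f c \<Longrightarrow> path_value g d \<Longrightarrow> path_value (\<lambda>z. f z + g z) (c + d)"
  unfolding path_value_def
proof (elim exE conjE, intro conjI continuous_on_add)
  fix F G
  assume F: "\<forall>z. (F has_field_derivative f z) (at z)" "F 1 - F 0 = c"
    and G: "\<forall>z. (G has_field_derivative g z) (at z)" "G 1 - G 0 = d"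
  show "\<exists>F. (\<forall>z. (F has_field_derivative f z + g z) (at z)) \<and> F 1 - F 0 = c + d"
    by (rule exI[of _ "\<lambda>z. F z + G z"]) (use F G in \<open>auto intro!: derivative_intros\<close>)
qed

lemma path_value_scale: "path_value f c \<Longrightarrow> path_value (\<lambda>z. k * f z) (k * c)"
  unfolding path_value_def
proof (elim exE conjE, intro conjI continuous_on_mult continuous_on_const)
  fix F
  assume F: "\<forall>z. (F has_field_derivative f z) (at z)" "F 1 - F 0 = c"
  show "\<exists>F. (\<forall>z. (F has_field_derivative k * f z) (at z)) \<and> F 1 - F 0 = k * c"
    by (rule exI[of _ "\<lambda>z. k * F z"])
      (use F in \<open>auto intro!: derivative_eq_intros simp: right_diff_distrib\<close>)
qed

lemma path_value_sum:
  "finite T \<Longrightarrow> (\<And>i. i \<in> T \<Longrightarrow> path_value (f i) (c i)) \<Longrightarrow> path_value (\<lambda>z. \<Sum>i\<in>T. f i z) (\<Sum>i\<in>T. c i)"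
proof (induction T rule: finite_induct)
  case empty
  show ?case
    unfolding path_value_def by (auto intro!: exI[of _ "\<lambda>_. 0"])
next
  case (insert i T)
  then show ?case
    by (simp add: path_value_add)
qed

lemma path_value_integrable:
  assumes "path_value f c"
  shows "integrable lborel (\<lambda>t. f (sigma_path a t) * (sigma_path a t * (1 - sigma_path a t)))"
    "continuous_on UNIV (\<lambda>t. f (sigma_path a t) * (sigma_path a t * (1 - sigma_path a t)))"
proof -
  have f: "continuous_on UNIV f"
    using assms unfolding path_value_def by blast
  have fs: "continuous_on UNIV (\<lambda>t. f (sigma_path a t))"
    using continuous_on_compose2[OF f sigma_path_continuous] by simp
  have "compact (f ` cball 0 1)"
    by (intro compact_continuous_image continuous_on_subset[OF f]) auto
  then obtain B where B: "\<And>z. z \<in> cball 0 1 \<Longrightarrow> cmod (f z) \<le> B"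
    by (meson bounded_iff compact_imp_bounded imageI)
  have "integrable lborel (\<lambda>t. sigma_path a t * (1 - sigma_path a t) * f (sigma_path a t))"
    by (rule integrable_mult_bounded[OF sigma_path_speed_integrable, where B = B])
      (use fs B norm_sigma_path_le in \<open>auto intro: borel_measurable_continuous_onI\<close>)
  then show "integrable lborel (\<lambda>t. f (sigma_path a t) * (sigma_path a t * (1 - sigma_path a t)))"
    by (simp add: mult.commute)
  show "continuous_on UNIV (\<lambda>t. f (sigma_path a t) * (sigma_path a t * (1 - sigma_path a t)))"
    by (intro continuous_intros fs sigma_path_continuous)
qed

lemma path_value_integral:
  assumes "path_value f c"
  shows "(\<integral>t. f (sigma_path a t) * (sigma_path a t * (1 - sigma_path a t)) \<partial>lborel) = c"
proof -
  obtain F where F: "\<And>z. (F has_field_derivative f z) (at z)" "F 1 - F 0 = c"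
    using assms unfolding path_value_def by blast
  have Fc: "isCont F z" for z
    using F(1) by (rule DERIV_isCont)
  have "(\<integral>t. f (sigma_path a t) * (sigma_path a t * (1 - sigma_path a t)) \<partial>lborel) = F 1 - F 0"
  proof (rule line_FTC[OF _ path_value_integrable(2)[OF assms] path_value_integrable(1)[OF assms]])
    show "((\<lambda>t. F (sigma_path a t)) has_vector_derivative f (sigma_path a t) * (sigma_path a t * (1 - sigma_path a t))) (at t)" for t
      using field_vector_diff_chain_at[OF sigma_path_deriv F(1)] by (simp add: comp_def mult.commute)
    show "((\<lambda>t. F (sigma_path a t)) \<longlongrightarrow> F 0) at_bot"
      by (rule isCont_tendsto_compose[OF Fc sigma_path_bot])
    show "((\<lambda>t. F (sigma_path a t)) \<longlongrightarrow> F 1) at_top"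
      by (rule isCont_tendsto_compose[OF Fc sigma_path_top])
  qed
  with F(2) show ?thesis by simp
qed

lemma path_value_unique: "path_value f c \<Longrightarrow> path_value f d \<Longrightarrow> c = d"
  using path_value_integral[of f c 0] path_value_integral[of f d 0] by simp

text \<open>The Beta integral at integer arguments, by induction on n: the boundary term z^(m+1)
  (1-z)^(n+1) / (m+1) of the integration by parts vanishes at 0 and 1.\<close>

lemma path_value_beta:
  "path_value (\<lambda>z. z ^ m * (1 - z) ^ n) (fact m * fact n / fact (m + n + 1))"
proof (induction n arbitrary: m)
  case 0
  have "((\<lambda>z. z ^ Suc m / of_nat (Suc m)) has_field_derivative z ^ m) (at z)" for z :: complex
    using DERIV_cdivide[OF DERIV_power[OF DERIV_ident, of "Suc m" z], of "of_nat (Suc m)"]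
    by (simp del: of_nat_Suc power_Suc)
  then show ?case
    unfolding path_value_def
    by (intro conjI exI[of _ "\<lambda>z. z ^ Suc m / of_nat (Suc m)"])
      (auto intro!: continuous_intros simp: fact_reduce[of "Suc m"] simp del: of_nat_Suc power_Suc)
next
  case (Suc n)
  have 1: "path_value (\<lambda>z. z ^ m * (1 - z) ^ Suc n - of_nat (Suc n) / of_nat (Suc m) * (z ^ Suc m * (1 - z) ^ n)) 0"
    unfolding path_value_def
  proof (intro conjI exI[of _ "\<lambda>z. z ^ Suc m * (1 - z) ^ Suc n / of_nat (Suc m)"] allI)
    fix z :: complex
    show "((\<lambda>z. z ^ Suc m * (1 - z) ^ Suc n / of_nat (Suc m)) has_field_derivative
        z ^ m * (1 - z) ^ Suc n - of_nat (Suc n) / of_nat (Suc m) * (z ^ Suc m * (1 - z) ^ n)) (at z)"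
      by (auto intro!: derivative_eq_intros simp del: of_nat_Suc power_Suc simp: field_simps)
  qed (auto intro!: continuous_intros simp del: of_nat_Suc)
  have "path_value (\<lambda>z. of_nat (Suc n) / of_nat (Suc m) * (z ^ Suc m * (1 - z) ^ n))
      (of_nat (Suc n) / of_nat (Suc m) * (fact (Suc m) * fact n / fact (Suc m + n + 1)))"
    by (rule path_value_scale[OF Suc.IH])
  from path_value_add[OF 1 this]
  have 2: "path_value (\<lambda>z. z ^ m * (1 - z) ^ Suc n)
      (of_nat (Suc n) / of_nat (Suc m) * (fact (Suc m) * fact n / fact (Suc m + n + 1)))"
    by simp
  have 3: "of_nat (Suc n) / of_nat (Suc m) * (fact (Suc m) * fact n / fact (Suc m + n + 1))
      = (fact m * fact (Suc n) / fact (m + Suc n + 1) :: complex)"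
    by (simp add: fact_Suc del: of_nat_Suc)
  show ?case
    using 2 unfolding 3 .
qed

text \<open>The derivative of F z - F (1 - z) is f z + f (1 - z) = 0, so this difference is
  constant, and at 1/2 it is 0.\<close>

lemma path_value_odd:
  assumes "path_value f c" "\<And>z. f (1 - z) = - f z"
  shows "c = 0"
proof -
  obtain F where F: "\<And>z. (F has_field_derivative f z) (at z)" "F 1 - F 0 = c"
    using assms(1) unfolding path_value_def by blast
  have "((\<lambda>z. F z - F (1 - z)) has_field_derivative 0) (at z)" for z
  proof -
    have "((\<lambda>z. F (1 - z)) has_field_derivative f (1 - z) * (- 1)) (at z)"
      by (rule DERIV_chain2[OF F(1)]) (auto intro!: derivative_eq_intros)
    from DERIV_diff[OF F(1) this] show ?thesis
      using assms(2) by simp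
  qed
  then obtain k where "\<And>z. F z - F (1 - z) = k"
    using has_field_derivative_zero_constant[of UNIV "\<lambda>z. F z - F (1 - z)"] by auto
  from this[of 1] this[of "1/2"] F(2) show ?thesis
    by simp
qed

text \<open>The velocity is \<open>chord\<close> times s (1 - s) at s =
  \<open>sigma_path a t\<close>. One of the q factors s (1 - s) is spent on the change of variables,
  which leaves the exponent q - 1.\<close>

lemma Ipq_path_value:
  assumes "q \<ge> 1" "path_value (\<lambda>s. (zm y + s * chord y) ^ p * (s * (1 - s)) ^ (q - 1)) c"
  shows "Ipq p q y = chord y ^ q * c"
proof -
  obtain b a where y: "y = (b, a)" by (cases y)
  have d: "(geod b a has_vector_derivative sigma_path a t * (1 - sigma_path a t) * chord y) (at t)" for t
    unfolding geod_path[abs_def] y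
    by (auto intro!: derivative_eq_intros has_vector_derivative_mult_left sigma_path_deriv)
  have "(geod b a t) ^ p * vector_derivative (geod b a) (at t) ^ q
      = chord y ^ q * ((\<lambda>s. (zm y + s * chord y) ^ p * (s * (1 - s)) ^ (q - 1)) (sigma_path a t)
        * (sigma_path a t * (1 - sigma_path a t)))" for t
    unfolding vector_derivative_at[OF d]
    using assms(1) power_minus_mult[of q "sigma_path a t * (1 - sigma_path a t)"]
    by (simp add: geod_path y power_mult_distrib mult_ac)
  then have "Ipq p q y = (\<integral>t. chord y ^ q * ((\<lambda>s. (zm y + s * chord y) ^ p * (s * (1 - s)) ^ (q - 1)) (sigma_path a t)
        * (sigma_path a t * (1 - sigma_path a t))) \<partial>lborel)"
    unfolding Ipq_def y by simp
  also have "\<dots> = chord y ^ q * c"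
    unfolding integral_mult_right_zero path_value_integral[OF assms(2)] ..
  finally show ?thesis .
qed

text \<open>The j-th binomial coefficient of (s zp + (1 - s) zm)^p times the Beta integral of
  s^(j+m) (1 - s)^(p-j+m), where m = q - 1.\<close>

definition wcoeff :: "nat \<Rightarrow> nat \<Rightarrow> nat \<Rightarrow> real" where
  "wcoeff p m j = of_nat (p choose j) * fact (j + m) * fact (p - j + m) / fact (p + 2 * m + 1)"

lemma Ipq_ends:
  "Ipq p (Suc m) y = chord y ^ Suc m * (\<Sum>j\<le>p. complex_of_real (wcoeff p m j) * zp y ^ j * zm y ^ (p - j))"
proof (rule Ipq_path_value)
  have "(zm y + s * chord y) ^ p * (s * (1 - s)) ^ (Suc m - 1)
      = (\<Sum>j\<le>p. (of_nat (p choose j) * zp y ^ j * zm y ^ (p - j)) * (s ^ (j + m) * (1 - s) ^ (p - j + m)))" for s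
  proof -
    have "zm y + s * chord y = s * zp y + (1 - s) * zm y"
      by (simp add: chord_def algebra_simps)
    then have "(zm y + s * chord y) ^ p = (\<Sum>j\<le>p. of_nat (p choose j) * (s * zp y) ^ j * ((1 - s) * zm y) ^ (p - j))"
      by (simp add: binomial_ring)
    then show ?thesis
      by (simp only: sum_distrib_left sum_distrib_right power_mult_distrib power_add mult_ac diff_Suc_1)
  qed
  moreover have "path_value (\<lambda>s. \<Sum>j\<le>p. (of_nat (p choose j) * zp y ^ j * zm y ^ (p - j)) * (s ^ (j + m) * (1 - s) ^ (p - j + m)))
     (\<Sum>j\<le>p. (of_nat (p choose j) * zp y ^ j * zm y ^ (p - j)) * (fact (j + m) * fact (p - j + m) / fact ((j + m) + (p - j + m) + 1)))"
    by (intro path_value_sum path_value_scale path_value_beta) simp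
  moreover have "(\<Sum>j\<le>p. (of_nat (p choose j) * zp y ^ j * zm y ^ (p - j)) * (fact (j + m) * fact (p - j + m) / fact ((j + m) + (p - j + m) + 1)))
      = (\<Sum>j\<le>p. complex_of_real (wcoeff p m j) * zp y ^ j * zm y ^ (p - j))"
  proof (intro sum.cong refl)
    fix j assume "j \<in> {..p}"
    then have "(j + m) + (p - j + m) + 1 = p + 2 * m + 1" by simp
    then show "(of_nat (p choose j) * zp y ^ j * zm y ^ (p - j)) * (fact (j + m) * fact (p - j + m) / fact ((j + m) + (p - j + m) + 1))
      = complex_of_real (wcoeff p m j) * zp y ^ j * zm y ^ (p - j)"
      by (simp only: wcoeff_def of_real_divide of_real_mult of_real_fact of_real_of_nat_eq) (simp add: mult_ac)
  qed
  ultimately show "path_value (\<lambda>s. (zm y + s * chord y) ^ p * (s * (1 - s)) ^ (Suc m - 1))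
    (\<Sum>j\<le>p. complex_of_real (wcoeff p m j) * zp y ^ j * zm y ^ (p - j))"
    by simp
qed simp

text \<open>The expansion is about the midpoint, zm + s chord = (s - 1/2) chord + (zp + zm) / 2. The
  weight (s (1 - s))^m is symmetric under s to 1 - s, which kills the odd powers of s - 1/2. This
  parity gives evenness under \<open>SA\<close> for even tensor degree, and c 0 \<noteq> 0 makes the
  expansion invertible.\<close>

lemma Ipq_chord_powers:
  "\<exists>c. c 0 \<noteq> 0 \<and> (\<forall>i. odd i \<longrightarrow> c i = 0) \<and>
    (\<forall>y. Ipq p (Suc m) y = (\<Sum>i\<le>p. c i * (chord y ^ (Suc m + i) * (zp y + zm y) ^ (p - i))))"
proof -
  have "\<exists>d. path_value (\<lambda>s. (s - 1/2) ^ i * (s * (1 - s)) ^ m) d" for i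
  proof -
    have eq: "(s - 1/2) ^ i * (s * (1 - s)) ^ m
        = (\<Sum>k\<le>i. (of_nat (i choose k) * (- 1/2) ^ (i - k)) * (s ^ (k + m) * (1 - s) ^ m))" for s :: complex
    proof -
      have "(s - 1/2) ^ i = (\<Sum>k\<le>i. of_nat (i choose k) * s ^ k * (- 1/2) ^ (i - k))"
        using binomial_ring[of s "- 1/2" i] by simp
      then show ?thesis
        by (simp only: sum_distrib_left sum_distrib_right power_mult_distrib power_add mult_ac)
    qed
    show ?thesis
      unfolding eq
      by (rule exI[of _ "\<Sum>k\<le>i. (of_nat (i choose k) * (- 1/2) ^ (i - k)) * (fact (k + m) * fact m / fact (k + m + m + 1))"])
        (intro path_value_sum path_value_scale path_value_beta; simp)
  qed
  then obtain d where d: "\<And>i. path_value (\<lambda>s. (s - 1/2) ^ i * (s * (1 - s)) ^ m) (d i)"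
    by metis
  have d_odd: "d i = 0" if "odd i" for i
  proof (rule path_value_odd[OF d[of i]])
    fix s :: complex
    have "(1 - s - 1/2) ^ i = (- (s - 1/2)) ^ i"
      by (simp add: algebra_simps)
    also have "\<dots> = - ((s - 1/2) ^ i)"
      using that by (rule power_minus_odd)
    finally show "(1 - s - 1/2) ^ i * ((1 - s) * (1 - (1 - s))) ^ m = - ((s - 1/2) ^ i * (s * (1 - s)) ^ m)"
      by (simp add: mult.commute)
  qed
  have d0: "d 0 \<noteq> 0"
  proof -
    have "path_value (\<lambda>s. s ^ m * (1 - s) ^ m) (d 0)"
      using d[of 0] by (simp add: power_mult_distrib)
    then have "d 0 = fact m * fact m / fact (m + m + 1)"
      by (rule path_value_unique[OF _ path_value_beta])
    moreover have "(fact m * fact m / fact (m + m + 1) :: complex) \<noteq> 0"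
      by (metis divide_eq_0_iff mult_eq_0_iff fact_nonzero)
    ultimately show ?thesis
      by (simp only: not_False_eq_True)
  qed
  have "Ipq p (Suc m) y = chord y ^ Suc m * (\<Sum>i\<le>p. (of_nat (p choose i) * chord y ^ i * ((zp y + zm y) / 2) ^ (p - i)) * d i)" for y
  proof (rule Ipq_path_value)
    have "(zm y + s * chord y) ^ p * (s * (1 - s)) ^ (Suc m - 1)
      = (\<Sum>i\<le>p. (of_nat (p choose i) * chord y ^ i * ((zp y + zm y) / 2) ^ (p - i)) * ((s - 1/2) ^ i * (s * (1 - s)) ^ m))" for s
    proof -
      have "zm y + s * chord y = (s - 1/2) * chord y + (zp y + zm y) / 2"
        by (simp add: chord_def field_simps)
      then have "(zm y + s * chord y) ^ p = (\<Sum>i\<le>p. of_nat (p choose i) * ((s - 1/2) * chord y) ^ i * ((zp y + zm y) / 2) ^ (p - i))"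
        by (simp only: binomial_ring)
      then show ?thesis
        by (simp only: sum_distrib_left sum_distrib_right power_mult_distrib mult_ac diff_Suc_1)
    qed
    moreover have "path_value (\<lambda>s. \<Sum>i\<le>p. (of_nat (p choose i) * chord y ^ i * ((zp y + zm y) / 2) ^ (p - i)) * ((s - 1/2) ^ i * (s * (1 - s)) ^ m))
       (\<Sum>i\<le>p. (of_nat (p choose i) * chord y ^ i * ((zp y + zm y) / 2) ^ (p - i)) * d i)"
      by (intro path_value_sum path_value_scale d) simp
    ultimately show "path_value (\<lambda>s. (zm y + s * chord y) ^ p * (s * (1 - s)) ^ (Suc m - 1))
       (\<Sum>i\<le>p. (of_nat (p choose i) * chord y ^ i * ((zp y + zm y) / 2) ^ (p - i)) * d i)"
      by simp
  qed simp
  then have "Ipq p (Suc m) y = (\<Sum>i\<le>p. (of_nat (p choose i) * d i / 2 ^ (p - i)) * (chord y ^ (Suc m + i) * (zp y + zm y) ^ (p - i)))" for y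
    by (simp add: sum_distrib_left power_divide power_add mult_ac)
  then show ?thesis
    using d0 d_odd by (intro exI[of _ "\<lambda>i. of_nat (p choose i) * d i / 2 ^ (p - i)"]) simp
qed

subsection \<open>Finite differences and orthogonality\<close>

definition fdiff :: "(nat \<Rightarrow> real) \<Rightarrow> nat \<Rightarrow> real" where
  "fdiff g j = g (Suc j) - g j"

lemma fdiff_pow_zero: "(fdiff ^^ m) (\<lambda>_. 0) = (\<lambda>_. 0)"
  by (induction m) (simp_all add: fdiff_def[abs_def])

lemma fdiff_pow_add: "(fdiff ^^ m) (\<lambda>j. f j + g j) = (\<lambda>j. (fdiff ^^ m) f j + (fdiff ^^ m) g j)"
proof (induction m arbitrary: f g)
  case (Suc m)
  have "fdiff (\<lambda>j. f j + g j) = (\<lambda>j. fdiff f j + fdiff g j)"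
    by (simp add: fdiff_def fun_eq_iff)
  then show ?case
    by (simp only: funpow_Suc_right comp_def Suc.IH)
qed simp

lemma fdiff_pow_scale: "(fdiff ^^ m) (\<lambda>j. c * f j) = (\<lambda>j. c * (fdiff ^^ m) f j)"
proof (induction m arbitrary: f)
  case (Suc m)
  have "fdiff (\<lambda>j. c * f j) = (\<lambda>j. c * fdiff f j)"
    by (simp add: fdiff_def fun_eq_iff right_diff_distrib)
  then show ?case
    by (simp only: funpow_Suc_right comp_def Suc.IH)
qed simp

lemma fdiff_pow_shift: "(fdiff ^^ m) (\<lambda>j. f (Suc j)) = (\<lambda>j. (fdiff ^^ m) f (Suc j))"
proof (induction m arbitrary: f)
  case (Suc m)
  have "fdiff (\<lambda>j. f (Suc j)) = (\<lambda>j. fdiff f (Suc j))"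
    by (simp add: fdiff_def fun_eq_iff)
  then show ?case
    by (simp only: funpow_Suc_right comp_def Suc.IH)
qed simp

text \<open>Annihilation by m differences means polynomial of degree below m, and a linear factor
  raises the degree by one; the proof is the discrete product rule.\<close>

lemma fdiff_pow_linear_mult:
  assumes "(fdiff ^^ m) g = (\<lambda>_. 0)"
  shows "(fdiff ^^ Suc m) (\<lambda>j. (\<alpha> + \<beta> * real j) * g j) = (\<lambda>_. 0)"
  using assms
proof (induction m arbitrary: g)
  case 0
  then have "g j = 0" for j
    by (simp add: fun_eq_iff)
  then show ?case
    by (simp add: fdiff_def fun_eq_iff)
next
  case (Suc m)
  have "fdiff (\<lambda>j. (\<alpha> + \<beta> * real j) * g j) = (\<lambda>j. (\<alpha> + \<beta> * real j) * fdiff g j + \<beta> * g (Suc j))"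
    by (simp add: fdiff_def fun_eq_iff algebra_simps)
  then have "(fdiff ^^ Suc (Suc m)) (\<lambda>j. (\<alpha> + \<beta> * real j) * g j)
      = (fdiff ^^ Suc m) (\<lambda>j. (\<alpha> + \<beta> * real j) * fdiff g j + \<beta> * g (Suc j))"
    by (subst funpow_Suc_right) simp
  also have "\<dots> = (\<lambda>j. (fdiff ^^ Suc m) (\<lambda>j. (\<alpha> + \<beta> * real j) * fdiff g j) j
      + \<beta> * (fdiff ^^ Suc m) g (Suc j))"
    unfolding fdiff_pow_add fdiff_pow_scale fdiff_pow_shift ..
  also have "(fdiff ^^ Suc m) (\<lambda>j. (\<alpha> + \<beta> * real j) * fdiff g j) = (\<lambda>_. 0)"
    by (rule Suc.IH) (use Suc.prems in \<open>simp add: funpow_swap1\<close>)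
  finally show ?case
    unfolding Suc.prems by simp
qed

lemma fdiff_pow_prod:
  assumes "finite T"
  shows "(fdiff ^^ Suc (card T)) (\<lambda>j. \<Prod>i\<in>T. \<alpha> i + \<beta> i * real j) = (\<lambda>_. 0)"
  using assms
proof (induction T rule: finite_induct)
  case empty
  show ?case
    by (simp add: fdiff_def fun_eq_iff)
next
  case (insert i T)
  then show ?case
    using fdiff_pow_linear_mult[OF insert.IH, of "\<alpha> i" "\<beta> i"] by simp
qed

lemma fdiff_pow_add_exp:
  assumes "(fdiff ^^ m) g = (\<lambda>_. 0)" "m \<le> n"
  shows "(fdiff ^^ n) g = (\<lambda>_. 0)"
proof -
  have "(fdiff ^^ n) g = (fdiff ^^ (n - m)) ((fdiff ^^ m) g)"
    using assms(2) by (simp flip: funpow_add comp_apply[of "fdiff ^^ (n - m)"])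
  then show ?thesis
    unfolding assms(1) fdiff_pow_zero .
qed

section \<open>Polynomials encoding the coefficients of the transforms\<close>

lemma coeff_xm1_mult: "coeff ([:-1, 1:] * H) j = (if j = 0 then 0 else coeff H (j - 1)) - coeff H (j :: nat)"
  for H :: "real poly"
proof -
  have "[:-1, 1:] * H = pCons 0 H - H"
    by (simp add: mult_pCons_left)
  then show ?thesis
    by (simp add: coeff_pCons split: nat.split)
qed

text \<open>Summation by parts: multiplication by X - 1 is a negated backward difference of
  coefficients, and the degree bound removes the boundary term at n.\<close>

lemma sum_coeff_xm1_mult:
  fixes H :: "real poly"
  assumes "degree H < n"
  shows "(\<Sum>j\<le>n. g j * coeff ([:-1, 1:] * H) j) = (\<Sum>j\<le>n. fdiff g j * coeff H j)"
proof -
  have H0: "coeff H n = 0"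
    using assms by (rule coeff_eq_0)
  obtain m where n: "n = Suc m"
    using assms by (cases n) auto
  have "(\<Sum>j\<le>n. g j * (if j = 0 then 0 else coeff H (j - 1))) = (\<Sum>j\<le>m. g (Suc j) * coeff H j)"
    unfolding n sum.atMost_Suc_shift by simp
  also have "\<dots> = (\<Sum>j\<le>n. g (Suc j) * coeff H j)"
    using H0 unfolding n by simp
  finally show ?thesis
    unfolding coeff_xm1_mult fdiff_def by (simp add: right_diff_distrib left_diff_distrib sum_subtractf)
qed

lemma sum_coeff_fdiff_zero:
  fixes H :: "real poly"
  assumes "(fdiff ^^ l) g = (\<lambda>_. 0)" "H \<noteq> 0" "l + degree H \<le> n"
  shows "(\<Sum>j\<le>n. g j * coeff ([:-1, 1:] ^ l * H) j) = 0"
  using assms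
proof (induction l arbitrary: g)
  case 0
  then show ?case by simp
next
  case (Suc l)
  have "degree ([:-1, 1:] ^ l * H) = l + degree H"
    using Suc.prems(2) by (simp add: degree_mult_eq degree_power_eq)
  then have "(\<Sum>j\<le>n. g j * coeff ([:-1, 1:] ^ Suc l * H) j) = (\<Sum>j\<le>n. fdiff g j * coeff ([:-1, 1:] ^ l * H) j)"
    unfolding power_Suc mult.assoc by (intro sum_coeff_xm1_mult) (use Suc.prems(3) in simp)
  also have "\<dots> = 0"
    by (rule Suc.IH) (use Suc.prems in \<open>simp_all add: funpow_swap1\<close>)
  finally show ?case .
qed

definition Wpoly :: "nat \<Rightarrow> nat \<Rightarrow> real poly" where
  "Wpoly p m = (\<Sum>j\<le>p. monom (wcoeff p m j) j)"

text \<open>In the variable zp / zm, \<open>Wpoly\<close> is the sum in \<open>Ipq_ends\<close> and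
  (X - 1)^m is chord^m / zm^m. These are therefore the coefficients of \<open>Ipq p (Suc m)\<close>
  once a single factor \<open>chord\<close> is split off.\<close>

definition Fpoly :: "nat \<Rightarrow> nat \<Rightarrow> real poly" where
  "Fpoly p m = [:-1, 1:] ^ m * Wpoly p m"

lemma coeff_Wpoly: "coeff (Wpoly p m) j = (if j \<le> p then wcoeff p m j else 0)"
  by (simp add: Wpoly_def coeff_sum)

lemma wcoeff_pos: "j \<le> p \<Longrightarrow> wcoeff p m j > 0"
  by (simp add: wcoeff_def)

lemma degree_Wpoly: "degree (Wpoly p m) = p" and Wpoly_nonzero: "Wpoly p m \<noteq> 0"
proof -
  have c: "coeff (Wpoly p m) p \<noteq> 0"
    using wcoeff_pos[of p p m] by (simp add: coeff_Wpoly)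
  then show "Wpoly p m \<noteq> 0" by auto
  have "degree (Wpoly p m) \<le> p"
    by (rule degree_le) (simp add: coeff_Wpoly)
  then show "degree (Wpoly p m) = p"
    using le_degree[OF c] by simp
qed

lemma degree_Fpoly: "degree (Fpoly p m) = m + p" and Fpoly_nonzero: "Fpoly p m \<noteq> 0"
  unfolding Fpoly_def using Wpoly_nonzero[of p m] by (simp_all add: degree_mult_eq degree_power_eq degree_Wpoly)

text \<open>Falling factorial: it writes (j + m)! / j! as a polynomial in j + m of degree m with
  zeros at 0, ..., m - 1.\<close>

definition falling :: "nat \<Rightarrow> real \<Rightarrow> real" where
  "falling m x = (\<Prod>r<m. x - real r)"

lemma falling_zero: "i < m \<Longrightarrow> falling m (real i) = 0"
  unfolding falling_def by (rule prod_zero) auto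

lemma falling_fact: "fact j * falling m (real (j + m)) = fact (j + m)"
proof (induction m)
  case (Suc m)
  have "falling (Suc m) (real (j + Suc m)) = real (j + Suc m) * falling m (real (j + m))"
    unfolding falling_def by (subst prod.lessThan_Suc_shift) (simp add: algebra_simps)
  then have "fact j * falling (Suc m) (real (j + Suc m)) = real (j + Suc m) * (fact j * falling m (real (j + m)))"
    by (simp only: mult_ac)
  then show ?case
    unfolding Suc.IH by simp
qed (simp add: falling_def)

lemma wcoeff_falling:
  assumes "j \<le> p"
  shows "wcoeff p m j = fact p / fact (p + 2 * m + 1) * (falling m (real (j + m)) * falling m (real (p - j + m)))"
proof -
  have "real (p choose j) * fact (j + m) * fact (p - j + m)
      = fact p * (falling m (real (j + m)) * falling m (real (p - j + m)))"
    unfolding binomial_fact[OF assms] falling_fact[symmetric, of j] falling_fact[symmetric, of "p - j"]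
    by (simp add: field_simps)
  then show ?thesis
    unfolding wcoeff_def by simp
qed

text \<open>The coefficients of \<open>Wpoly\<close> are values of a polynomial of degree \<open>2 m\<close> which vanishes at the
  \<open>m\<close> integers on either side of the support, so taking \<open>m\<close> differences leaves a polynomial of
  degree \<open>m\<close>: the coefficients of \<open>Fpoly\<close> are discrete Chebyshev polynomials.\<close>

definition wext :: "nat \<Rightarrow> nat \<Rightarrow> nat \<Rightarrow> real" where
  "wext p m i = fact p / fact (p + 2 * m + 1) * (falling m (real i) * falling m (real (p + 2 * m) - real i))"

lemma fdiff_wext: "(fdiff ^^ Suc (2 * m)) (wext p m) = (\<lambda>_. 0)"
proof -
  \<comment> \<open>All 2 m linear factors in one product: the first m belong to the falling
    factorial at j, the others to the one at p + 2 m - j.\<close>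
  define \<alpha> where "\<alpha> i = (if i < m then - real i else real (p + 2 * m) - real (i - m))" for i
  define \<beta> where "\<beta> i = (if i < m then 1 else - 1 :: real)" for i
  have split: "{..<2*m} = {..<m} \<union> (\<lambda>r. r + m) ` {..<m}"
  proof (intro set_eqI iffI)
    fix x assume "x \<in> {..<2*m}"
    then show "x \<in> {..<m} \<union> (\<lambda>r. r + m) ` {..<m}"
      by (cases "x < m") (auto intro!: image_eqI[of _ _ "x - m"])
  qed auto
  have "(\<Prod>i<2*m. \<alpha> i + \<beta> i * real j) = falling m (real j) * falling m (real (p + 2 * m) - real j)" for j
  proof -
    have "(\<Prod>i<2*m. \<alpha> i + \<beta> i * real j)
        = (\<Prod>i<m. \<alpha> i + \<beta> i * real j) * (\<Prod>i\<in>(\<lambda>r. r + m) ` {..<m}. \<alpha> i + \<beta> i * real j)"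
      unfolding split by (rule prod.union_disjoint) auto
    also have "(\<Prod>i<m. \<alpha> i + \<beta> i * real j) = falling m (real j)"
      unfolding falling_def by (rule prod.cong) (auto simp: \<alpha>_def \<beta>_def)
    also have "(\<Prod>i\<in>(\<lambda>r. r + m) ` {..<m}. \<alpha> i + \<beta> i * real j) = falling m (real (p + 2 * m) - real j)"
      unfolding falling_def by (subst prod.reindex) (auto intro!: prod.cong simp: \<alpha>_def \<beta>_def)
    finally show ?thesis .
  qed
  then have "wext p m = (\<lambda>j. fact p / fact (p + 2 * m + 1) * (\<Prod>i<2*m. \<alpha> i + \<beta> i * real j))"
    by (simp add: wext_def fun_eq_iff)
  then show ?thesis
    using fdiff_pow_prod[of "{..<2*m}" \<alpha> \<beta>] by (simp only: fdiff_pow_scale card_lessThan finite_lessThan simp_thms mult_zero_right)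
qed

text \<open>The shift by m places the support at m, ..., p + m. Outside it \<open>wext\<close> still
  gives the right value 0, because one falling factorial vanishes below m and the other above p + m;
  differences can thus be taken across the boundary.\<close>

lemma coeff_shifted_Wpoly:
  assumes "i \<le> p + 2 * m"
  shows "coeff (monom 1 m * Wpoly p m) i = wext p m i"
proof -
  consider "i < m" | "m \<le> i" "i \<le> p + m" | "p + m < i" by linarith
  then show ?thesis
  proof cases
    case 1
    then show ?thesis
      by (simp add: coeff_monom_mult wext_def falling_zero)
  next
    case 2
    then have e: "real (p + 2 * m) - real i = real (p - (i - m) + m)" "i - m + m = i" "i - m \<le> p"
      by linarith+
    have "wext p m i = wcoeff p m (i - m)"
      unfolding wext_def wcoeff_falling[OF e(3)] e(1,2) ..
    then show ?thesis
      using 2 by (simp add: coeff_monom_mult coeff_Wpoly)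
  next
    case 3
    then have "real (p + 2 * m) - real i = real (p + 2 * m - i)" "p + 2 * m - i < m"
      using assms by linarith+
    then have "wext p m i = 0"
      unfolding wext_def by (simp only: falling_zero mult_zero_right)
    then show ?thesis
      using 3 by (simp add: coeff_monom_mult coeff_Wpoly)
  qed
qed

text \<open>Each factor X - 1 contributes one forward difference with a minus sign and moves the
  index by one.\<close>

lemma coeff_shifted_diff:
  assumes "i + r \<le> p + 2 * m"
  shows "coeff ([:-1, 1:] ^ r * (monom 1 m * Wpoly p m)) (i + r) = (- 1) ^ r * (fdiff ^^ r) (wext p m) i"
  using assms
proof (induction r arbitrary: i)
  case 0
  then show ?case by (simp add: coeff_shifted_Wpoly)
next
  case (Suc r)
  have "coeff ([:-1, 1:] ^ Suc r * (monom 1 m * Wpoly p m)) (i + Suc r)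
      = coeff ([:-1, 1:] ^ r * (monom 1 m * Wpoly p m)) (i + r)
      - coeff ([:-1, 1:] ^ r * (monom 1 m * Wpoly p m)) (Suc i + r)"
    using coeff_xm1_mult[of "[:-1, 1:] ^ r * (monom 1 m * Wpoly p m)" "i + Suc r"] by (simp only: power_Suc mult.assoc) simp
  also have "\<dots> = (- 1) ^ r * ((fdiff ^^ r) (wext p m) i - (fdiff ^^ r) (wext p m) (Suc i))"
    using Suc.IH[of i] Suc.IH[of "Suc i"] Suc.prems by (simp add: right_diff_distrib)
  also have "\<dots> = (- 1) ^ Suc r * (fdiff ^^ Suc r) (wext p m) i"
    by (simp add: fdiff_def[of "(fdiff ^^ r) (wext p m)"] algebra_simps)
  finally show ?case .
qed

lemma coeff_Fpoly:
  assumes "i \<le> m + p"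
  shows "coeff (Fpoly p m) i = (- 1) ^ m * (fdiff ^^ m) (wext p m) i"
proof -
  have "coeff (Fpoly p m) i = coeff (monom 1 m * Fpoly p m) (i + m)"
    by (simp add: coeff_monom_mult)
  also have "monom 1 m * Fpoly p m = [:-1, 1:] ^ m * (monom 1 m * Wpoly p m)"
    by (simp add: Fpoly_def mult_ac)
  finally show ?thesis
    using coeff_shifted_diff[of i m p m] assms by simp
qed

text \<open>The coefficients of \<open>Fpoly p m\<close> are m-th differences of a polynomial of
  degree at most 2 m, so m + 1 further differences annihilate them. The other polynomial contains (X
  - 1)^m' with m' > m, and summation by parts moves these differences over.\<close>

lemma Fpoly_orthogonal:
  assumes "m < m'" "m + p = m' + p'"
  shows "(\<Sum>i\<le>m + p. coeff (Fpoly p m) i * coeff (Fpoly p' m') i) = 0"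
proof -
  have "(fdiff ^^ Suc m) ((fdiff ^^ m) (wext p m)) = (\<lambda>_. 0)"
  proof -
    have "Suc (2 * m) = Suc m + m" by simp
    then show ?thesis
      using fdiff_wext[of m p] by (simp only: funpow_add comp_apply)
  qed
  then have z: "(fdiff ^^ m') ((fdiff ^^ m) (wext p m)) = (\<lambda>_. 0)"
    by (rule fdiff_pow_add_exp) (use assms in simp)
  have "(\<Sum>i\<le>m + p. coeff (Fpoly p m) i * coeff (Fpoly p' m') i)
      = (\<Sum>i\<le>m + p. (- 1) ^ m * ((fdiff ^^ m) (wext p m) i * coeff (Fpoly p' m') i))"
    by (rule sum.cong) (simp_all add: coeff_Fpoly)
  also have "\<dots> = (- 1) ^ m * (\<Sum>i\<le>m + p. (fdiff ^^ m) (wext p m) i * coeff (Fpoly p' m') i)"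
    by (simp add: sum_distrib_left)
  also have "\<dots> = 0"
    unfolding Fpoly_def using sum_coeff_fdiff_zero[OF z Wpoly_nonzero[of p' m'], of "m + p"] assms
    by (simp add: degree_Wpoly)
  finally show ?thesis .
qed

text \<open>Homogenises \<open>Fpoly\<close> in zp and zm. The indices are nonnegative with sum m +
  p, so transforms with different m + p have disjoint index sets.\<close>

lemma Ipq_ebasis:
  "Ipq p (Suc m) y = (\<Sum>i\<le>m + p. complex_of_real (coeff (Fpoly p m) i) * ebasis (int i) (int (m + p) - int i) y)"
proof -
  have map_poly_of_real: "poly (map_poly complex_of_real ([:-1, 1:] * G)) x = (x - 1) * poly (map_poly complex_of_real G) x"
    for G :: "real poly" and x
  proof -
    have "map_poly complex_of_real ([:-1, 1:] * G) = [:-1, 1:] * map_poly complex_of_real G"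
      by (rule poly_eqI) (simp add: coeff_map_poly coeff_pCons split: nat.split)
    then show ?thesis
      by (simp only: poly_mult) (simp add: algebra_simps)
  qed
  have xm1: "poly (map_poly complex_of_real ([:-1, 1:] ^ r * G)) x = (x - 1) ^ r * poly (map_poly complex_of_real G) x"
    for G :: "real poly" and x r
    by (induction r) (simp_all only: power_Suc power_0 mult_1 mult.assoc map_poly_of_real)
  have ev: "(\<Sum>j\<le>n. complex_of_real (coeff G j) * z ^ j * w ^ (n - j)) = w ^ n * poly (map_poly complex_of_real G) (z / w)"
    if "degree G \<le> n" "w \<noteq> 0" for G n z w
  proof -
    have "poly (map_poly complex_of_real G) (z / w) = (\<Sum>j\<le>n. complex_of_real (coeff G j) * (z / w) ^ j)"
    proof -
      have "degree (map_poly complex_of_real G) \<le> n"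
        by (rule degree_le) (use that(1) in \<open>simp add: coeff_map_poly coeff_eq_0\<close>)
      then have "(\<Sum>j\<le>degree (map_poly complex_of_real G). coeff (map_poly complex_of_real G) j * (z / w) ^ j)
          = (\<Sum>j\<le>n. coeff (map_poly complex_of_real G) j * (z / w) ^ j)"
        by (intro sum.mono_neutral_left) (auto simp: coeff_eq_0)
      then show ?thesis
        unfolding poly_altdef by (simp add: coeff_map_poly)
    qed
    then have "w ^ n * poly (map_poly complex_of_real G) (z / w)
        = (\<Sum>j\<le>n. w ^ n * (complex_of_real (coeff G j) * (z / w) ^ j))"
      by (simp only: sum_distrib_left)
    also have "\<dots> = (\<Sum>j\<le>n. complex_of_real (coeff G j) * z ^ j * w ^ (n - j))"
      by (rule sum.cong) (use \<open>w \<noteq> 0\<close> in \<open>simp_all add: power_diff power_divide\<close>)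
    finally show ?thesis by simp
  qed
  have "Ipq p (Suc m) y = chord y ^ Suc m * (zm y ^ p * poly (map_poly complex_of_real (Wpoly p m)) (zp y / zm y))"
    unfolding Ipq_ends ev[of "Wpoly p m" p "zm y" "zp y", symmetric, OF eq_refl[OF degree_Wpoly] zm_nonzero]
    by (simp add: coeff_Wpoly)
  also have "chord y ^ Suc m = chord y * (zm y ^ m * (zp y / zm y - 1) ^ m)"
  proof -
    have "zm y * (zp y / zm y - 1) = chord y"
      by (simp add: chord_def right_diff_distrib)
    then show ?thesis
      by (metis power_Suc power_mult_distrib)
  qed
  finally have "Ipq p (Suc m) y = chord y * (zm y ^ (m + p) * poly (map_poly complex_of_real (Fpoly p m)) (zp y / zm y))"
    unfolding Fpoly_def xm1 by (simp add: power_add mult_ac)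
  also have "\<dots> = chord y * (\<Sum>j\<le>m + p. complex_of_real (coeff (Fpoly p m) j) * zp y ^ j * zm y ^ (m + p - j))"
    by (subst ev) (simp_all add: degree_Fpoly)
  also have "\<dots> = (\<Sum>i\<le>m + p. complex_of_real (coeff (Fpoly p m) i) * ebasis (int i) (int (m + p) - int i) y)"
    unfolding sum_distrib_left
  proof (rule sum.cong)
    fix i assume "i \<in> {..m + p}"
    then have "int (m + p) - int i = int (m + p - i)" by simp
    then show "chord y * (complex_of_real (coeff (Fpoly p m) i) * zp y ^ i * zm y ^ (m + p - i))
        = complex_of_real (coeff (Fpoly p m) i) * ebasis (int i) (int (m + p) - int i) y"
      unfolding ebasis_def by (simp only: power_int_of_nat mult_ac)
  qed simp
  finally show ?thesis .
qed

lemma Ipq_ebasis_fun: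
  "Ipq p (Suc m) = (\<lambda>y. \<Sum>i\<le>m + p. complex_of_real (coeff (Fpoly p m) i) * ebasis (int i) (int (m + p) - int i) y)"
  by (rule ext) (rule Ipq_ebasis)

lemma L2_Ipq: "Ipq p (Suc m) \<in> L2_GH"
  unfolding Ipq_ebasis_fun by (intro L2_sum L2_scale L2_ebasis)

lemma inner_Ipq_ebasis:
  "inner_GH (Ipq p (Suc m)) (ebasis j k)
    = (if j \<ge> 0 \<and> k \<ge> 0 \<and> j + k = int (m + p) then complex_of_real (coeff (Fpoly p m) (nat j) * (8 * pi\<^sup>2)) else 0)"
proof -
  have "inner_GH (Ipq p (Suc m)) (ebasis j k)
      = (\<Sum>i\<le>m + p. complex_of_real (coeff (Fpoly p m) i) * inner_GH (ebasis (int i) (int (m + p) - int i)) (ebasis j k))"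
    unfolding Ipq_ebasis_fun by (subst inner_GH_sum) (simp_all only: L2_scale L2_ebasis inner_GH_scale)
  also have "\<dots> = (\<Sum>i\<le>m + p. if i = nat j then (if j \<ge> 0 \<and> k \<ge> 0 \<and> j + k = int (m + p)
      then complex_of_real (coeff (Fpoly p m) (nat j) * (8 * pi\<^sup>2)) else 0) else 0)"
  proof (rule sum.cong)
    fix i assume "i \<in> {..m + p}"
    then have "int i = j \<and> int (m + p) - int i = k \<longleftrightarrow> i = nat j \<and> j \<ge> 0 \<and> k \<ge> 0 \<and> j + k = int (m + p)"
      by auto
    then show "complex_of_real (coeff (Fpoly p m) i) * inner_GH (ebasis (int i) (int (m + p) - int i)) (ebasis j k)
        = (if i = nat j then (if j \<ge> 0 \<and> k \<ge> 0 \<and> j + k = int (m + p)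
          then complex_of_real (coeff (Fpoly p m) (nat j) * (8 * pi\<^sup>2)) else 0) else 0)"
      unfolding inner_ebasis by auto
  qed simp
  also have "\<dots> = (if j \<ge> 0 \<and> k \<ge> 0 \<and> j + k = int (m + p) then complex_of_real (coeff (Fpoly p m) (nat j) * (8 * pi\<^sup>2)) else 0)"
    by (subst sum.delta) auto
  finally show ?thesis .
qed

lemma inner_Ipq_Ipq:
  "inner_GH (Ipq p (Suc m)) (Ipq p' (Suc m')) = (if m + p = m' + p'
    then complex_of_real (8 * pi\<^sup>2 * (\<Sum>i\<le>m + p. coeff (Fpoly p m) i * coeff (Fpoly p' m') i)) else 0)"
proof -
  have "inner_GH (Ipq p (Suc m)) (Ipq p' (Suc m'))
      = (\<Sum>i\<le>m + p. complex_of_real (coeff (Fpoly p m) i) * inner_GH (ebasis (int i) (int (m + p) - int i)) (Ipq p' (Suc m')))"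
    by (subst (1) Ipq_ebasis_fun, subst inner_GH_sum) (simp_all only: L2_scale L2_ebasis inner_GH_scale L2_Ipq)
  also have "\<dots> = (\<Sum>i\<le>m + p. if m + p = m' + p' then complex_of_real (8 * pi\<^sup>2 * (coeff (Fpoly p m) i * coeff (Fpoly p' m') i)) else 0)"
  proof (rule sum.cong)
    fix i assume i: "i \<in> {..m + p}"
    have "inner_GH (ebasis (int i) (int (m + p) - int i)) (Ipq p' (Suc m'))
        = (if m + p = m' + p' then complex_of_real (coeff (Fpoly p' m') i * (8 * pi\<^sup>2)) else 0)"
      unfolding inner_GH_commute[of "ebasis _ _"] inner_Ipq_ebasis using i by auto
    then show "complex_of_real (coeff (Fpoly p m) i) * inner_GH (ebasis (int i) (int (m + p) - int i)) (Ipq p' (Suc m'))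
        = (if m + p = m' + p' then complex_of_real (8 * pi\<^sup>2 * (coeff (Fpoly p m) i * coeff (Fpoly p' m') i)) else 0)"
      by (simp add: mult_ac)
  qed simp
  also have "\<dots> = (if m + p = m' + p' then complex_of_real (8 * pi\<^sup>2 * (\<Sum>i\<le>m + p. coeff (Fpoly p m) i * coeff (Fpoly p' m') i)) else 0)"
    by (simp add: sum_distrib_left)
  finally show ?thesis .
qed

text \<open>The coefficients of \<open>Fpoly\<close> are real and the leading one is not zero, so
  the sum of their squares is positive. This is what makes the normalisation meaningful.\<close>

lemma nsq_Ipq: "nsq (Ipq p (Suc m)) > 0"
proof -
  have "complex_of_real (nsq (Ipq p (Suc m))) = complex_of_real (8 * pi\<^sup>2 * (\<Sum>i\<le>m + p. coeff (Fpoly p m) i * coeff (Fpoly p m) i))"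
    unfolding inner_GH_self[symmetric] inner_Ipq_Ipq by simp
  then have "nsq (Ipq p (Suc m)) = 8 * pi\<^sup>2 * (\<Sum>i\<le>m + p. coeff (Fpoly p m) i * coeff (Fpoly p m) i)"
    by (simp only: of_real_eq_iff)
  moreover have "(\<Sum>i\<le>m + p. coeff (Fpoly p m) i * coeff (Fpoly p m) i) \<ge> coeff (Fpoly p m) (m + p) * coeff (Fpoly p m) (m + p)"
    by (rule member_le_sum) auto
  moreover have "coeff (Fpoly p m) (m + p) \<noteq> 0"
    using Fpoly_nonzero[of p m] leading_coeff_neq_0 degree_Fpoly[of p m] by metis
  then have "coeff (Fpoly p m) (m + p) * coeff (Fpoly p m) (m + p) > 0"
    using not_real_square_gt_zero by blast
  ultimately show ?thesis
    by simp
qed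

lemma Ipq_orthogonal:
  assumes "(p, m) \<noteq> (p', m')"
  shows "inner_GH (Ipq p (Suc m)) (Ipq p' (Suc m')) = 0"
proof (cases "m + p = m' + p'")
  case True
  with assms consider "m < m'" | "m' < m" by fastforce
  then show ?thesis
  proof cases
    case 1
    show ?thesis
      unfolding inner_Ipq_Ipq Fpoly_orthogonal[OF 1 True] by simp
  next
    case 2
    have "(\<Sum>i\<le>m + p. coeff (Fpoly p m) i * coeff (Fpoly p' m') i) = 0"
      using Fpoly_orthogonal[OF 2 True[symmetric]] unfolding True[symmetric] by (simp add: mult.commute)
    from this show ?thesis
      unfolding inner_Ipq_Ipq by (simp only: mult_zero_right of_real_0 if_cancel)
  qed
qed (simp add: inner_Ipq_Ipq)

lemma Ipq_hat_scale: "Ipq_hat p q = (\<lambda>y. (1 / complex_of_real (norm_GH (Ipq p q))) * Ipq p q y)"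
  by (simp add: Ipq_hat_def fun_eq_iff)

lemma orthonormal_Ipq_hat: "orthonormal_family index_set (\<lambda>(p, q). Ipq_hat p (2 * q))"
proof -
  have L: "Ipq_hat p (Suc m) \<in> L2_GH" for p m
    unfolding Ipq_hat_scale by (rule L2_scale[OF L2_Ipq])
  have inner: "inner_GH (Ipq_hat p (Suc m)) (Ipq_hat p' (Suc m')) = (if (p, m) = (p', m') then 1 else 0)" for p m p' m'
  proof -
    have "inner_GH (Ipq_hat p (Suc m)) (Ipq_hat p' (Suc m'))
        = 1 / complex_of_real (norm_GH (Ipq p (Suc m))) * (1 / complex_of_real (norm_GH (Ipq p' (Suc m'))) * inner_GH (Ipq p (Suc m)) (Ipq p' (Suc m')))"
      unfolding Ipq_hat_scale inner_GH_scale
      by (subst inner_GH_commute) (simp add: inner_GH_scale inner_GH_commute[of "Ipq p' (Suc m')" "Ipq p (Suc m)"] del: times_divide_eq_left)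
    also have "\<dots> = (if (p, m) = (p', m') then 1 else 0)"
    proof (cases "(p, m) = (p', m')")
      case True
      have "complex_of_real (norm_GH (Ipq p (Suc m))) * complex_of_real (norm_GH (Ipq p (Suc m))) = complex_of_real (nsq (Ipq p (Suc m)))"
        by (simp flip: of_real_mult norm_GH_sq power2_eq_square)
      then show ?thesis
        using True nsq_Ipq[of p m] by (simp add: inner_GH_self)
    next
      case False
      then show ?thesis by (simp add: Ipq_orthogonal del: prod.inject)
    qed
    finally show ?thesis .
  qed
  \<comment> \<open>The finite difference lemmas are indexed by the tensor degree minus one, so the
    degree 2 q appears as \<open>Suc m\<close> with m = 2 q - 1.\<close>
  have ix: "\<exists>m. 2 * q = Suc m" if "q \<ge> 1" for q :: nat
    using that by (intro exI[of _ "2 * q - 1"]) simp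
  show ?thesis
    unfolding orthonormal_family_def
  proof (intro conjI ballI)
    fix i assume "i \<in> index_set"
    then obtain p q where i: "i = (p, q)" "q \<ge> 1" by (auto simp: index_set_def)
    with ix L show "(case i of (p, q) \<Rightarrow> Ipq_hat p (2 * q)) \<in> L2_GH" by fastforce
  next
    fix i j assume "i \<in> index_set" "j \<in> index_set"
    then obtain p q p' q' where i: "i = (p, q)" "q \<ge> 1" and j: "j = (p', q')" "q' \<ge> 1"
      by (auto simp: index_set_def)
    obtain m m' where m: "2 * q = Suc m" "2 * q' = Suc m'"
      using ix i(2) j(2) by metis
    have "(p, m) = (p', m') \<longleftrightarrow> i = j"
      using m i j by auto
    then show "inner_GH (case i of (p, q) \<Rightarrow> Ipq_hat p (2 * q)) (case j of (p, q) \<Rightarrow> Ipq_hat p (2 * q)) = (if i = j then 1 else 0)"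
      using inner[of p m p' m'] unfolding i(1) j(1) by (simp add: m del: prod.inject)
  qed
qed

lemma orthonormal_cnj:
  assumes "orthonormal_family J F"
  shows "orthonormal_family J (\<lambda>i y. cnj (F i y))"
  using assms unfolding orthonormal_family_def by (auto simp: L2_cnj inner_GH_cnj)

subsection \<open>Spans of the transforms of tensors\<close>

abbreviation (input) Ipq_family :: "nat \<times> nat \<Rightarrow> real \<times> real \<Rightarrow> complex" where
  "Ipq_family \<equiv> \<lambda>(p, q). Ipq_hat p (2 * q)"

abbreviation (input) both_nonneg :: "(int \<times> int) set" where
  "both_nonneg \<equiv> {(j, k). 0 \<le> j \<and> 0 \<le> k}"

abbreviation (input) both_neg :: "(int \<times> int) set" where
  "both_neg \<equiv> {(j, k). j < 0 \<and> k < 0}"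

text \<open>\<open>SA\<close> changes the sign of \<open>chord\<close> and fixes zp + zm. For m odd
  only even powers of \<open>chord\<close> occur in the midpoint expansion, so the transform is
  even; nonnegativity of the indices is read off from \<open>inner_Ipq_ebasis\<close>.\<close>

lemma Ipq_hat_spectral:
  assumes "i \<in> index_set"
  shows "Ipq_family i \<in> spectral both_nonneg"
proof -
  obtain p q where i: "i = (p, q)" "q \<ge> 1"
    using assms by (auto simp: index_set_def)
  obtain m where m: "2 * q = Suc m" "odd m"
    using i(2) by (metis Suc_pred' even_Suc even_mult_iff even_numeral mult_pos_pos zero_less_numeral less_le_trans zero_less_one)
  obtain c where c: "\<And>i. odd i \<Longrightarrow> c i = 0"
      "\<And>y. Ipq p (Suc m) y = (\<Sum>i\<le>p. c i * (chord y ^ (Suc m + i) * (zp y + zm y) ^ (p - i)))"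
    using Ipq_chord_powers[of p m] by blast
  have "Ipq p (Suc m) (SA y) = Ipq p (Suc m) y" for y
    unfolding c(2)
  proof (rule sum.cong)
    fix i
    have SA: "chord (SA y) = - chord y" "zp (SA y) + zm (SA y) = zp y + zm y"
      by (simp_all add: chord_def zm_SA zp_SA add.commute)
    show "c i * (chord (SA y) ^ (Suc m + i) * (zp (SA y) + zm (SA y)) ^ (p - i))
        = c i * (chord y ^ (Suc m + i) * (zp y + zm y) ^ (p - i))"
    proof (cases "even i")
      case True
      then have "even (Suc m + i)"
        using m(2) by simp
      then show ?thesis
        unfolding SA by (simp only: power_minus_even)
    next
      case False
      then show ?thesis by (simp add: c(1))
    qed
  qed simp
  then have "Ipq p (Suc m) \<in> L2_plus"
    by (simp add: L2_plus_def L2_Ipq)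
  then have even: "Ipq p (Suc m) \<in> spectral UNIV"
    by (simp only: L2_plus_eq_spectral)
  have "Ipq p (Suc m) \<in> spectral both_nonneg"
  proof (rule spectralI[OF L2_Ipq spectral_anti[OF even]])
    fix j k :: int assume "(j, k) \<notin> both_nonneg"
    then have "\<not> (0 \<le> j \<and> 0 \<le> k \<and> j + k = int (m + p))" by blast
    then show "inner_GH (Ipq p (Suc m)) (ebasis j k) = 0"
      unfolding inner_Ipq_ebasis by (rule if_not_P)
  qed
  then show ?thesis
    unfolding i(1) prod.case m(1) Ipq_hat_scale by (rule subspace_fun_scale[OF subspace_spectral])
qed

text \<open>Inverts the triangular system of \<open>Ipq_chord_powers\<close> by strong induction on
  p: besides the leading term only even i > 0 occur, which lower the power of zp + zm and raise that
  of \<open>chord\<close> by an even amount.\<close>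

lemma chord_powers_in_span:
  assumes "q \<ge> 1"
  shows "(\<lambda>y. chord y ^ (2 * q) * (zp y + zm y) ^ p) \<in> lin_span index_set Ipq_family"
  using assms
proof (induction p arbitrary: q rule: less_induct)
  case (less p)
  let ?L = "lin_span index_set Ipq_family"
  obtain m where m: "2 * q = Suc m"
    using less.prems by (cases "2 * q") auto
  obtain c where c: "c 0 \<noteq> 0" "\<And>i. odd i \<Longrightarrow> c i = 0"
      "\<And>y. Ipq p (Suc m) y = (\<Sum>i\<le>p. c i * (chord y ^ (Suc m + i) * (zp y + zm y) ^ (p - i)))"
    using Ipq_chord_powers[of p m] by blast
  have I: "Ipq p (Suc m) \<in> ?L"
  proof -
    have "Ipq_hat p (2 * q) \<in> ?L"
      using lin_span_base[of "(p, q)" index_set Ipq_family] less.prems by (simp add: index_set_def)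
    from subspace_fun_scale[OF lin_span_subspace this, of "complex_of_real (norm_GH (Ipq p (2 * q)))"]
    show ?thesis
      using nsq_Ipq[of p m] unfolding Ipq_hat_def m by (simp add: norm_GH_nsq less_imp_neq[symmetric])
  qed
  have rest: "(\<lambda>y. \<Sum>i\<in>{1..p}. c i * (chord y ^ (Suc m + i) * (zp y + zm y) ^ (p - i))) \<in> ?L"
  proof (rule subspace_fun_sum[OF lin_span_subspace], rule subspace_fun_scale_if[OF lin_span_subspace])
    fix i assume i: "i \<in> {1..p}" and "c i \<noteq> 0"
    then have "even i" using c(2) by blast
    then obtain l where l: "i = 2 * l" by blast
    have "(\<lambda>y. chord y ^ (2 * (q + l)) * (zp y + zm y) ^ (p - i)) \<in> ?L"
      by (rule less.IH) (use i less.prems in auto)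
    moreover have "2 * (q + l) = Suc m + i"
      using m l by simp
    ultimately show "(\<lambda>y. chord y ^ (Suc m + i) * (zp y + zm y) ^ (p - i)) \<in> ?L"
      by (simp only:)
  qed
  have "chord y ^ (2 * q) * (zp y + zm y) ^ p
      = (1 / c 0) * (Ipq p (Suc m) y - (\<Sum>i\<in>{1..p}. c i * (chord y ^ (Suc m + i) * (zp y + zm y) ^ (p - i))))" for y
  proof -
    have "{..p} = insert 0 {1..p}" by auto
    then have "Ipq p (Suc m) y = c 0 * (chord y ^ (Suc m + 0) * (zp y + zm y) ^ (p - 0))
        + (\<Sum>i\<in>{1..p}. c i * (chord y ^ (Suc m + i) * (zp y + zm y) ^ (p - i)))"
      unfolding c(3) by simp
    then show ?thesis
      using c(1) by (simp add: m)
  qed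
  then show ?case
    using subspace_fun_scale[OF lin_span_subspace subspace_fun_diff[OF lin_span_subspace I rest], of "1 / c 0"]
    by simp
qed

lemma lin_span_closed_mult:
  assumes "f \<in> lin_span J F" "\<And>i. i \<in> J \<Longrightarrow> (\<lambda>y. g y * F i y) \<in> lin_span J F"
  shows "(\<lambda>y. g y * f y) \<in> lin_span J F"
proof -
  define S where "S = {f. (\<lambda>y. g y * f y) \<in> lin_span J F}"
  note sub = lin_span_subspace[of J F]
  have "subspace_fun S"
    unfolding subspace_fun_def
  proof (intro conjI ballI allI)
    show "(\<lambda>y. 0) \<in> S"
      using sub by (simp add: S_def subspace_fun_def)
  next
    fix u v assume "u \<in> S" "v \<in> S"
    then show "(\<lambda>y. u y + v y) \<in> S"
      using subspace_fun_add[OF sub] by (simp add: S_def distrib_left)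
  next
    fix c u assume "u \<in> S"
    then show "(\<lambda>y. c * u y) \<in> S"
      using subspace_fun_scale[OF sub, of _ c] by (simp add: S_def mult.left_commute)
  qed
  then have "lin_span J F \<subseteq> S"
    by (rule lin_span_minimal) (use assms(2) in \<open>simp add: S_def\<close>)
  with assms(1) show ?thesis
    by (auto simp: S_def)
qed

text \<open>An antisymmetric polynomial in zp, zm is \<open>chord\<close> times a symmetric one, and
  symmetric polynomials are generated by zp + zm and zp zm. Hence the key is that the span of the
  functions \<open>G\<close> is stable under multiplication by these two.\<close>

lemma ebasis_even_in_span:
  assumes "(j, k) \<in> both_nonneg"
  shows "ebasis_even j k \<in> lin_span index_set Ipq_family"
proof -
  let ?L = "lin_span index_set Ipq_family"
  define G where "G i = (\<lambda>y. chord y ^ (2 * snd i) * (zp y + zm y) ^ fst i)" for i :: "nat \<times> nat"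
  let ?V = "lin_span index_set G"
  have VL: "?V \<subseteq> ?L"
  proof (rule lin_span_minimal[OF lin_span_subspace])
    fix i assume "i \<in> index_set"
    then show "G i \<in> ?L"
      unfolding G_def by (intro chord_powers_in_span) (auto simp: index_set_def)
  qed
  note sub = lin_span_subspace[of index_set G]
  have GV: "(\<lambda>y. chord y ^ (2 * q) * (zp y + zm y) ^ p) \<in> ?V" if "q \<ge> 1" for p q
    using lin_span_base[of "(p, q)" index_set G] that by (simp add: G_def index_set_def)
  have mult_sum: "(\<lambda>y. (zp y + zm y) * f y) \<in> ?V" if "f \<in> ?V" for f
  proof (rule lin_span_closed_mult[OF that])
    fix i assume "i \<in> index_set"
    then show "(\<lambda>y. (zp y + zm y) * G i y) \<in> ?V"
      using GV[of "snd i" "Suc (fst i)"] by (auto simp: G_def index_set_def mult.left_commute)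
  qed
  have mult_chord: "(\<lambda>y. (chord y)\<^sup>2 * f y) \<in> ?V" if "f \<in> ?V" for f
  proof (rule lin_span_closed_mult[OF that])
    fix i assume "i \<in> index_set"
    then show "(\<lambda>y. (chord y)\<^sup>2 * G i y) \<in> ?V"
      using GV[of "Suc (snd i)" "fst i"] by (auto simp: G_def index_set_def power2_eq_square mult.assoc)
  qed
  have mult_prod: "(\<lambda>y. (zp y * zm y) * f y) \<in> ?V" if "f \<in> ?V" for f
  proof -
    \<comment> \<open>From 4 zp zm = (zp + zm)^2 - chord^2.\<close>
    have "(zp y * zm y) * f y = (1/4) * ((zp y + zm y) * ((zp y + zm y) * f y) - (chord y)\<^sup>2 * f y)" for y
      by (simp add: chord_def power2_eq_square field_simps)
    then show ?thesis
      using subspace_fun_scale[OF sub subspace_fun_diff[OF sub mult_sum[OF mult_sum[OF that]] mult_chord[OF that]], of "1/4"]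
      by (simp only:)
  qed
  define A where "A j k = (\<lambda>y. chord y * (zp y ^ j * zm y ^ k - zp y ^ k * zm y ^ j))" for j k :: nat
  have zero: "(\<lambda>y. 0) \<in> ?V"
    using sub by (simp add: subspace_fun_def)
  have A0: "A n 0 \<in> ?V" for n
  proof (induction n rule: less_induct)
    case (less n)
    consider "n = 0" | "n = 1" | l where "n = Suc (Suc l)"
      by (metis One_nat_def not0_implies_Suc)
    then show ?case
    proof cases
      case 1
      then show ?thesis using zero by (simp add: A_def)
    next
      case 2
      then have "A n 0 = (\<lambda>y. chord y ^ (2 * 1) * (zp y + zm y) ^ 0)"
        by (simp add: A_def chord_def power2_eq_square fun_eq_iff)
      then show ?thesis using GV[of 1 0] by simp
    next
      case 3
      \<comment> \<open>Three-term recurrence for zp^n - zm^n, with the two symmetric generators as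
        coefficients.\<close>
      have "A n 0 = (\<lambda>y. (zp y + zm y) * A (Suc l) 0 y - (zp y * zm y) * A l 0 y)"
        unfolding 3 A_def by (simp add: fun_eq_iff algebra_simps)
      also have "\<dots> \<in> ?V"
        using less.IH[of "Suc l"] less.IH[of l] 3
        by (intro subspace_fun_diff[OF sub] mult_sum mult_prod) auto
      finally show ?thesis .
    qed
  qed
  have shift: "A (n + k) k \<in> ?V" for n k
  proof (induction k)
    case (Suc k)
    have "A (n + Suc k) (Suc k) = (\<lambda>y. (zp y * zm y) * A (n + k) k y)"
      by (simp add: A_def fun_eq_iff algebra_simps)
    then show ?case
      using mult_prod[OF Suc.IH] by simp
  qed (use A0 in simp)
  have AV: "A j k \<in> ?V" for j k
  proof (cases "k \<le> j")
    case True
    then show ?thesis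
      using shift[of "j - k" k] by simp
  next
    case False
    have "A j k = (\<lambda>y. (- 1) * A k j y)"
      by (simp add: A_def fun_eq_iff algebra_simps)
    then show ?thesis
      using subspace_fun_scale[OF sub shift[of "k - j" j], of "- 1"] False by simp
  qed
  have "ebasis_even j k = A (nat j) (nat k)"
  proof -
    have "j = int (nat j)" "k = int (nat k)"
      using assms by auto
    then obtain j' k' where "j = int j'" "k = int k'" by blast
    then show ?thesis
      by (simp add: ebasis_even_def ebasis_def A_def fun_eq_iff algebra_simps)
  qed
  then show ?thesis
    using AV VL by auto
qed

lemma closed_span_Ipq: "closed_span index_set Ipq_family = spectral both_nonneg"
  by (rule closed_span_eq_spectral[OF _ ebasis_even_in_span Ipq_hat_spectral]) auto

lemma closed_span_Ipq_cnj:
  "closed_span index_set (\<lambda>(p, q) y. cnj (Ipq_hat p (2 * q) y)) = spectral both_neg"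
proof -
  have eq: "(\<lambda>(p, q) y. cnj (Ipq_hat p (2 * q) y)) = (\<lambda>i y. cnj (Ipq_family i y))"
    by (simp add: fun_eq_iff)
  show ?thesis
    unfolding eq
  proof (rule closed_span_eq_spectral)
    fix j k assume jk: "(j, k) \<in> both_neg"
    have "ebasis_even (- k - 1) (- j - 1) \<in> lin_span index_set Ipq_family"
      by (rule ebasis_even_in_span) (use jk in auto)
    from lin_span_cnj[OF this] show "ebasis_even j k \<in> lin_span index_set (\<lambda>i y. cnj (Ipq_family i y))"
      by (simp add: cnj_ebasis_even)
  next
    fix i assume "i \<in> index_set"
    from spectral_cnj[OF Ipq_hat_spectral[OF this]]
    show "(\<lambda>y. cnj (Ipq_family i y)) \<in> spectral both_neg"
      by (rule spectral_mono) auto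
  qed auto
qed

subsection \<open>The Klein model\<close>

definition klein :: "complex \<Rightarrow> complex" where
  "klein z = 2 * z / of_real (1 + (cmod z)\<^sup>2)"

text \<open>Inverse of \<open>klein\<close> on the disk, where the square root is the boundary
  defining function of the preimage.\<close>

definition unklein :: "complex \<Rightarrow> complex" where
  "unklein w = w / of_real (1 + sqrt (1 - (cmod w)\<^sup>2))"

lemma one_plus_sq_pos: "1 + (cmod z)\<^sup>2 > 0"
  by (simp add: add_pos_nonneg)

lemma norm_klein: "cmod (klein z) = 2 * cmod z / (1 + (cmod z)\<^sup>2)"
  using one_plus_sq_pos[of z] by (simp add: klein_def norm_divide norm_mult del: of_real_add)

lemma norm_klein_le: "cmod (klein z) \<le> 1"
proof -
  have "0 \<le> (1 - cmod z)\<^sup>2" by simp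
  then have "2 * cmod z \<le> 1 + (cmod z)\<^sup>2"
    by (simp add: power2_diff)
  then show ?thesis
    unfolding norm_klein using one_plus_sq_pos[of z] by (simp add: divide_le_eq_1)
qed

lemma norm_klein_powers_le: "cmod (klein z ^ m * cnj (klein z) ^ n) \<le> 1"
proof -
  have "cmod (klein z) ^ m * cmod (klein z) ^ n \<le> 1 * 1"
    using norm_klein_le[of z] by (intro mult_mono) (simp_all add: power_le_one)
  then show ?thesis
    by (simp add: norm_mult norm_power)
qed

lemma bdf_sq_klein: "(bdf z)\<^sup>2 = 1 - (cmod (klein z))\<^sup>2"
  unfolding bdf_def norm_klein using one_plus_sq_pos[of z]
  by (simp add: power_divide divide_eq_eq diff_divide_eq_iff) (simp add: power2_eq_square algebra_simps)

lemma bdf_pos: "z \<in> disk \<Longrightarrow> bdf z > 0"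
  using one_plus_sq_pos[of z] power_strict_mono[of "cmod z" 1 2]
  by (simp add: bdf_def disk_def dist_norm)

lemma unklein_klein:
  assumes "z \<in> disk"
  shows "unklein (klein z) = z"
proof -
  have "sqrt (1 - (cmod (klein z))\<^sup>2) = bdf z"
    unfolding bdf_sq_klein[symmetric] using bdf_pos[OF assms] by simp
  moreover have "1 + bdf z = 2 / (1 + (cmod z)\<^sup>2)"
    unfolding bdf_def using one_plus_sq_pos[of z] by (simp add: field_simps)
  ultimately have "unklein (klein z) = klein z / complex_of_real (2 / (1 + (cmod z)\<^sup>2))"
    unfolding unklein_def by simp
  moreover have "complex_of_real (1 + (cmod z)\<^sup>2) \<noteq> 0"
    using one_plus_sq_pos[of z] by (simp only: of_real_eq_0_iff)
  ultimately show ?thesis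
    unfolding klein_def of_real_divide by simp
qed

lemma klein_measurable [measurable]: "klein \<in> borel_measurable borel"
  and unklein_measurable [measurable]: "unklein \<in> borel_measurable borel"
  and bdf_measurable [measurable]: "bdf \<in> borel_measurable borel"
  unfolding klein_def[abs_def] unklein_def[abs_def] bdf_def[abs_def] by measurable

text \<open>The real affine parameter of the Klein image along its chord, as
  \<open>klein_geod\<close> shows. It is again logistic, with the time doubled and shifted by ln (1
  + a^2), so the path integrals for \<open>sigma_path 0\<close> apply.\<close>

definition chord_param :: "real \<Rightarrow> real \<Rightarrow> real" where
  "chord_param a t = (1 + a\<^sup>2) * (exp t)\<^sup>2 / (1 + (1 + a\<^sup>2) * (exp t)\<^sup>2)"

lemma chord_param_den: "1 + (1 + a\<^sup>2) * (exp t)\<^sup>2 > (0::real)"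
  by (intro add_pos_nonneg) auto

lemma norm_geod_sq:
  "(cmod (geod b a t))\<^sup>2 = ((1 - exp t)\<^sup>2 + a\<^sup>2 * (exp t)\<^sup>2) / ((1 + exp t)\<^sup>2 + a\<^sup>2 * (exp t)\<^sup>2)"
proof -
  have "(cmod (1 - (1 + \<i> * of_real a) * complex_of_real (exp t)))\<^sup>2 = (1 - exp t)\<^sup>2 + a\<^sup>2 * (exp t)\<^sup>2"
    by (simp add: cmod_power2 power_mult_distrib)
  then show ?thesis
    unfolding geod_eq by (simp only: norm_mult norm_cis mult_1 norm_divide power_divide norm_path_den)
qed

lemma geod_den_pos: "(1 + exp t)\<^sup>2 + a\<^sup>2 * (exp t)\<^sup>2 > (0::real)"
proof -
  have "(1 + exp t)\<^sup>2 > (0::real)"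
    using exp_gt_zero[of t] by (intro zero_less_power) linarith
  then show ?thesis
    by (intro add_pos_nonneg) auto
qed

lemma one_plus_norm_geod:
  "1 + (cmod (geod b a t))\<^sup>2 = 2 * (1 + (1 + a\<^sup>2) * (exp t)\<^sup>2) / ((1 + exp t)\<^sup>2 + a\<^sup>2 * (exp t)\<^sup>2)"
  unfolding norm_geod_sq using geod_den_pos[of t a]
  by (simp add: add_divide_eq_iff less_imp_neq[symmetric]) (simp add: power2_eq_square algebra_simps)

lemma one_minus_norm_geod:
  "1 - (cmod (geod b a t))\<^sup>2 = 4 * exp t / ((1 + exp t)\<^sup>2 + a\<^sup>2 * (exp t)\<^sup>2)"
  unfolding norm_geod_sq using geod_den_pos[of t a]
  by (simp add: diff_divide_eq_iff less_imp_neq[symmetric]) (simp add: power2_eq_square algebra_simps)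

lemma geod_in_disk: "geod b a t \<in> disk"
proof -
  have "1 - (cmod (geod b a t))\<^sup>2 > 0"
    unfolding one_minus_norm_geod using geod_den_pos by simp
  then have "(cmod (geod b a t))\<^sup>2 < 1\<^sup>2"
    by simp
  then have "cmod (geod b a t) < 1"
    by (rule power2_less_imp_less) simp
  then show ?thesis
    by (simp add: disk_def dist_norm)
qed

lemma bdf_geod: "bdf (geod b a t) = 2 * exp t / (1 + (1 + a\<^sup>2) * (exp t)\<^sup>2)"
proof -
  have "(4 * x / D) / (2 * Y / D) = 2 * x / Y" if "D > 0" for x D Y :: real
    using that by simp
  from this[OF geod_den_pos] show ?thesis
    unfolding bdf_def one_minus_norm_geod one_plus_norm_geod .
qed

text \<open>Power of a point: 1 - |w|^2 at a point w of a chord of the unit circle is the product of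
  the two segments, here s |chord| and (1 - s) |chord|.\<close>

lemma bdf_sq_geod:
  "(bdf (geod b a t))\<^sup>2 = chord_param a t * (1 - chord_param a t) * (cmod (chord (b, a)))\<^sup>2"
proof -
  have "1 - chord_param a t = 1 / (1 + (1 + a\<^sup>2) * (exp t)\<^sup>2)"
    unfolding chord_param_def using chord_param_den[of a t] by (simp add: diff_divide_eq_iff divide_eq_eq)
  moreover have "1 + a\<^sup>2 \<noteq> 0"
    by (metis add_pos_nonneg less_irrefl zero_le_power2 zero_less_one)
  ultimately show ?thesis
    unfolding bdf_geod norm_chord_sq unfolding chord_param_def
    by (simp add: power2_eq_square)
qed

lemma klein_geod: "klein (geod b a t) = zm (b, a) + of_real (chord_param a t) * chord (b, a)"
proof -
  define e where "e = complex_of_real (exp t)"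
  define w where "w = 1 - \<i> * complex_of_real a"
  define v where "v = 1 + \<i> * complex_of_real a"
  define Q where "Q = 1 + v * w * e\<^sup>2"
  have vw: "v * w = complex_of_real (1 + a\<^sup>2)"
    by (simp add: v_def w_def power2_eq_square algebra_simps)
  have Q: "Q = complex_of_real (1 + (1 + a\<^sup>2) * (exp t)\<^sup>2)"
    by (simp add: Q_def vw e_def)
  have Qnz: "Q \<noteq> 0"
    unfolding Q using chord_param_den[of a t] by (simp only: of_real_eq_0_iff)
  have wnz: "w \<noteq> 0"
    by (simp add: w_def)
  have Dnz: "1 + w * e \<noteq> 0"
    unfolding w_def e_def by (rule path_den_nonzero)
  have "cnj (1 + w * e) = 1 + v * e"
    by (simp add: w_def v_def e_def)
  then have DD: "complex_of_real ((1 + exp t)\<^sup>2 + a\<^sup>2 * (exp t)\<^sup>2) = (1 + w * e) * (1 + v * e)"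
    unfolding norm_path_den[symmetric] complex_norm_square by (simp add: w_def e_def)
  have Dnz': "1 + v * e \<noteq> 0"
    using Dnz \<open>cnj (1 + w * e) = 1 + v * e\<close> by (metis complex_cnj_zero_iff)
  have "klein (geod b a t) = 2 * (cis b * ((1 - v * e) / (1 + w * e))) / (2 * Q / ((1 + w * e) * (1 + v * e)))"
    unfolding klein_def one_plus_norm_geod of_real_divide DD of_real_mult[of 2] Q[symmetric]
    by (simp add: geod_eq v_def w_def e_def)
  also have "\<dots> = cis b * ((1 - v * e) * (1 + v * e) / Q)"
    using Dnz Dnz' by simp
  also have "(1 - v * e) * (1 + v * e) = Q - 2 * v * e\<^sup>2"
  proof -
    have "v + w = 2" by (simp add: v_def w_def)
    then have "w = 2 - v" by (simp add: eq_diff_eq add.commute)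
    then show ?thesis
      unfolding Q_def by (simp only:) (simp add: power2_eq_square algebra_simps)
  qed
  also have "(Q - 2 * v * e\<^sup>2) / Q = 1 + (v * w * e\<^sup>2 / Q) * (- 2 / w)"
    using Qnz wnz by (simp add: diff_divide_distrib)
  also have "cis b * (1 + (v * w * e\<^sup>2 / Q) * (- 2 / w)) = zm (b, a) + (v * w * e\<^sup>2 / Q) * chord (b, a)"
    by (simp add: chord_eq zm_def w_def algebra_simps)
  also have "v * w * e\<^sup>2 / Q = complex_of_real (chord_param a t)"
    by (simp add: chord_param_def Q vw e_def)
  finally show ?thesis .
qed

lemma chord_param_sigma: "complex_of_real (chord_param a t) = sigma_path 0 (ln (1 + a\<^sup>2) + 2 * t)"
proof -
  have "exp (ln (1 + a\<^sup>2) + 2 * t) = (1 + a\<^sup>2) * (exp t)\<^sup>2"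
  proof -
    have "1 + a\<^sup>2 > 0" by (simp add: add_pos_nonneg)
    then show ?thesis
      by (simp add: exp_add exp_double)
  qed
  then show ?thesis
    by (simp add: chord_param_def sigma_path_def)
qed

text \<open>The factor 1/2 comes from the doubled time in \<open>chord_param_sigma\<close>.\<close>

lemma path_value_chord_param:
  assumes "path_value f c"
  shows "integrable lborel (\<lambda>t. f (of_real (chord_param a t)) * of_real (chord_param a t * (1 - chord_param a t)))"
    "(\<integral>t. f (of_real (chord_param a t)) * of_real (chord_param a t * (1 - chord_param a t)) \<partial>lborel) = c / 2"
proof -
  define g where "g u = f (sigma_path 0 u) * (sigma_path 0 u * (1 - sigma_path 0 u))" for u
  have gi: "integrable lborel g"
    unfolding g_def by (rule path_value_integrable(1)[OF assms])
  have gv: "(\<integral>u. g u \<partial>lborel) = c"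
    unfolding g_def by (rule path_value_integral[OF assms])
  have eq: "f (of_real (chord_param a t)) * of_real (chord_param a t * (1 - chord_param a t)) = g (ln (1 + a\<^sup>2) + 2 * t)" for t
    unfolding g_def chord_param_sigma[symmetric] by simp
  show "integrable lborel (\<lambda>t. f (of_real (chord_param a t)) * of_real (chord_param a t * (1 - chord_param a t)))"
    unfolding eq using lborel_integrable_real_affine[OF gi, of 2 "ln (1 + a\<^sup>2)"] by simp
  have "c = 2 * (\<integral>t. g (ln (1 + a\<^sup>2) + 2 * t) \<partial>lborel)"
    using lborel_integral_real_affine[of 2 g "ln (1 + a\<^sup>2)"] gv by (simp add: scaleR_conv_of_real)
  then show "(\<integral>t. f (of_real (chord_param a t)) * of_real (chord_param a t * (1 - chord_param a t)) \<partial>lborel) = c / 2"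
    unfolding eq by simp
qed

text \<open>Coefficients of the boundary terms produced by the successive integrations by parts in
  \<open>path_value_ibp\<close>. Their positivity later allows solving for the last term.\<close>

primrec ibp_coeff :: "nat \<Rightarrow> nat \<Rightarrow> nat \<Rightarrow> real" where
  "ibp_coeff 0 m n = 1 / real (Suc m)"
| "ibp_coeff (Suc i) m n = real n / real (Suc m) * ibp_coeff i (Suc m) (n - 1)"

lemma ibp_coeff_pos: "i \<le> n \<Longrightarrow> ibp_coeff i m n > 0"
  by (induction i arbitrary: m n) auto

text \<open>Repeated integration by parts along the segment from \<open>w\<close> to \<open>z\<close>.\<close>

lemma path_value_ibp:
  fixes z w :: complex
  shows "path_value (\<lambda>s. (z - w) * ((w + s * (z - w)) ^ m * (z - s * (z - w)) ^ n))
    (\<Sum>i\<le>n. complex_of_real (ibp_coeff i m n) * (z ^ (m + 1 + i) * w ^ (n - i) - w ^ (m + 1 + i) * z ^ (n - i)))"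
proof (induction n arbitrary: m)
  case 0
  have "((\<lambda>s. (w + s * (z - w)) ^ Suc m / of_nat (Suc m)) has_field_derivative (z - w) * (w + s * (z - w)) ^ m) (at s)" for s
  proof -
    have "((\<lambda>s. w + s * (z - w)) has_field_derivative (z - w)) (at s)"
      by (auto intro!: derivative_eq_intros)
    from DERIV_cdivide[OF DERIV_power[OF this, of "Suc m"], of "of_nat (Suc m)"]
    show ?thesis
      by (simp del: of_nat_Suc power_Suc)
  qed
  then show ?case
    unfolding path_value_def
    by (intro conjI exI[of _ "\<lambda>s. (w + s * (z - w)) ^ Suc m / of_nat (Suc m)"])
      (auto intro!: continuous_intros simp: diff_divide_distrib simp del: of_nat_Suc power_Suc)
next
  case (Suc n)
  define N where "N = complex_of_nat (Suc n)"
  define M where "M = complex_of_nat (Suc m)"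
  have M: "M \<noteq> 0"
    unfolding M_def by (simp del: of_nat_Suc)
  have 1: "path_value (\<lambda>s. (z - w) * ((w + s * (z - w)) ^ m * (z - s * (z - w)) ^ Suc n)
      - N / M * ((z - w) * ((w + s * (z - w)) ^ Suc m * (z - s * (z - w)) ^ n)))
      (1 / M * (z ^ Suc m * w ^ Suc n - w ^ Suc m * z ^ Suc n))"
    unfolding path_value_def
  proof (intro conjI exI[of _ "\<lambda>s. 1 / M * ((w + s * (z - w)) ^ Suc m * (z - s * (z - w)) ^ Suc n)"] allI)
    fix s
    have "((\<lambda>s. w + s * (z - w)) has_field_derivative (z - w)) (at s)"
      "((\<lambda>s. z - s * (z - w)) has_field_derivative - (z - w)) (at s)"
      by (auto intro!: derivative_eq_intros)
    from DERIV_cmult[OF DERIV_mult[OF DERIV_power[OF this(1), of "Suc m"] DERIV_power[OF this(2), of "Suc n"]], of "1 / M"]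
    have "((\<lambda>s. 1 / M * ((w + s * (z - w)) ^ Suc m * (z - s * (z - w)) ^ Suc n)) has_field_derivative
      1 / M * (M * ((z - w) * (w + s * (z - w)) ^ m) * (z - s * (z - w)) ^ Suc n
        + N * (- (z - w) * (z - s * (z - w)) ^ n) * (w + s * (z - w)) ^ Suc m)) (at s)"
      unfolding M_def N_def by (simp only: diff_Suc_Suc diff_zero mult.commute add.commute)
    moreover have "1 / M * (M * (d * A) * B + N * (- d * C) * D) = d * (A * B) - N / M * (d * (D * C))" for d A B C D
      using M by (simp add: field_simps)
    ultimately show "((\<lambda>s. 1 / M * ((w + s * (z - w)) ^ Suc m * (z - s * (z - w)) ^ Suc n)) has_field_derivative
      (z - w) * ((w + s * (z - w)) ^ m * (z - s * (z - w)) ^ Suc n)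
      - N / M * ((z - w) * ((w + s * (z - w)) ^ Suc m * (z - s * (z - w)) ^ n))) (at s)"
      by (simp only:)
  qed (auto intro!: continuous_intros M simp: right_diff_distrib simp del: power_Suc)
  note 2 = path_value_add[OF 1 path_value_scale[OF Suc.IH[of "Suc m"], of "N / M"]]
  have "1 / M * (z ^ Suc m * w ^ Suc n - w ^ Suc m * z ^ Suc n)
      + N / M * (\<Sum>i\<le>n. complex_of_real (ibp_coeff i (Suc m) n) * (z ^ (Suc m + 1 + i) * w ^ (n - i) - w ^ (Suc m + 1 + i) * z ^ (n - i)))
    = (\<Sum>i\<le>Suc n. complex_of_real (ibp_coeff i m (Suc n)) * (z ^ (m + 1 + i) * w ^ (Suc n - i) - w ^ (m + 1 + i) * z ^ (Suc n - i)))"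
    unfolding sum.atMost_Suc_shift sum_distrib_left
  proof (rule arg_cong2[where f = "(+)"])
    show "1 / M * (z ^ Suc m * w ^ Suc n - w ^ Suc m * z ^ Suc n)
      = complex_of_real (ibp_coeff 0 m (Suc n)) * (z ^ (m + 1 + 0) * w ^ (Suc n - 0) - w ^ (m + 1 + 0) * z ^ (Suc n - 0))"
      by (simp add: M_def del: of_nat_Suc power_Suc)
    show "(\<Sum>i\<le>n. N / M * (complex_of_real (ibp_coeff i (Suc m) n) * (z ^ (Suc m + 1 + i) * w ^ (n - i) - w ^ (Suc m + 1 + i) * z ^ (n - i))))
      = (\<Sum>i\<le>n. complex_of_real (ibp_coeff (Suc i) m (Suc n)) * (z ^ (m + 1 + Suc i) * w ^ (Suc n - Suc i) - w ^ (m + 1 + Suc i) * z ^ (Suc n - Suc i)))"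
      by (rule sum.cong) (simp_all add: M_def N_def del: of_nat_Suc power_Suc)
  qed
  then show ?case
    using 2 by simp
qed

subsection \<open>The X-ray transform of functions\<close>

text \<open>The weight x^2 is |chord|^2 s (1 - s) on a geodesic, a constant multiple of the
  derivative of s in t, so the integral in t becomes that of a polynomial in s.\<close>

definition klein_monomial :: "nat \<Rightarrow> nat \<Rightarrow> complex \<Rightarrow> complex" where
  "klein_monomial m n z = of_real ((bdf z)\<^sup>2) * (klein z ^ m * cnj (klein z) ^ n)"

text \<open>Because the endpoints lie on the unit circle, the conjugate of a chord point is (zp - s
  chord) / (zp zm), so conjugate powers are polynomial in s too. Dividing the boundary terms by (zp
  zm)^(n+1) gives the index pairs (m - n + i, -1 - i); the minus sign is that of
  \<open>cnj_chord\<close> and the 1/2 that of the doubled time.\<close>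

lemma I0_klein_monomial:
  "integrable lborel (\<lambda>t. klein_monomial m n (geod b a t))"
  "I0 (klein_monomial m n) (b, a)
    = - (1/2) * (\<Sum>i\<le>n. complex_of_real (ibp_coeff i m n) * ebasis_even (int m - int n + int i) (- 1 - int i) (b, a))"
proof -
  define y where "y = (b, a)"
  define C where "C = (\<Sum>i\<le>n. complex_of_real (ibp_coeff i m n) * (zp y ^ (m + 1 + i) * zm y ^ (n - i) - zm y ^ (m + 1 + i) * zp y ^ (n - i)))"
  define f where "f s = chord y * ((zm y + s * chord y) ^ m * (zp y - s * chord y) ^ n)" for s
  have pv: "path_value f C"
    using path_value_ibp[of "zp y" "zm y" m n] unfolding f_def C_def chord_def .
  define k where "k = cnj (chord y) / (zp y * zm y) ^ n"
  have cnjK: "cnj (zm y + of_real s * chord y) = (zp y - of_real s * chord y) / (zp y * zm y)" for s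
    unfolding complex_cnj_add complex_cnj_mult complex_cnj_complex_of_real cnj_chord cnj_zm
    by (simp add: field_simps)
  have eq: "klein_monomial m n (geod b a t)
      = k * (f (of_real (chord_param a t)) * of_real (chord_param a t * (1 - chord_param a t)))" for t
    unfolding klein_monomial_def bdf_sq_geod klein_geod y_def[symmetric] cnjK f_def k_def
      of_real_mult complex_norm_square of_real_power[of "cmod (chord y)" 2]
    by (simp add: power_divide mult_ac)
  show "integrable lborel (\<lambda>t. klein_monomial m n (geod b a t))"
    unfolding eq by (intro integrable_mult_right path_value_chord_param(1)[OF pv])
  have "I0 (klein_monomial m n) (b, a) = k * (C / 2)"
    unfolding I0_def prod.case eq integral_mult_right_zero path_value_chord_param(2)[OF pv] ..
  also have "\<dots> = - (1/2) * (chord y / (zp y * zm y) ^ Suc n * C)"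
    unfolding k_def cnj_chord by (simp add: field_simps)
  also have "chord y / (zp y * zm y) ^ Suc n * C
      = (\<Sum>i\<le>n. complex_of_real (ibp_coeff i m n) * ebasis_even (int m - int n + int i) (- 1 - int i) y)"
    unfolding C_def sum_distrib_left
  proof (rule sum.cong)
    fix i assume i: "i \<in> {..n}"
    have pw: "u ^ (m + 1 + i) / u ^ Suc n = u powi (int m - int n + int i)" "u ^ (n - i) / u ^ Suc n = u powi (- 1 - int i)"
      if "u \<noteq> 0" for u :: complex
    proof -
      have "int m - int n + int i = int (m + 1 + i) - int (Suc n)"
        by simp
      then have "u powi (int m - int n + int i) = u powi (int (m + 1 + i) - int (Suc n))"
        by (simp only:)
      also have "\<dots> = u ^ (m + 1 + i) / u ^ Suc n"
        by (subst power_int_diff) (use that in \<open>simp_all only: power_int_of_nat simp_thms\<close>)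
      finally show "u ^ (m + 1 + i) / u ^ Suc n = u powi (int m - int n + int i)" ..
      have "- 1 - int i = int (n - i) - int (Suc n)"
        using i by (simp add: of_nat_diff)
      then have "u powi (- 1 - int i) = u powi (int (n - i) - int (Suc n))"
        by (simp only:)
      also have "\<dots> = u ^ (n - i) / u ^ Suc n"
        by (subst power_int_diff) (use that in \<open>simp_all only: power_int_of_nat simp_thms\<close>)
      finally show "u ^ (n - i) / u ^ Suc n = u powi (- 1 - int i)" ..
    qed
    show "chord y / (zp y * zm y) ^ Suc n * (complex_of_real (ibp_coeff i m n) * (zp y ^ (m + 1 + i) * zm y ^ (n - i) - zm y ^ (m + 1 + i) * zp y ^ (n - i)))
        = complex_of_real (ibp_coeff i m n) * ebasis_even (int m - int n + int i) (- 1 - int i) y"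
      unfolding ebasis_even_def ebasis_def pw[OF zp_nonzero, symmetric] pw[OF zm_nonzero, symmetric]
      by (simp add: power_mult_distrib diff_divide_distrib right_diff_distrib mult_ac del: power_Suc)
  qed simp
  finally show "I0 (klein_monomial m n) (b, a)
    = - (1/2) * (\<Sum>i\<le>n. complex_of_real (ibp_coeff i m n) * ebasis_even (int m - int n + int i) (- 1 - int i) (b, a))"
    unfolding y_def .
qed

subsection \<open>Rotation invariance of planar Lebesgue measure\<close>

lemma distr_lborel_Complex: "distr (lborel \<Otimes>\<^sub>M lborel) borel (\<lambda>(x, y). Complex x y) = lborel"
proof (rule lborel_eqI[symmetric])
  have m: "(\<lambda>(x, y). Complex x y) \<in> borel_measurable (lborel \<Otimes>\<^sub>M lborel)"
    unfolding lborel_prod by (simp add: split_def borel_measurable_continuous_onI continuous_on_Complex continuous_on_fst continuous_on_snd)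
  fix l u :: complex
  assume lu: "\<And>b. b \<in> Basis \<Longrightarrow> l \<bullet> b \<le> u \<bullet> b"
  have le: "Re l \<le> Re u" "Im l \<le> Im u"
    using lu[of 1] lu[of \<i>] by (simp_all add: Basis_complex_def)
  have "(\<lambda>(x, y). Complex x y) -` box l u \<inter> space (lborel \<Otimes>\<^sub>M lborel) = {Re l<..<Re u} \<times> {Im l<..<Im u}"
    by (auto simp: box_def Basis_complex_def space_pair_measure)
  then have "emeasure (distr (lborel \<Otimes>\<^sub>M lborel) borel (\<lambda>(x, y). Complex x y)) (box l u)
      = emeasure (lborel \<Otimes>\<^sub>M lborel) ({Re l<..<Re u} \<times> {Im l<..<Im u})"
    by (subst emeasure_distr[OF m]) simp_all
  also have "\<dots> = ennreal (Re u - Re l) * ennreal (Im u - Im l)"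
    using le by (subst lborel.emeasure_pair_measure_Times) simp_all
  also have "\<dots> = ennreal (\<Prod>b\<in>Basis. (u - l) \<bullet> b)"
    using le by (simp add: Basis_complex_def ennreal_mult)
  finally show "emeasure (distr (lborel \<Otimes>\<^sub>M lborel) borel (\<lambda>(x, y). Complex x y)) (box l u)
      = ennreal (\<Prod>b\<in>Basis. (u - l) \<bullet> b)" .
qed simp

lemma nn_integral_complex_fst:
  fixes f :: "complex \<Rightarrow> ennreal"
  assumes [measurable]: "f \<in> borel_measurable borel"
  shows "(\<integral>\<^sup>+z. f z \<partial>lborel) = (\<integral>\<^sup>+x. \<integral>\<^sup>+y. f (Complex x y) \<partial>lborel \<partial>lborel)"
    and "(\<integral>\<^sup>+z. f z \<partial>lborel) = (\<integral>\<^sup>+y. \<integral>\<^sup>+x. f (Complex x y) \<partial>lborel \<partial>lborel)"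
proof -
  have m: "(\<lambda>(x, y). Complex x y) \<in> borel_measurable (lborel \<Otimes>\<^sub>M lborel)"
    unfolding lborel_prod by (simp add: split_def borel_measurable_continuous_onI continuous_on_Complex continuous_on_fst continuous_on_snd)
  have "(\<integral>\<^sup>+z. f z \<partial>lborel) = (\<integral>\<^sup>+p. f (case p of (x, y) \<Rightarrow> Complex x y) \<partial>(lborel \<Otimes>\<^sub>M lborel))"
    by (subst distr_lborel_Complex[symmetric], subst nn_integral_distr[OF m]) simp_all
  moreover have fm: "(\<lambda>p. f (case p of (x, y) \<Rightarrow> Complex x y)) \<in> borel_measurable (lborel \<Otimes>\<^sub>M lborel)"
    using measurable_compose[OF m assms] .
  ultimately show "(\<integral>\<^sup>+z. f z \<partial>lborel) = (\<integral>\<^sup>+x. \<integral>\<^sup>+y. f (Complex x y) \<partial>lborel \<partial>lborel)"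
    "(\<integral>\<^sup>+z. f z \<partial>lborel) = (\<integral>\<^sup>+y. \<integral>\<^sup>+x. f (Complex x y) \<partial>lborel \<partial>lborel)"
    using lborel.nn_integral_fst[OF fm] lborel_pair.nn_integral_snd[OF fm]
    by (simp_all add: split_def)
qed

lemma measurable_Complex_section [measurable]:
  "(\<lambda>y. Complex x y) \<in> borel_measurable borel" "(\<lambda>x. Complex x y) \<in> borel_measurable borel"
  by (intro borel_measurable_continuous_onI continuous_on_Complex continuous_intros)+

definition shear_re :: "real \<Rightarrow> complex \<Rightarrow> complex" where
  "shear_re s z = z + of_real (s * Im z)"

definition shear_im :: "real \<Rightarrow> complex \<Rightarrow> complex" where
  "shear_im s z = z + \<i> * of_real (s * Re z)"

lemma shear_measurable [measurable]: "shear_re s \<in> borel_measurable borel" "shear_im s \<in> borel_measurable borel"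
  unfolding shear_re_def[abs_def] shear_im_def[abs_def] by (intro borel_measurable_continuous_onI continuous_intros)+

lemma nn_integral_shear_re:
  fixes f :: "complex \<Rightarrow> ennreal"
  assumes [measurable]: "f \<in> borel_measurable borel"
  shows "(\<integral>\<^sup>+z. f (shear_re s z) \<partial>lborel) = (\<integral>\<^sup>+z. f z \<partial>lborel)"
proof -
  have "(\<integral>\<^sup>+z. f (shear_re s z) \<partial>lborel) = (\<integral>\<^sup>+y. \<integral>\<^sup>+x. f (shear_re s (Complex x y)) \<partial>lborel \<partial>lborel)"
    by (rule nn_integral_complex_fst(2)) measurable
  also have "\<dots> = (\<integral>\<^sup>+y. \<integral>\<^sup>+x. f (Complex x y) \<partial>lborel \<partial>lborel)"
  proof (rule nn_integral_cong)
    fix y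
    have "shear_re s (Complex x y) = Complex (s * y + 1 * x) y" for x
      by (simp add: shear_re_def complex_eq_iff)
    then show "(\<integral>\<^sup>+x. f (shear_re s (Complex x y)) \<partial>lborel) = (\<integral>\<^sup>+x. f (Complex x y) \<partial>lborel)"
      using nn_integral_real_affine[of "\<lambda>x. f (Complex x y)" 1 "s * y"] by simp
  qed
  also have "\<dots> = (\<integral>\<^sup>+z. f z \<partial>lborel)"
    by (rule nn_integral_complex_fst(2)[symmetric]) measurable
  finally show ?thesis .
qed

lemma nn_integral_shear_im:
  fixes f :: "complex \<Rightarrow> ennreal"
  assumes [measurable]: "f \<in> borel_measurable borel"
  shows "(\<integral>\<^sup>+z. f (shear_im s z) \<partial>lborel) = (\<integral>\<^sup>+z. f z \<partial>lborel)"
proof -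
  have "(\<integral>\<^sup>+z. f (shear_im s z) \<partial>lborel) = (\<integral>\<^sup>+x. \<integral>\<^sup>+y. f (shear_im s (Complex x y)) \<partial>lborel \<partial>lborel)"
    by (rule nn_integral_complex_fst(1)) measurable
  also have "\<dots> = (\<integral>\<^sup>+x. \<integral>\<^sup>+y. f (Complex x y) \<partial>lborel \<partial>lborel)"
  proof (rule nn_integral_cong)
    fix x
    have "shear_im s (Complex x y) = Complex x (s * x + 1 * y)" for y
      by (simp add: shear_im_def complex_eq_iff)
    then show "(\<integral>\<^sup>+y. f (shear_im s (Complex x y)) \<partial>lborel) = (\<integral>\<^sup>+y. f (Complex x y) \<partial>lborel)"
      using nn_integral_real_affine[of "\<lambda>y. f (Complex x y)" 1 "s * x"] by simp
  qed
  also have "\<dots> = (\<integral>\<^sup>+z. f z \<partial>lborel)"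
    by (rule nn_integral_complex_fst(1)[symmetric]) measurable
  finally show ?thesis .
qed

text \<open>Away from half turns, a rotation is a product of three shears.\<close>

lemma distr_lborel_cis:
  assumes "cos (\<theta> / 2) \<noteq> 0"
  shows "distr lborel borel ((*) (cis \<theta>)) = lborel"
proof -
  define s where "s = - tan (\<theta> / 2)"
  have s1: "s * sin \<theta> = cos \<theta> - 1"
  proof -
    have "s * sin \<theta> = - 2 * (sin (\<theta> / 2))\<^sup>2"
      using assms sin_double[of "\<theta> / 2"] by (simp add: s_def tan_def power2_eq_square)
    also have "\<dots> = cos \<theta> - 1"
      using cos_double_sin[of "\<theta> / 2"] by simp
    finally show ?thesis .
  qed
  have s2: "s * (1 + cos \<theta>) = - sin \<theta>"
  proof -
    have "1 + cos \<theta> = 2 * (cos (\<theta> / 2))\<^sup>2"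
      using cos_double_cos[of "\<theta> / 2"] by simp
    then show ?thesis
      using assms sin_double[of "\<theta> / 2"] by (simp add: s_def tan_def power2_eq_square)
  qed
  have rot: "cis \<theta> * z = shear_re s (shear_im (sin \<theta>) (shear_re s z))" for z
  proof (rule complex_eqI)
    have "Im (shear_im (sin \<theta>) (shear_re s z)) = Im z + sin \<theta> * (Re z + s * Im z)"
      by (simp add: shear_im_def shear_re_def)
    also have "\<dots> = sin \<theta> * Re z + (1 + s * sin \<theta>) * Im z"
      by (simp add: algebra_simps)
    also have "\<dots> = sin \<theta> * Re z + cos \<theta> * Im z"
      unfolding s1 by simp
    finally have im: "Im (shear_im (sin \<theta>) (shear_re s z)) = sin \<theta> * Re z + cos \<theta> * Im z" .
    then show "Im (cis \<theta> * z) = Im (shear_re s (shear_im (sin \<theta>) (shear_re s z)))"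
      by (simp add: shear_re_def[of s "shear_im _ _"])
    have "Re (shear_re s (shear_im (sin \<theta>) (shear_re s z))) = Re z + s * Im z + s * (sin \<theta> * Re z + cos \<theta> * Im z)"
      unfolding shear_re_def[of s "shear_im _ _"] using im by (simp add: shear_im_def shear_re_def)
    also have "\<dots> = (1 + s * sin \<theta>) * Re z + s * (1 + cos \<theta>) * Im z"
      by (simp add: algebra_simps)
    also have "\<dots> = cos \<theta> * Re z - sin \<theta> * Im z"
      unfolding s1 s2 by simp
    finally show "Re (cis \<theta> * z) = Re (shear_re s (shear_im (sin \<theta>) (shear_re s z)))"
      by simp
  qed
  show ?thesis
  proof (rule measure_eqI)
    fix A assume "A \<in> sets (distr lborel borel ((*) (cis \<theta>)))"
    then have A [measurable]: "A \<in> sets borel" by simp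
    have m: "(*) (cis \<theta>) \<in> borel_measurable lborel"
      by simp
    have "emeasure (distr lborel borel ((*) (cis \<theta>))) A = (\<integral>\<^sup>+z. indicator A z \<partial>distr lborel borel ((*) (cis \<theta>)))"
      using A by simp
    also have "\<dots> = (\<integral>\<^sup>+z. indicator A (cis \<theta> * z) \<partial>lborel)"
      by (rule nn_integral_distr[OF m]) simp
    also have "\<dots> = (\<integral>\<^sup>+z. indicator A (shear_re s (shear_im (sin \<theta>) z)) \<partial>lborel)"
      unfolding rot by (rule nn_integral_shear_re[of "\<lambda>z. indicator A (shear_re s (shear_im (sin \<theta>) z))"]) measurable
    also have "\<dots> = (\<integral>\<^sup>+z. indicator A (shear_re s z) \<partial>lborel)"
      by (rule nn_integral_shear_im[of "\<lambda>z. indicator A (shear_re s z)"]) measurable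
    also have "\<dots> = (\<integral>\<^sup>+z. indicator A z \<partial>lborel)"
      by (rule nn_integral_shear_re) measurable
    finally show "emeasure (distr lborel borel ((*) (cis \<theta>))) A = emeasure lborel A"
      by simp
  qed simp
qed

section \<open>Area measure in the Klein coordinate\<close>

lemma disk_measurable [measurable]: "disk \<in> sets borel"
  by (simp add: disk_def)

text \<open>For a in [0, 1] the part of the disk with |z|^2 \<le> a has area pi a, and such half
  lines generate the Borel sets.\<close>

lemma distr_norm_sq_disk:
  "distr (restrict_space lborel disk) borel (\<lambda>z. (cmod z)\<^sup>2) = density lborel (\<lambda>r. ennreal (pi * indicator {0..1} r))"
proof (rule measure_eqI_generator_eq[where E = "range (\<lambda>a::real. {..a})" and \<Omega> = UNIV and A = "\<lambda>n. {..real n}"])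
  let ?D = "distr (restrict_space lborel disk) borel (\<lambda>z. (cmod z)\<^sup>2)"
  let ?R = "density lborel (\<lambda>r. ennreal (pi * indicator {0..1} r))"
  have D: "emeasure ?D {..a} = ennreal (pi * (if a \<le> 0 then 0 else min a 1))" for a
  proof -
    have m: "(\<lambda>z. (cmod z)\<^sup>2) \<in> borel_measurable (restrict_space lborel disk)"
      by (rule measurable_restrict_space1) simp
    have "emeasure ?D {..a} = emeasure (restrict_space lborel disk) ({z. (cmod z)\<^sup>2 \<le> a} \<inter> disk)"
      by (subst emeasure_distr[OF m]) (auto simp: space_restrict_space intro!: arg_cong2[where f = emeasure])
    also have "\<dots> = emeasure lborel ({z. (cmod z)\<^sup>2 \<le> a} \<inter> disk)"
      by (rule emeasure_restrict_space) auto
    also have "\<dots> = ennreal (pi * (if a \<le> 0 then 0 else min a 1))"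
    proof -
      have area: "emeasure lborel (ball 0 r :: complex set) = ennreal (pi * r\<^sup>2)"
        "emeasure lborel (cball 0 r :: complex set) = ennreal (pi * r\<^sup>2)" if "r \<ge> 0" for r
        using that by (simp_all add: emeasure_ball emeasure_cball unit_ball_vol_2)
      consider "a < 0" | "a = 0" | "0 < a" "a < 1" | "1 \<le> a" by linarith
      then show ?thesis
      proof cases
        case 1
        have "{z. (cmod z)\<^sup>2 \<le> a} = {}"
          using 1 by (auto simp: not_le intro: less_le_trans)
        then show ?thesis using 1 by simp
      next
        case 2
        then have "{z. (cmod z)\<^sup>2 \<le> a} \<inter> disk = {0}"
          by (auto simp: disk_def)
        then show ?thesis using 2 by simp
      next
        case 3
        have "{z. (cmod z)\<^sup>2 \<le> a} \<inter> disk = cball 0 (sqrt a)"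
        proof (intro set_eqI iffI)
          fix z :: complex assume "z \<in> cball 0 (sqrt a)"
          then have "cmod z \<le> sqrt a" by (simp add: dist_norm)
          moreover have "sqrt a < 1" using 3 by simp
          ultimately have "cmod z < 1" by linarith
          moreover have "(cmod z)\<^sup>2 \<le> a"
            using power_mono[OF \<open>cmod z \<le> sqrt a\<close>, of 2] 3 by simp
          ultimately show "z \<in> {z. (cmod z)\<^sup>2 \<le> a} \<inter> disk"
            by (simp add: disk_def dist_norm)
        qed (auto simp: dist_norm real_le_rsqrt)
        then show ?thesis using 3 area(2)[of "sqrt a"] by simp
      next
        case 4
        have "{z. (cmod z)\<^sup>2 \<le> a} \<inter> disk = ball 0 1"
        proof (intro set_eqI iffI)
          fix z :: complex assume "z \<in> ball 0 1"
          then have "(cmod z)\<^sup>2 \<le> 1"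
            by (simp add: dist_norm power_le_one)
          then show "z \<in> {z. (cmod z)\<^sup>2 \<le> a} \<inter> disk"
            using 4 \<open>z \<in> ball 0 1\<close> by (simp add: disk_def)
        qed (simp add: disk_def)
        then show ?thesis using 4 area(1)[of 1] by simp
      qed
    qed
    finally show ?thesis .
  qed
  have R: "emeasure ?R {..a} = ennreal (pi * (if a \<le> 0 then 0 else min a 1))" for a
  proof -
    have "emeasure ?R {..a} = (\<integral>\<^sup>+r. ennreal (pi * indicator {0..1} r) * indicator {..a} r \<partial>lborel)"
      by (rule emeasure_density) auto
    also have "\<dots> = (\<integral>\<^sup>+r. ennreal pi * indicator {0..min a 1} r \<partial>lborel)"
      by (rule nn_integral_cong) (auto simp: indicator_def)
    also have "\<dots> = ennreal pi * emeasure lborel {0..min a 1}"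
      by (simp add: nn_integral_cmult)
    also have "\<dots> = ennreal (pi * (if a \<le> 0 then 0 else min a 1))"
      by (auto simp: emeasure_lborel_Icc_eq ennreal_mult)
    finally show ?thesis .
  qed
  show "Int_stable (range (\<lambda>a::real. {..a}))"
    by (auto simp: Int_stable_def)
  show "\<And>X. X \<in> range (\<lambda>a::real. {..a}) \<Longrightarrow> emeasure ?D X = emeasure ?R X"
    using D R by auto
  show "sets ?D = sigma_sets UNIV (range (\<lambda>a::real. {..a}))" "sets ?R = sigma_sets UNIV (range (\<lambda>a::real. {..a}))"
    by (simp_all add: borel_eq_atMost)
  show "(\<Union>n. {..real n}) = UNIV"
    using real_arch_simple by auto
  show "emeasure ?D {..real n} \<noteq> \<infinity>" for n
    unfolding D by simp
qed auto

lemma hyp_area_space: "space hyp_area = disk"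
  by (simp add: hyp_area_def space_restrict_space)

lemma borel_measurable_hyp: "f \<in> borel_measurable borel \<Longrightarrow> f \<in> borel_measurable hyp_area"
  unfolding hyp_area_def by (simp add: measurable_restrict_space1)

text \<open>As a function of r = |z|^2 this is the derivative of |klein z|^2 = 4 r / (1 + r)^2.
  Consequently x^3 dV_H is carried by \<open>klein\<close> to Lebesgue measure on the unit disk,
  which explains the values in \<open>klein_moment\<close>.\<close>

definition klein_density :: "real \<Rightarrow> real" where
  "klein_density r = 4 * (1 - r) / (1 + r) ^ 3"

lemma klein_density_eq:
  assumes "z \<in> disk"
  shows "(4 / (1 - (cmod z)\<^sup>2)\<^sup>2) * (bdf z) ^ 3 = klein_density ((cmod z)\<^sup>2)"
proof -
  have "1 - (cmod z)\<^sup>2 > 0"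
    using assms power_strict_mono[of "cmod z" 1 2] by (simp add: disk_def dist_norm)
  then show ?thesis
    unfolding bdf_def klein_density_def power_divide by (simp add: power2_eq_square power3_eq_cube)
qed

lemma integral_hyp_bdf:
  fixes f :: "complex \<Rightarrow> complex"
  assumes [measurable]: "f \<in> borel_measurable borel"
  shows "(\<integral>z. of_real ((bdf z) ^ 3) * f z \<partial>hyp_area)
    = (\<integral>z. of_real (klein_density ((cmod z)\<^sup>2)) * f z \<partial>restrict_space lborel disk)"
    and "integrable hyp_area (\<lambda>z. of_real ((bdf z) ^ 3) * f z)
    \<longleftrightarrow> integrable (restrict_space lborel disk) (\<lambda>z. of_real (klein_density ((cmod z)\<^sup>2)) * f z)"
proof -
  have m: "g \<in> borel_measurable (restrict_space lborel disk)" if "g \<in> borel_measurable borel" for g :: "complex \<Rightarrow> 'b :: topological_space"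
    by (rule measurable_restrict_space1) (use that in simp)
  have m1: "(\<lambda>z. of_real ((bdf z) ^ 3) * f z) \<in> borel_measurable (restrict_space lborel disk)"
    by (rule m) measurable
  have m2: "(\<lambda>z. 4 / (1 - (cmod z)\<^sup>2)\<^sup>2) \<in> borel_measurable (restrict_space lborel disk)"
    by (rule m) measurable
  have eq: "(4 / (1 - (cmod z)\<^sup>2)\<^sup>2) *\<^sub>R (of_real ((bdf z) ^ 3) * f z) = of_real (klein_density ((cmod z)\<^sup>2)) * f z"
    if "z \<in> disk" for z
  proof -
    have "complex_of_real (4 / (1 - (cmod z)\<^sup>2)\<^sup>2) * complex_of_real ((bdf z) ^ 3) = complex_of_real (klein_density ((cmod z)\<^sup>2))"
      by (simp only: of_real_mult[symmetric] klein_density_eq[OF that])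
    then show ?thesis
      unfolding scaleR_conv_of_real mult.assoc[symmetric] by (rule arg_cong)
  qed
  show "(\<integral>z. of_real ((bdf z) ^ 3) * f z \<partial>hyp_area)
    = (\<integral>z. of_real (klein_density ((cmod z)\<^sup>2)) * f z \<partial>restrict_space lborel disk)"
    unfolding hyp_area_def
    by (subst integral_density[OF m1 m2]) (auto intro!: AE_I2 Bochner_Integration.integral_cong eq simp del: of_real_power simp: space_restrict_space)
  show "integrable hyp_area (\<lambda>z. of_real ((bdf z) ^ 3) * f z)
    \<longleftrightarrow> integrable (restrict_space lborel disk) (\<lambda>z. of_real (klein_density ((cmod z)\<^sup>2)) * f z)"
    unfolding hyp_area_def
    by (subst integrable_density[OF m1 m2]) (auto intro!: AE_I2 Bochner_Integration.integrable_cong eq simp del: of_real_power simp: space_restrict_space)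
qed

lemma klein_density_bounds:
  assumes "0 \<le> r" "r \<le> 1"
  shows "0 \<le> klein_density r" "klein_density r \<le> 4"
proof -
  have "(1 + r) ^ 3 \<ge> 1"
    using assms by (intro one_le_power) simp
  moreover have "x > 0 \<and> 4 * (1 - r) \<le> 4 * x" if "x \<ge> 1" for x
    using assms that by simp
  ultimately have "(1 + r) ^ 3 > 0" "4 * (1 - r) \<le> 4 * (1 + r) ^ 3"
    by blast+
  then show "0 \<le> klein_density r" "klein_density r \<le> 4"
    using assms unfolding klein_density_def by (simp_all add: pos_divide_le_eq)
qed

lemma finite_disk: "emeasure lborel disk < \<infinity>"
  unfolding disk_def by (rule emeasure_lborel_ball_finite)

lemma integrable_disk_bounded:
  fixes f :: "complex \<Rightarrow> complex"
  assumes "f \<in> borel_measurable borel" "\<And>z. z \<in> disk \<Longrightarrow> cmod (f z) \<le> B"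
  shows "integrable (restrict_space lborel disk) f"
proof -
  have "finite_measure (restrict_space lborel disk)"
    using finite_disk by (intro finite_measureI) (simp add: space_restrict_space emeasure_restrict_space)
  then interpret finite_measure "restrict_space lborel disk" .
  show ?thesis
  proof (rule integrable_const_bound)
    show "AE z in restrict_space lborel disk. norm (f z) \<le> B"
      using assms(2) by (auto intro!: AE_I2 simp: space_restrict_space)
    show "f \<in> borel_measurable (restrict_space lborel disk)"
      by (rule measurable_restrict_space1) (use assms(1) in simp)
  qed
qed

text \<open>Different exponents: a rotation preserves the measure and multiplies the integrand by a
  number other than 1. Equal exponents: the substitution u = |klein z|^2 leaves pi times the
  integral of u^n over the unit interval.\<close>

lemma klein_moment:
  "integrable hyp_area (\<lambda>z. of_real ((bdf z) ^ 3) * (klein z ^ m * cnj (klein z) ^ n))"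
  "(\<integral>z. of_real ((bdf z) ^ 3) * (klein z ^ m * cnj (klein z) ^ n) \<partial>hyp_area) = (if m = n then pi / of_nat (Suc n) else 0)"
proof -
  define g where "g z = complex_of_real (klein_density ((cmod z)\<^sup>2)) * (klein z ^ m * cnj (klein z) ^ n)" for z
  have km: "(\<lambda>z. klein z ^ m * cnj (klein z) ^ n) \<in> borel_measurable borel"
    by measurable
  have gm [measurable]: "g \<in> borel_measurable borel"
    unfolding g_def klein_density_def by measurable
  have gi: "integrable (restrict_space lborel disk) g"
  proof (rule integrable_disk_bounded[OF gm])
    fix z assume "z \<in> disk"
    then have "(cmod z)\<^sup>2 \<le> 1"
      by (simp add: disk_def dist_norm power_le_one)
    then have "\<bar>klein_density ((cmod z)\<^sup>2)\<bar> \<le> 4"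
      using klein_density_bounds[of "(cmod z)\<^sup>2"] by simp
    from mult_mono[OF this norm_klein_powers_le[of z m n]] show "cmod (g z) \<le> 4"
      by (simp add: g_def norm_mult)
  qed
  show "integrable hyp_area (\<lambda>z. of_real ((bdf z) ^ 3) * (klein z ^ m * cnj (klein z) ^ n))"
    using integral_hyp_bdf(2)[OF km] gi unfolding g_def by simp
  have I: "(\<integral>z. of_real ((bdf z) ^ 3) * (klein z ^ m * cnj (klein z) ^ n) \<partial>hyp_area) = (\<integral>z. g z \<partial>restrict_space lborel disk)"
    using integral_hyp_bdf(1)[OF km] unfolding g_def .
  have "(\<integral>z. g z \<partial>restrict_space lborel disk) = (if m = n then pi / of_nat (Suc n) else 0)"
  proof (cases "m = n")
    case False
    \<comment> \<open>With this angle the multiplier is \<open>cis 1\<close>; moreover |\<theta>|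
      \<le> 1 stays away from the half turn excluded in \<open>distr_lborel_cis\<close>.\<close>
    define \<theta> where "\<theta> = 1 / (real m - real n)"
    define c where "c = cis \<theta>"
    have "\<bar>real m - real n\<bar> \<ge> 1"
      using False by linarith
    then have "\<bar>\<theta>\<bar> \<le> 1"
      unfolding \<theta>_def by (simp add: divide_le_eq abs_divide)
    then have "cos (\<theta> / 2) > 0"
      using pi_gt3 by (intro cos_gt_zero_pi) linarith+
    then have inv: "distr lborel borel ((*) c) = lborel"
      unfolding c_def by (intro distr_lborel_cis) simp
    have kc: "klein (c * z) = c * klein z" for z
      by (simp add: klein_def norm_mult c_def)
    have "c ^ m * cnj c ^ n = cis (real m * \<theta> - real n * \<theta>)"
      unfolding c_def cis_cnj Complex.DeMoivre by (simp add: cis_mult)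
    also have "real m * \<theta> - real n * \<theta> = 1"
      unfolding \<theta>_def using False by (simp flip: diff_divide_distrib)
    finally have cc: "c ^ m * cnj c ^ n = cis 1" .
    have "sin (1::real) > 0"
      using pi_gt3 by (intro sin_gt_zero) auto
    then have "cis 1 \<noteq> 1"
      by (metis Im_complex_of_real cis.sel(2) less_irrefl of_real_1)
    have eq: "indicator disk (c * z) *\<^sub>R g (c * z) = cis 1 * (indicator disk z *\<^sub>R g z)" for z
    proof -
      have "(c * z \<in> disk) = (z \<in> disk)"
        by (simp add: disk_def dist_norm norm_mult c_def)
      moreover have "g (c * z) = (c ^ m * cnj c ^ n) * g z"
        unfolding g_def kc by (simp add: norm_mult c_def[THEN arg_cong[where f = norm]] power_mult_distrib mult_ac)
      ultimately show ?thesis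
        unfolding cc by (simp add: indicator_def)
    qed
    have "(\<integral>z. g z \<partial>restrict_space lborel disk) = (\<integral>z. indicator disk z *\<^sub>R g z \<partial>lborel)"
      by (rule integral_restrict_space) simp
    also have "\<dots> = (\<integral>z. indicator disk z *\<^sub>R g z \<partial>distr lborel borel ((*) c))"
      unfolding inv ..
    also have "\<dots> = (\<integral>z. indicator disk (c * z) *\<^sub>R g (c * z) \<partial>lborel)"
      by (rule integral_distr) simp_all
    also have "\<dots> = cis 1 * (\<integral>z. indicator disk z *\<^sub>R g z \<partial>lborel)"
      unfolding eq by (rule integral_mult_right_zero)
    also have "(\<integral>z. indicator disk z *\<^sub>R g z \<partial>lborel) = (\<integral>z. g z \<partial>restrict_space lborel disk)"
      by (rule integral_restrict_space[symmetric]) simp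
    finally have "(\<integral>z. g z \<partial>restrict_space lborel disk) * (cis 1 - 1) = 0"
      by (simp add: algebra_simps)
    then show ?thesis
      using False \<open>cis 1 \<noteq> 1\<close> by simp
  next
    case True
    define u where "u r = 4 * r / (1 + r)\<^sup>2" for r :: real
    define h where "h r = klein_density r * u r ^ n" for r
    have gh: "g z = complex_of_real (h ((cmod z)\<^sup>2))" for z
    proof -
      have "klein z ^ n * cnj (klein z) ^ n = complex_of_real (((cmod (klein z))\<^sup>2) ^ n)"
        by (simp only: of_real_power[of "(cmod (klein z))\<^sup>2" n] complex_norm_square power_mult_distrib)
      moreover have "(cmod (klein z))\<^sup>2 = u ((cmod z)\<^sup>2)"
        unfolding norm_klein u_def by (simp add: power_divide power_mult_distrib)
      ultimately show ?thesis
        unfolding g_def True h_def by simp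
    qed
    have hm [measurable]: "h \<in> borel_measurable borel"
      unfolding h_def u_def klein_density_def by measurable
    have m: "(\<lambda>z. (cmod z)\<^sup>2) \<in> borel_measurable (restrict_space lborel disk)"
      by (rule measurable_restrict_space1) simp
    have "(\<integral>z. g z \<partial>restrict_space lborel disk) = complex_of_real (\<integral>z. h ((cmod z)\<^sup>2) \<partial>restrict_space lborel disk)"
      unfolding gh by (rule integral_complex_of_real)
    also have "(\<integral>z. h ((cmod z)\<^sup>2) \<partial>restrict_space lborel disk) = (\<integral>r. h r \<partial>distr (restrict_space lborel disk) borel (\<lambda>z. (cmod z)\<^sup>2))"
      by (rule integral_distr[symmetric, OF m hm])
    also have "\<dots> = (\<integral>r. (pi * indicator {0..1} r) *\<^sub>R h r \<partial>lborel)"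
      unfolding distr_norm_sq_disk by (rule integral_density) auto
    also have "\<dots> = pi * (\<integral>r. indicator {0..1} r *\<^sub>R h r \<partial>lborel)"
      by (simp add: mult.assoc)
    also have "(\<integral>r. indicator {0..1} r *\<^sub>R h r \<partial>lborel) = u 1 ^ Suc n / real (Suc n) - u 0 ^ Suc n / real (Suc n)"
    proof (rule integral_FTC_atLeastAtMost)
      fix r :: real assume r: "0 \<le> r" "r \<le> 1"
      have "(u has_real_derivative klein_density r) (at r within {0..1})"
        unfolding u_def klein_density_def using r
        by (auto intro!: derivative_eq_intros simp: divide_simps power2_eq_square power3_eq_cube) (simp add: algebra_simps)
      from DERIV_cdivide[OF DERIV_power[OF this, of "Suc n"], of "real (Suc n)"]
      have "((\<lambda>r. u r ^ Suc n / real (Suc n)) has_real_derivative h r) (at r within {0..1})"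
        unfolding h_def by (simp del: of_nat_Suc power_Suc)
      then show "((\<lambda>r. u r ^ Suc n / real (Suc n)) has_vector_derivative h r) (at r within {0..1})"
        by (simp add: has_real_derivative_iff_has_vector_derivative)
    next
      show "continuous_on {0..1} h"
        unfolding h_def u_def klein_density_def by (intro continuous_intros) auto
    qed simp
    also have "\<dots> = 1 / real (Suc n)"
      by (simp add: u_def)
    finally show ?thesis
      using True by simp
  qed
  with I show "(\<integral>z. of_real ((bdf z) ^ 3) * (klein z ^ m * cnj (klein z) ^ n) \<partial>hyp_area) = (if m = n then pi / of_nat (Suc n) else 0)"
    by simp
qed

subsection \<open>Push-forward to the disk\<close>

text \<open>Passes from indicators to a Borel function G that may be unbounded, only the product
  being integrable; the simple functions approximating G are bounded by 2 |G|.\<close>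

lemma integral_comp_zero:
  fixes g :: "'a \<Rightarrow> complex" and T :: "'a \<Rightarrow> complex" and G :: "complex \<Rightarrow> complex"
  assumes g: "integrable M g" and T [measurable]: "T \<in> borel_measurable M"
    and z: "\<And>A. A \<in> sets borel \<Longrightarrow> (\<integral>x. g x * indicator A (T x) \<partial>M) = 0"
    and G [measurable]: "G \<in> borel_measurable borel"
    and gG: "integrable M (\<lambda>x. g x * G (T x))"
  shows "(\<integral>x. g x * G (T x) \<partial>M) = 0"
proof -
  have [measurable]: "g \<in> borel_measurable M"
    using g by simp
  obtain F where F: "\<And>i. simple_function borel (F i)" "\<And>w. (\<lambda>i. F i w) \<longlonglongrightarrow> G w"
    "\<And>i w. dist (F i w) 0 \<le> 2 * dist (G w) 0"
    using borel_measurable_implies_sequence_metric[OF G, of 0] by auto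
  have Fm [measurable]: "F i \<in> borel_measurable borel" for i
    using F(1) by (rule borel_measurable_simple_function)
  have zero: "(\<integral>x. g x * F i (T x) \<partial>M) = 0" for i
  proof -
    have fin: "finite (range (F i))"
      using simple_functionD(1)[OF F(1)[of i]] by simp
    have rep: "F i w = (\<Sum>c\<in>range (F i). c * indicator (F i -` {c}) w)" for w
    proof -
      have "(\<Sum>c\<in>range (F i). c * indicator (F i -` {c}) w) = (\<Sum>c\<in>range (F i). if c = F i w then c else 0)"
        by (rule sum.cong) (auto simp: indicator_def)
      then show ?thesis
        using fin by simp
    qed
    have sets: "F i -` {c} \<in> sets borel" for c
      using simple_functionD(2)[OF F(1)[of i], of "{c}"] by simp
    have int: "integrable M (\<lambda>x. g x * indicator (F i -` {c}) (T x))" for c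
      by (rule integrable_mult_bounded[OF g, where B = 1])
        (use sets in \<open>auto simp: indicator_def intro!: measurable_compose[OF T borel_measurable_indicator]\<close>)
    have "g x * F i (T x) = (\<Sum>c\<in>range (F i). c * (g x * indicator (F i -` {c}) (T x)))" for x
      by (subst rep) (simp only: sum_distrib_left mult.left_commute)
    then have "(\<integral>x. g x * F i (T x) \<partial>M) = (\<integral>x. (\<Sum>c\<in>range (F i). c * (g x * indicator (F i -` {c}) (T x))) \<partial>M)"
      by (simp only:)
    also have "\<dots> = (\<Sum>c\<in>range (F i). \<integral>x. c * (g x * indicator (F i -` {c}) (T x)) \<partial>M)"
      by (intro Bochner_Integration.integral_sum integrable_mult_right int)
    also have "\<dots> = 0"
      by (rule sum.neutral) (simp add: z[OF sets])
    finally show ?thesis .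
  qed
  have "(\<lambda>i. \<integral>x. g x * F i (T x) \<partial>M) \<longlonglongrightarrow> (\<integral>x. g x * G (T x) \<partial>M)"
  proof (rule integral_dominated_convergence)
    show "integrable M (\<lambda>x. 2 * cmod (g x * G (T x)))"
      using gG by simp
    show "AE x in M. (\<lambda>i. g x * F i (T x)) \<longlonglongrightarrow> g x * G (T x)"
      by (intro AE_I2 tendsto_mult tendsto_const F(2))
    show "AE x in M. norm (g x * F i (T x)) \<le> 2 * cmod (g x * G (T x))" for i
    proof (rule AE_I2)
      fix x
      have "cmod (F i (T x)) \<le> 2 * cmod (G (T x))"
        using F(3)[of i "T x"] by (simp add: dist_norm)
      then have "cmod (g x) * cmod (F i (T x)) \<le> cmod (g x) * (2 * cmod (G (T x)))"
        by (rule mult_left_mono) simp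
      then show "norm (g x * F i (T x)) \<le> 2 * cmod (g x * G (T x))"
        by (simp add: norm_mult)
    qed
  qed measurable
  then show ?thesis
    unfolding zero by (simp add: LIMSEQ_const_iff)
qed

section \<open>The flow along all geodesics\<close>

abbreviation flow_measure :: "((real \<times> real) \<times> real) measure" where
  "flow_measure \<equiv> GH_measure \<Otimes>\<^sub>M lborel"

definition flow :: "(real \<times> real) \<times> real \<Rightarrow> complex" where
  "flow p = geod (fst (fst p)) (snd (fst p)) (snd p)"

interpretation flow: pair_sigma_finite GH_measure lborel
  by (intro pair_sigma_finite.intro sigma_finite_GH sigma_finite_lborel)

lemma measurable_fst_GH: "f \<in> borel_measurable GH_measure \<Longrightarrow> (\<lambda>p. f (fst p)) \<in> borel_measurable flow_measure"
  by (rule measurable_compose[OF measurable_fst])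

lemma flow_measurable [measurable]: "flow \<in> borel_measurable flow_measure"
proof -
  have [measurable]: "cis \<in> borel_measurable borel"
    by (intro borel_measurable_continuous_onI continuous_intros)
  have [measurable]: "(\<lambda>p. fst (fst p)) \<in> borel_measurable flow_measure" "(\<lambda>p. snd (fst p)) \<in> borel_measurable flow_measure"
    by (intro measurable_fst_GH borel_measurable_GH borel_measurable_continuous_onI continuous_intros)+
  show ?thesis
    unfolding flow_def[abs_def] geod_eq by measurable
qed

lemma flow_in_disk: "flow p \<in> disk"
  by (simp add: flow_def geod_in_disk)

lemma chord_measurable_GH [measurable]: "chord \<in> borel_measurable GH_measure"
  by (intro borel_measurable_GH) measurable

lemma bdf_sq_integral:
  "integrable lborel (\<lambda>t. (bdf (geod b a t))\<^sup>2)" "(\<integral>t. (bdf (geod b a t))\<^sup>2 \<partial>lborel) = (cmod (chord (b, a)))\<^sup>2 / 2"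
proof -
  have "path_value (\<lambda>_. 1) 1"
    using path_value_beta[of 0 0] by simp
  note pv = path_value_chord_param[OF this, of a]
  have i: "integrable lborel (\<lambda>t. Re (complex_of_real (chord_param a t * (1 - chord_param a t))))"
    using pv(1) by (intro integrable_Re) simp
  then have i': "integrable lborel (\<lambda>t. chord_param a t * (1 - chord_param a t))"
    by (simp only: Re_complex_of_real)
  have "complex_of_real (\<integral>t. chord_param a t * (1 - chord_param a t) \<partial>lborel) = complex_of_real (1 / 2)"
    using pv(2) unfolding mult_1 by (simp only: integral_complex_of_real) simp
  then have v: "(\<integral>t. chord_param a t * (1 - chord_param a t) \<partial>lborel) = 1 / 2"
    by (simp only: of_real_eq_iff)
  show "integrable lborel (\<lambda>t. (bdf (geod b a t))\<^sup>2)"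
    unfolding bdf_sq_geod by (intro integrable_mult_left i')
  show "(\<integral>t. (bdf (geod b a t))\<^sup>2 \<partial>lborel) = (cmod (chord (b, a)))\<^sup>2 / 2"
    unfolding bdf_sq_geod integral_mult_left_zero v by simp
qed

text \<open>Integrating x^2 along the geodesic gives |chord|^2 / 2, so two factors |chord|^2 meet;
  one is at most 4 and the other is integrable.\<close>

lemma weight_bdf_integrable:
  assumes [measurable]: "h \<in> borel_measurable GH_measure" and B: "\<And>y. cmod (h y) \<le> B * (cmod (chord y))\<^sup>2"
  shows "integrable flow_measure (\<lambda>p. h (fst p) * of_real ((bdf (flow p))\<^sup>2))"
proof (rule flow.Fubini_integrable)
  have [measurable]: "(\<lambda>p. h (fst p)) \<in> borel_measurable flow_measure"
    by (rule measurable_fst_GH) measurable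
  show "(\<lambda>p. h (fst p) * of_real ((bdf (flow p))\<^sup>2)) \<in> borel_measurable flow_measure"
    by measurable
  have eq: "(\<integral>t. norm (h (fst (y, t)) * of_real ((bdf (flow (y, t)))\<^sup>2)) \<partial>lborel) = cmod (h y) * ((cmod (chord y))\<^sup>2 / 2)" for y
    using bdf_sq_integral(2)[of "fst y" "snd y"] by (simp add: norm_mult flow_def norm_power)
  show "integrable GH_measure (\<lambda>y. \<integral>t. norm (h (fst (y, t)) * of_real ((bdf (flow (y, t)))\<^sup>2)) \<partial>lborel)"
    unfolding eq
  proof (rule Bochner_Integration.integrable_bound)
    show "integrable GH_measure (\<lambda>y. (2 * B) * (cmod (chord y))\<^sup>2)"
      using L2_integrable[OF chord_L2] by simp
    show "AE y in GH_measure. norm (cmod (h y) * ((cmod (chord y))\<^sup>2 / 2)) \<le> norm ((2 * B) * (cmod (chord y))\<^sup>2)"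
    proof (rule AE_I2)
      fix y
      have c4: "(cmod (chord y))\<^sup>2 \<le> 2\<^sup>2"
        by (intro power_mono norm_chord_le) simp
      have Bpos: "0 \<le> B * (cmod (chord y))\<^sup>2"
        using B[of y] norm_ge_zero[of "h y"] by linarith
      have "cmod (h y) * ((cmod (chord y))\<^sup>2 / 2) \<le> (B * (cmod (chord y))\<^sup>2) * (4 / 2)"
        using c4 Bpos by (intro mult_mono B) auto
      also have "\<dots> \<le> norm ((2 * B) * (cmod (chord y))\<^sup>2)"
        by simp
      finally show "norm (cmod (h y) * ((cmod (chord y))\<^sup>2 / 2)) \<le> norm ((2 * B) * (cmod (chord y))\<^sup>2)"
        by simp
    qed
  qed measurable
  show "AE y in GH_measure. integrable lborel (\<lambda>t. h (fst (y, t)) * of_real ((bdf (flow (y, t)))\<^sup>2))"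
    unfolding flow_def fst_conv snd_conv by (intro AE_I2 integrable_mult_right integrable_of_real bdf_sq_integral(1))
qed

lemma flow_integral:
  assumes "integrable flow_measure (\<lambda>p. h (fst p) * f (flow p))"
  shows "(\<integral>p. h (fst p) * f (flow p) \<partial>flow_measure) = (\<integral>y. h y * I0 f y \<partial>GH_measure)"
proof -
  have "(\<integral>p. h (fst p) * f (flow p) \<partial>flow_measure) = (\<integral>y. (\<integral>t. h (fst (y, t)) * f (flow (y, t)) \<partial>lborel) \<partial>GH_measure)"
    by (rule flow.integral_fst'[OF assms, symmetric])
  also have "\<dots> = (\<integral>y. h y * I0 f y \<partial>GH_measure)"
    by (rule Bochner_Integration.integral_cong) (auto simp: flow_def I0_def split_def)
  finally show ?thesis .
qed

text \<open>Fubini turns the Klein moments of the push-forward of h x^2 into pairings of h with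
  \<open>ebasis_even\<close> at pairs whose second index is negative. These pairings therefore
  determine the push-forward.\<close>

lemma weight_monomial:
  assumes h: "h \<in> borel_measurable GH_measure" "\<And>y. cmod (h y) \<le> B * (cmod (chord y))\<^sup>2"
  shows "(\<integral>p. h (fst p) * of_real ((bdf (flow p))\<^sup>2) * (klein (flow p) ^ m * cnj (klein (flow p)) ^ n) \<partial>flow_measure)
    = - (1/2) * (\<Sum>i\<le>n. complex_of_real (ibp_coeff i m n) *
        (\<integral>y. h y * ebasis_even (int m - int n + int i) (- 1 - int i) y \<partial>GH_measure))"
proof -
  have "integrable flow_measure (\<lambda>p. h (fst p) * of_real ((bdf (flow p))\<^sup>2) * (klein (flow p) ^ m * cnj (klein (flow p)) ^ n))"
  proof (rule integrable_mult_bounded[OF weight_bdf_integrable[OF h], where B = 1])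
    show "(\<lambda>p. klein (flow p) ^ m * cnj (klein (flow p)) ^ n) \<in> borel_measurable flow_measure"
      by measurable
  qed (rule norm_klein_powers_le)
  then have i: "integrable flow_measure (\<lambda>p. h (fst p) * klein_monomial m n (flow p))"
    by (simp add: klein_monomial_def mult.assoc)
  have hL: "(\<lambda>y. cnj (h y)) \<in> L2_GH"
  proof -
    have "integrable GH_measure (\<lambda>y. (cmod (h y))\<^sup>2)"
    proof (rule Bochner_Integration.integrable_bound)
      show "integrable GH_measure (\<lambda>y. (B\<^sup>2 * 4) * (cmod (chord y))\<^sup>2)"
        using L2_integrable[OF chord_L2] by simp
      show "AE y in GH_measure. norm ((cmod (h y))\<^sup>2) \<le> norm ((B\<^sup>2 * 4) * (cmod (chord y))\<^sup>2)"
      proof (rule AE_I2)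
        fix y
        have c4: "(cmod (chord y))\<^sup>2 \<le> 2\<^sup>2"
          by (intro power_mono norm_chord_le) simp
        have "(cmod (h y))\<^sup>2 \<le> (B * (cmod (chord y))\<^sup>2)\<^sup>2"
          by (intro power_mono h(2)) simp
        also have "\<dots> = (B\<^sup>2 * (cmod (chord y))\<^sup>2) * (cmod (chord y))\<^sup>2"
          by (simp add: power2_eq_square)
        also have "\<dots> \<le> (B\<^sup>2 * 4) * (cmod (chord y))\<^sup>2"
          using c4 by (intro mult_right_mono mult_left_mono) auto
        finally show "norm ((cmod (h y))\<^sup>2) \<le> norm ((B\<^sup>2 * 4) * (cmod (chord y))\<^sup>2)"
          by simp
      qed
    qed (use h(1) in measurable)
    then show ?thesis
      using h(1) by (simp add: L2_GH_def borel_measurable_cnj)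
  qed
  have I: "integrable GH_measure (\<lambda>y. h y * ebasis_even j k y)" for j k
    using L2_mult_integrable[OF L2_cnj[OF hL] L2_ebasis_even] by simp
  have "(\<integral>p. h (fst p) * of_real ((bdf (flow p))\<^sup>2) * (klein (flow p) ^ m * cnj (klein (flow p)) ^ n) \<partial>flow_measure)
      = (\<integral>y. h y * I0 (klein_monomial m n) y \<partial>GH_measure)"
    unfolding flow_integral[OF i, symmetric] by (simp add: klein_monomial_def mult.assoc)
  also have "\<dots> = (\<integral>y. - (1/2) * (\<Sum>i\<le>n. complex_of_real (ibp_coeff i m n) * (h y * ebasis_even (int m - int n + int i) (- 1 - int i) y)) \<partial>GH_measure)"
  proof (rule Bochner_Integration.integral_cong)
    fix y
    show "h y * I0 (klein_monomial m n) y
        = - (1/2) * (\<Sum>i\<le>n. complex_of_real (ibp_coeff i m n) * (h y * ebasis_even (int m - int n + int i) (- 1 - int i) y))"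
      using I0_klein_monomial(2)[of m n "fst y" "snd y"] by (simp add: sum_distrib_left mult.left_commute)
  qed simp
  also have "\<dots> = - (1/2) * (\<integral>y. (\<Sum>i\<le>n. complex_of_real (ibp_coeff i m n) * (h y * ebasis_even (int m - int n + int i) (- 1 - int i) y)) \<partial>GH_measure)"
    by (rule integral_mult_right_zero)
  also have "(\<integral>y. (\<Sum>i\<le>n. complex_of_real (ibp_coeff i m n) * (h y * ebasis_even (int m - int n + int i) (- 1 - int i) y)) \<partial>GH_measure)
      = (\<Sum>i\<le>n. complex_of_real (ibp_coeff i m n) * (\<integral>y. h y * ebasis_even (int m - int n + int i) (- 1 - int i) y \<partial>GH_measure))"
    by (subst Bochner_Integration.integral_sum) (auto intro!: integrable_mult_right I)
  finally show ?thesis .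
qed

text \<open>The factor \<open>chord\<close> of \<open>ebasis\<close> is expanded as zp - zm, which
  leaves two integrals of the type \<open>integral_chord_ends\<close>.\<close>

lemma integral_chord_ebasis:
  "integrable GH_measure (\<lambda>y. of_real ((cmod (chord y))\<^sup>2) * ebasis j k y)"
  "(\<integral>y. of_real ((cmod (chord y))\<^sup>2) * ebasis j k y \<partial>GH_measure)
    = (if j = -1 \<and> k = 0 then 8 * pi\<^sup>2 else 0) - (if j = 0 \<and> k = -1 then 8 * pi\<^sup>2 else 0)"
proof -
  have eq: "of_real ((cmod (chord y))\<^sup>2) * ebasis j k y
      = complex_of_real ((cmod (chord y))\<^sup>2) * zp y powi (j + 1) * zm y powi k
      - complex_of_real ((cmod (chord y))\<^sup>2) * zp y powi j * zm y powi (k + 1)" for y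
    unfolding ebasis_def power_int_add_1'[OF disjI1[OF zp_nonzero]] power_int_add_1'[OF disjI1[OF zm_nonzero]]
    by (simp add: chord_def[of y, THEN arg_cong[where f = "\<lambda>c. c * _"]] chord_def algebra_simps)
  show "integrable GH_measure (\<lambda>y. of_real ((cmod (chord y))\<^sup>2) * ebasis j k y)"
    unfolding eq by (intro Bochner_Integration.integrable_diff integral_chord_ends)
  have "j + 1 = 0 \<and> k = 0 \<longleftrightarrow> j = -1 \<and> k = 0" "j = 0 \<and> k + 1 = 0 \<longleftrightarrow> j = 0 \<and> k = -1"
    by auto
  then show "(\<integral>y. of_real ((cmod (chord y))\<^sup>2) * ebasis j k y \<partial>GH_measure)
    = (if j = -1 \<and> k = 0 then 8 * pi\<^sup>2 else 0) - (if j = 0 \<and> k = -1 then 8 * pi\<^sup>2 else 0)"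
    unfolding eq by (subst Bochner_Integration.integral_diff[OF integral_chord_ends(1) integral_chord_ends(1)])
      (simp only: integral_chord_ends(2) of_real_diff)
qed

lemma integral_chord_ebasis_even:
  "(\<integral>y. of_real ((cmod (chord y))\<^sup>2) * ebasis_even j (- 1 - int i) y \<partial>GH_measure)
    = (if j = 0 \<and> i = 0 then - (16 * pi\<^sup>2) else 0)"
proof -
  have "(\<integral>y. of_real ((cmod (chord y))\<^sup>2) * ebasis_even j (- 1 - int i) y \<partial>GH_measure)
      = (\<integral>y. of_real ((cmod (chord y))\<^sup>2) * ebasis j (- 1 - int i) y \<partial>GH_measure)
      - (\<integral>y. of_real ((cmod (chord y))\<^sup>2) * ebasis (- 1 - int i) j y \<partial>GH_measure)"
    unfolding ebasis_even_def right_diff_distrib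
    by (rule Bochner_Integration.integral_diff[OF integral_chord_ebasis(1) integral_chord_ebasis(1)])
  then show ?thesis
    unfolding integral_chord_ebasis(2) by auto
qed

text \<open>A Santalo type formula, proved by comparing moments. For the weight |chord|^2 only the
  pair (0, -1) contributes, so both sides have moment 8 pi^2 / (n + 1) for equal exponents n and 0
  otherwise.\<close>

lemma push_sets:
  assumes E: "E \<in> sets borel"
  shows "(\<integral>p. of_real ((cmod (chord (fst p)))\<^sup>2) * of_real ((bdf (flow p))\<^sup>2) * indicator E (klein (flow p)) \<partial>flow_measure)
    = (\<integral>z. complex_of_real (8 * pi) * of_real ((bdf z) ^ 3) * indicator E (klein z) \<partial>hyp_area)"
proof -
  have hm: "(\<lambda>y. complex_of_real ((cmod (chord y))\<^sup>2)) \<in> borel_measurable GH_measure"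
    by measurable
  have hB: "cmod (complex_of_real ((cmod (chord y))\<^sup>2)) \<le> 1 * (cmod (chord y))\<^sup>2" for y
    by (simp add: norm_power)
  have f1: "integrable flow_measure (\<lambda>p. of_real ((cmod (chord (fst p)))\<^sup>2) * of_real ((bdf (flow p))\<^sup>2) :: complex)"
    by (rule weight_bdf_integrable[OF hm hB])
  have f2: "integrable hyp_area (\<lambda>z. complex_of_real (8 * pi) * of_real ((bdf z) ^ 3))"
    using klein_moment(1)[of 0 0] by (simp del: of_real_power)
  show ?thesis
  proof (rule moments_determine_plane[OF f1 f2 _ _ _ _ _ E])
    show "klein \<in> borel_measurable hyp_area"
      by (intro borel_measurable_hyp) measurable
    fix a b :: nat
    have "(\<integral>p. of_real ((cmod (chord (fst p)))\<^sup>2) * of_real ((bdf (flow p))\<^sup>2) * (klein (flow p) ^ a * cnj (klein (flow p)) ^ b) \<partial>flow_measure)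
        = - (1/2) * (\<Sum>i\<le>b. complex_of_real (ibp_coeff i a b) * (if int a - int b + int i = 0 \<and> i = 0 then - (16 * pi\<^sup>2) else 0))"
      unfolding weight_monomial[OF hm hB] integral_chord_ebasis_even ..
    also have "(\<Sum>i\<le>b. complex_of_real (ibp_coeff i a b) * (if int a - int b + int i = 0 \<and> i = 0 then - (16 * pi\<^sup>2) else 0))
        = (\<Sum>i\<le>b. if i = 0 then (if a = b then complex_of_real (ibp_coeff 0 a b) * (- (16 * pi\<^sup>2)) else 0) else 0)"
      by (rule sum.cong) auto
    also have "\<dots> = (if a = b then complex_of_real (ibp_coeff 0 a b) * (- (16 * pi\<^sup>2)) else 0)"
      by (subst sum.delta) auto
    \<comment> \<open>\<open>ibp_coeff 0 a b\<close> is 1 / (a + 1), and - 1/2 times - 16 pi^2 is 8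
      pi times pi.\<close>
    also have "- (1/2) * \<dots> = complex_of_real (8 * pi) * (if a = b then pi / of_nat (Suc b) else 0)"
      by (cases "a = b") (simp_all add: power2_eq_square field_simps del: of_nat_Suc)
    also have "\<dots> = (\<integral>z. complex_of_real (8 * pi) * (of_real ((bdf z) ^ 3) * (klein z ^ a * cnj (klein z) ^ b)) \<partial>hyp_area)"
      unfolding integral_mult_right_zero klein_moment(2) by simp
    finally show "(\<integral>p. of_real ((cmod (chord (fst p)))\<^sup>2) * of_real ((bdf (flow p))\<^sup>2) * (klein (flow p) ^ a * cnj (klein (flow p)) ^ b) \<partial>flow_measure)
      = (\<integral>z. complex_of_real (8 * pi) * of_real ((bdf z) ^ 3) * (klein z ^ a * cnj (klein z) ^ b) \<partial>hyp_area)"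
      by (simp add: mult.assoc)
  qed (simp_all add: norm_klein_le)
qed

text \<open>The same identity of push-forward measures for nonnegative integrands of possibly
  infinite integral, which is the form that establishes integrability in
  \<open>I0_orthogonal\<close>.\<close>

lemma push_nn_integral:
  assumes G [measurable]: "G \<in> borel_measurable borel"
  shows "(\<integral>\<^sup>+p. ennreal ((cmod (chord (fst p)))\<^sup>2 * (bdf (flow p))\<^sup>2) * G (klein (flow p)) \<partial>flow_measure)
    = (\<integral>\<^sup>+z. ennreal (8 * pi * (bdf z) ^ 3) * G (klein z) \<partial>hyp_area)"
proof -
  define w1 where "w1 p = (cmod (chord (fst p)))\<^sup>2 * (bdf (flow p))\<^sup>2" for p
  define w2 where "w2 z = 8 * pi * (bdf z) ^ 3" for z
  have [measurable]: "(\<lambda>p. chord (fst p)) \<in> borel_measurable flow_measure"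
    by (rule measurable_fst_GH) measurable
  have w1m [measurable]: "w1 \<in> borel_measurable flow_measure"
    unfolding w1_def by measurable
  have w2b: "w2 \<in> borel_measurable borel"
    unfolding w2_def by measurable
  then have w2m [measurable]: "w2 \<in> borel_measurable hyp_area"
    by (rule borel_measurable_hyp)
  have k1 [measurable]: "(\<lambda>p. klein (flow p)) \<in> borel_measurable flow_measure"
    by measurable
  have k2 [measurable]: "klein \<in> borel_measurable hyp_area"
    by (intro borel_measurable_hyp) measurable
  have w1n: "w1 p \<ge> 0" for p
    by (simp add: w1_def)
  have w2n: "w2 z \<ge> 0" if "z \<in> disk" for z
    using bdf_pos[OF that] by (simp add: w2_def)
  have i1: "integrable flow_measure (\<lambda>p. complex_of_real (w1 p))"
    using weight_bdf_integrable[of "\<lambda>y. complex_of_real ((cmod (chord y))\<^sup>2)" 1]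
    by (simp add: w1_def norm_power del: of_real_power)
  have i2: "integrable hyp_area (\<lambda>z. complex_of_real (w2 z))"
    using klein_moment(1)[of 0 0] by (simp add: w2_def del: of_real_power)
  have r1: "integrable flow_measure (\<lambda>p. w1 p * indicator E (klein (flow p)))" if [measurable]: "E \<in> sets borel" for E
    by (rule Bochner_Integration.integrable_bound[OF integrable_Re[OF i1]]) (auto simp: indicator_def)
  have r2: "integrable hyp_area (\<lambda>z. w2 z * indicator E (klein z))" if [measurable]: "E \<in> sets borel" for E
    by (rule Bochner_Integration.integrable_bound[OF integrable_Re[OF i2]]) (auto simp: indicator_def)
  have eqE: "(\<integral>p. w1 p * indicator E (klein (flow p)) \<partial>flow_measure) = (\<integral>z. w2 z * indicator E (klein z) \<partial>hyp_area)"
    if E: "E \<in> sets borel" for E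
  proof -
    have "complex_of_real (\<integral>p. w1 p * indicator E (klein (flow p)) \<partial>flow_measure)
        = (\<integral>p. of_real ((cmod (chord (fst p)))\<^sup>2) * of_real ((bdf (flow p))\<^sup>2) * indicator E (klein (flow p)) \<partial>flow_measure)"
      unfolding integral_complex_of_real[symmetric] w1_def
      by (rule Bochner_Integration.integral_cong) (simp_all add: indicator_def)
    also have "\<dots> = (\<integral>z. complex_of_real (8 * pi) * of_real ((bdf z) ^ 3) * indicator E (klein z) \<partial>hyp_area)"
      by (rule push_sets[OF E])
    also have "\<dots> = complex_of_real (\<integral>z. w2 z * indicator E (klein z) \<partial>hyp_area)"
      unfolding integral_complex_of_real[symmetric] w2_def
      by (rule Bochner_Integration.integral_cong) (simp_all add: indicator_def)
    finally show ?thesis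
      by (simp only: of_real_eq_iff)
  qed
  have D: "distr (density flow_measure (\<lambda>p. ennreal (w1 p))) borel (\<lambda>p. klein (flow p))
      = distr (density hyp_area (\<lambda>z. ennreal (w2 z))) borel klein" (is "?D1 = ?D2")
  proof (rule measure_eqI)
    fix E assume "E \<in> sets ?D1"
    then have E [measurable]: "E \<in> sets borel" by simp
    have "emeasure ?D1 E = (\<integral>\<^sup>+w. indicator E w \<partial>?D1)"
      using E by simp
    also have "\<dots> = (\<integral>\<^sup>+p. ennreal (w1 p) * indicator E (klein (flow p)) \<partial>flow_measure)"
      by (subst nn_integral_distr, simp, simp, subst nn_integral_density) simp_all
    also have "\<dots> = (\<integral>\<^sup>+p. ennreal (w1 p * indicator E (klein (flow p))) \<partial>flow_measure)"
      by (rule nn_integral_cong) (simp add: indicator_def)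
    also have "\<dots> = ennreal (\<integral>p. w1 p * indicator E (klein (flow p)) \<partial>flow_measure)"
      by (rule nn_integral_eq_integral[OF r1[OF E]]) (simp add: w1n)
    also have "\<dots> = ennreal (\<integral>z. w2 z * indicator E (klein z) \<partial>hyp_area)"
      by (simp only: eqE[OF E])
    also have "\<dots> = (\<integral>\<^sup>+z. ennreal (w2 z * indicator E (klein z)) \<partial>hyp_area)"
      by (rule nn_integral_eq_integral[OF r2[OF E], symmetric]) (auto intro!: AE_I2 simp: hyp_area_space w2n)
    also have "\<dots> = (\<integral>\<^sup>+z. ennreal (w2 z) * indicator E (klein z) \<partial>hyp_area)"
      by (rule nn_integral_cong) (simp add: indicator_def)
    also have "\<dots> = (\<integral>\<^sup>+w. indicator E w \<partial>?D2)"
      by (subst nn_integral_distr, simp, simp, subst nn_integral_density) simp_all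
    also have "\<dots> = emeasure ?D2 E"
      using E by simp
    finally show "emeasure ?D1 E = emeasure ?D2 E" .
  qed simp
  have "(\<integral>\<^sup>+p. ennreal (w1 p) * G (klein (flow p)) \<partial>flow_measure) = (\<integral>\<^sup>+w. G w \<partial>?D1)"
    by (subst nn_integral_distr, simp, simp, subst nn_integral_density) simp_all
  also have "\<dots> = (\<integral>\<^sup>+z. ennreal (w2 z) * G (klein z) \<partial>hyp_area)"
    unfolding D by (subst nn_integral_distr, simp, simp, subst nn_integral_density) simp_all
  finally show ?thesis
    unfolding w1_def w2_def .
qed

subsection \<open>Orthogonality of the range of the X-ray transform\<close>

text \<open>Extending u by 0 outside the disk gives a Borel function on the plane, which can be
  composed with the flow and with \<open>unklein\<close>. The finiteness is where the exponent 1/2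
  is used.\<close>

lemma xhalf_borel:
  assumes "f \<in> xhalf_L2"
  obtains f' where "f' \<in> borel_measurable borel" "\<And>z. z \<in> disk \<Longrightarrow> f' z = f z"
    "(\<integral>\<^sup>+z. ennreal (8 * pi * (bdf z * cmod (f' z))) \<partial>hyp_area) < \<infinity>"
proof -
  obtain u where u: "u \<in> L2_disk" and f: "f = (\<lambda>z. complex_of_real (sqrt (bdf z)) * u z)"
    using assms unfolding xhalf_L2_def by blast
  define u' where "u' z = indicator disk z *\<^sub>R u z" for z
  define f' where "f' z = complex_of_real (sqrt (bdf z)) * u' z" for z
  have um: "u \<in> borel_measurable hyp_area" and ui: "integrable hyp_area (\<lambda>z. (cmod (u z))\<^sup>2)"
    using u by (auto simp: L2_disk_def)
  have "u \<in> borel_measurable (restrict_space lborel disk)"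
    using um unfolding hyp_area_def by simp
  then have u'm [measurable]: "u' \<in> borel_measurable borel"
    unfolding u'_def by (subst (asm) borel_measurable_restrict_space_iff) simp_all
  have "f' \<in> borel_measurable borel"
    unfolding f'_def by measurable
  moreover have "f' z = f z" if "z \<in> disk" for z
    using that by (simp add: f'_def f u'_def)
  moreover have "(\<integral>\<^sup>+z. ennreal (8 * pi * (bdf z * cmod (f' z))) \<partial>hyp_area) < \<infinity>"
  proof -
    have i3: "integrable hyp_area (\<lambda>z. (bdf z) ^ 3)"
      using integrable_Re[OF klein_moment(1)[of 0 0]] by (simp flip: of_real_power)
    have i: "integrable hyp_area (\<lambda>z. 8 * pi * ((bdf z) ^ 3 + (cmod (u z))\<^sup>2))"
      by (intro integrable_mult_right Bochner_Integration.integrable_add i3 ui)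
    have "(\<integral>\<^sup>+z. ennreal (8 * pi * (bdf z * cmod (f' z))) \<partial>hyp_area)
        \<le> (\<integral>\<^sup>+z. ennreal (norm (8 * pi * ((bdf z) ^ 3 + (cmod (u z))\<^sup>2))) \<partial>hyp_area)"
    proof (rule nn_integral_mono)
      fix z assume "z \<in> space hyp_area"
      then have z: "z \<in> disk" by (simp add: hyp_area_space)
      define s where "s = sqrt (bdf z)"
      have s: "s \<ge> 0" "bdf z = s\<^sup>2"
        using bdf_pos[OF z] by (simp_all add: s_def)
      have "cmod (f' z) = s * cmod (u z)"
        using z s(1) by (simp add: f'_def u'_def norm_mult s_def)
      then have "bdf z * cmod (f' z) = s ^ 3 * cmod (u z)"
        by (simp add: s(2) power2_eq_square power3_eq_cube)
      \<comment> \<open>The left side is x^(3/2) |u|; the elementary inequality 2 a b \<le> a^2 +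
        b^2 splits it into the integrable functions x^3 and |u|^2.\<close>
      also have "\<dots> \<le> (s ^ 3)\<^sup>2 + (cmod (u z))\<^sup>2"
        using sum_squares_bound[of "s ^ 3" "cmod (u z)"]
          mult_nonneg_nonneg[OF zero_le_power[OF s(1), of 3] norm_ge_zero[of "u z"]]
        by linarith
      also have "(s ^ 3)\<^sup>2 = (bdf z) ^ 3"
        unfolding s(2) by (simp flip: power_mult)
      finally have "8 * pi * (bdf z * cmod (f' z)) \<le> 8 * pi * ((bdf z) ^ 3 + (cmod (u z))\<^sup>2)"
        by (intro mult_left_mono) auto
      also have "\<dots> \<le> norm (8 * pi * ((bdf z) ^ 3 + (cmod (u z))\<^sup>2))"
        by simp
      finally show "ennreal (8 * pi * (bdf z * cmod (f' z))) \<le> ennreal (norm (8 * pi * ((bdf z) ^ 3 + (cmod (u z))\<^sup>2)))"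
        by (rule ennreal_leI)
    qed
    also have "\<dots> < \<infinity>"
      using i by (simp only: integrable_iff_bounded)
    finally show ?thesis .
  qed
  ultimately show ?thesis
    using that by blast
qed

text \<open>The hypotheses make all Klein moments of the push-forward of h x^2 vanish, so this
  push-forward is the zero measure and annihilates f / x^2. The bound by |chord|^2 supplies the
  absolute integrability required by Fubini.\<close>

lemma I0_orthogonal:
  assumes f: "f \<in> xhalf_L2" and h: "h \<in> borel_measurable GH_measure" "\<And>y. cmod (h y) \<le> B * (cmod (chord y))\<^sup>2"
    and z: "\<And>j i. (\<integral>y. h y * ebasis_even j (- 1 - int i) y \<partial>GH_measure) = 0"
  shows "(\<integral>y. h y * I0 f y \<partial>GH_measure) = 0"
proof -
  obtain f' where f'm [measurable]: "f' \<in> borel_measurable borel" and f'f: "\<And>z. z \<in> disk \<Longrightarrow> f' z = f z"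
    and fin: "(\<integral>\<^sup>+z. ennreal (8 * pi * (bdf z * cmod (f' z))) \<partial>hyp_area) < \<infinity>"
    using xhalf_borel[OF f] by blast
  have hfm [measurable]: "(\<lambda>p. h (fst p)) \<in> borel_measurable flow_measure"
    by (rule measurable_fst_GH[OF h(1)])
  have cfm [measurable]: "(\<lambda>p. chord (fst p)) \<in> borel_measurable flow_measure"
    by (rule measurable_fst_GH) measurable
  define g where "g p = h (fst p) * of_real ((bdf (flow p))\<^sup>2)" for p
  \<comment> \<open>Division by x^2 compensates the weight that was inserted to obtain polynomial
    integrands.\<close>
  define G where "G w = f' (unklein w) / of_real ((bdf (unklein w))\<^sup>2)" for w
  have Gm [measurable]: "G \<in> borel_measurable borel"
    unfolding G_def by measurable
  have gi: "integrable flow_measure g"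
    unfolding g_def by (rule weight_bdf_integrable[OF h])
  have bn: "bdf (flow p) \<noteq> 0" for p
    using bdf_pos[OF flow_in_disk, of p] by simp
  have gG: "g p * G (klein (flow p)) = h (fst p) * f (flow p)" for p
    unfolding g_def G_def unklein_klein[OF flow_in_disk] using bn[of p] f'f[OF flow_in_disk] by simp
  have chord_int: "(\<integral>\<^sup>+p. ennreal ((cmod (chord (fst p)))\<^sup>2 * cmod (f' (flow p))) \<partial>flow_measure) < \<infinity>"
  proof -
    have "(\<integral>\<^sup>+p. ennreal ((cmod (chord (fst p)))\<^sup>2 * cmod (f' (flow p))) \<partial>flow_measure)
        = (\<integral>\<^sup>+p. ennreal ((cmod (chord (fst p)))\<^sup>2 * (bdf (flow p))\<^sup>2) * ennreal (cmod (G (klein (flow p)))) \<partial>flow_measure)"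
    proof (rule nn_integral_cong)
      fix p
      have "(cmod (chord (fst p)))\<^sup>2 * cmod (f' (flow p)) = (cmod (chord (fst p)))\<^sup>2 * (bdf (flow p))\<^sup>2 * cmod (G (klein (flow p)))"
        unfolding G_def unklein_klein[OF flow_in_disk] using bn[of p] by (simp add: norm_divide norm_power)
      then show "ennreal ((cmod (chord (fst p)))\<^sup>2 * cmod (f' (flow p)))
          = ennreal ((cmod (chord (fst p)))\<^sup>2 * (bdf (flow p))\<^sup>2) * ennreal (cmod (G (klein (flow p))))"
        by (simp add: ennreal_mult mult.assoc)
    qed
    also have "\<dots> = (\<integral>\<^sup>+z. ennreal (8 * pi * (bdf z) ^ 3) * ennreal (cmod (G (klein z))) \<partial>hyp_area)"
      by (rule push_nn_integral) measurable
    also have "\<dots> = (\<integral>\<^sup>+z. ennreal (8 * pi * (bdf z * cmod (f' z))) \<partial>hyp_area)"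
    proof (rule nn_integral_cong)
      fix z assume "z \<in> space hyp_area"
      then have z: "z \<in> disk" by (simp add: hyp_area_space)
      have b: "bdf z > 0" by (rule bdf_pos[OF z])
      have "8 * pi * (bdf z) ^ 3 * cmod (G (klein z)) = 8 * pi * (bdf z * cmod (f' z))"
        unfolding G_def unklein_klein[OF z] using b by (simp add: norm_divide norm_mult power2_eq_square power3_eq_cube)
      then show "ennreal (8 * pi * (bdf z) ^ 3) * ennreal (cmod (G (klein z))) = ennreal (8 * pi * (bdf z * cmod (f' z)))"
        using b by (simp flip: ennreal_mult')
    qed
    finally show ?thesis
      using fin by simp
  qed
  have int: "integrable flow_measure (\<lambda>p. g p * G (klein (flow p)))"
  proof (rule Bochner_Integration.integrable_bound)
    show "integrable flow_measure (\<lambda>p. B * ((cmod (chord (fst p)))\<^sup>2 * cmod (f' (flow p))))"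
      using chord_int by (intro integrable_mult_right integrableI_bounded) simp_all
    show "(\<lambda>p. g p * G (klein (flow p))) \<in> borel_measurable flow_measure"
      unfolding g_def by measurable
    show "AE p in flow_measure. norm (g p * G (klein (flow p))) \<le> norm (B * ((cmod (chord (fst p)))\<^sup>2 * cmod (f' (flow p))))"
    proof (rule AE_I2)
      fix p
      have "norm (g p * G (klein (flow p))) = cmod (h (fst p)) * cmod (f' (flow p))"
        unfolding gG f'f[OF flow_in_disk] by (simp add: norm_mult)
      also have "\<dots> \<le> (B * (cmod (chord (fst p)))\<^sup>2) * cmod (f' (flow p))"
        by (intro mult_right_mono h(2)) simp
      also have "\<dots> \<le> norm (B * ((cmod (chord (fst p)))\<^sup>2 * cmod (f' (flow p))))"
        by (simp add: mult.assoc)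
      finally show "norm (g p * G (klein (flow p))) \<le> norm (B * ((cmod (chord (fst p)))\<^sup>2 * cmod (f' (flow p))))" .
    qed
  qed
  have "(\<integral>p. g p * indicator E (klein (flow p)) \<partial>flow_measure) = 0" if E: "E \<in> sets borel" for E
  proof -
    have "(\<integral>p. g p * (klein (flow p) ^ a * cnj (klein (flow p)) ^ b) \<partial>flow_measure) = 0" for a b
      unfolding g_def weight_monomial[OF h] z by simp
    then have "(\<integral>p. g p * indicator E (klein (flow p)) \<partial>flow_measure) = (\<integral>p. 0 * indicator E (klein (flow p)) \<partial>flow_measure)"
      by (intro moments_determine_plane[OF gi _ _ _ _ _ _ E]) (simp_all add: norm_klein_le)
    then show ?thesis by simp
  qed
  then have "(\<integral>p. g p * G (klein (flow p)) \<partial>flow_measure) = 0"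
    by (intro integral_comp_zero[OF gi _ _ Gm int]) simp_all
  then have zero: "(\<integral>p. h (fst p) * f (flow p) \<partial>flow_measure) = 0"
    unfolding gG .
  show ?thesis
    unfolding flow_integral[OF int[unfolded gG], symmetric] by (rule zero)
qed

text \<open>\<open>SA\<close> reverses the geodesic. Its Klein image passes the midpoint of the
  chord at time - ln (1 + a^2) / 2 and not at 0, hence the shift; the proof compares Klein images,
  where reversal is s to 1 - s.\<close>

lemma geod_SA: "geod (fst (SA (b, a))) (snd (SA (b, a))) t = geod b a (- ln (1 + a\<^sup>2) - t)"
proof -
  obtain b' where SA: "SA (b, a) = (b', - a)"
    by (simp add: SA_def)
  have pos: "1 + a\<^sup>2 > 0"
    by (simp add: add_pos_nonneg)
  define Q where "Q = (1 + a\<^sup>2) * (exp t)\<^sup>2"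
  have Q: "Q > 0"
    using pos by (simp add: Q_def)
  have eq: "(1 + a\<^sup>2) * (exp (- ln (1 + a\<^sup>2) - t))\<^sup>2 = 1 / Q"
    using pos by (simp add: Q_def exp_diff exp_minus power_divide divide_inverse power2_eq_square)
  have c1: "chord_param a (- ln (1 + a\<^sup>2) - t) = 1 - chord_param a t"
    unfolding chord_param_def eq Q_def[symmetric] using Q by (simp add: field_simps)
  have c2: "chord_param (- a) t = chord_param a t"
    by (simp add: chord_param_def)
  have c3: "zm (b', - a) = zp (b, a)" "chord (b', - a) = - chord (b, a)"
    unfolding SA[symmetric] by (simp_all add: zm_SA zp_SA chord_def)
  have "klein (geod b' (- a) t) = klein (geod b a (- ln (1 + a\<^sup>2) - t))"
    unfolding klein_geod c1 c2 c3 by (simp add: chord_def algebra_simps)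
  then have "geod b' (- a) t = geod b a (- ln (1 + a\<^sup>2) - t)"
    using unklein_klein[OF geod_in_disk] by metis
  then show ?thesis
    by (simp add: SA)
qed

lemma I0_SA: "I0 f (SA y) = I0 f y"
proof (cases y)
  case (Pair b a)
  have I0: "I0 f x = (\<integral>t. f (geod (fst x) (snd x) t) \<partial>lborel)" for x
    by (simp add: I0_def split_def)
  have "I0 f (SA y) = (\<integral>t. f (geod b a (- ln (1 + a\<^sup>2) + (- 1) * t)) \<partial>lborel)"
    unfolding I0 Pair geod_SA by simp
  also have "\<dots> = (\<integral>t. f (geod b a t) \<partial>lborel)"
    using lborel_integral_real_affine[of "- 1" "\<lambda>t. f (geod b a t)" "- ln (1 + a\<^sup>2)"] by simp
  finally show ?thesis
    unfolding I0 Pair by simp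
qed

lemma I0_even: "I0 f \<in> L2_GH \<Longrightarrow> I0 f \<in> spectral UNIV"
  unfolding L2_plus_eq_spectral[symmetric] by (simp add: L2_plus_def I0_SA)

text \<open>The polynomial zp^m zm^n - zp^n zm^m vanishes for zp = zm, which yields a second factor
  \<open>chord\<close>; it is split so that each difference of powers is at most its exponent times
  |chord|.\<close>

lemma norm_ebasis_even_le:
  assumes "j \<ge> 0" "k \<ge> 0"
  shows "cmod (ebasis_even j k y) \<le> of_int (j + k) * (cmod (chord y))\<^sup>2"
proof -
  obtain m n where jk: "j = int m" "k = int n"
    using assms nonneg_int_cases by metis
  have "ebasis_even j k y = chord y * (zp y ^ m * (zm y ^ n - zp y ^ n) + zp y ^ n * (zp y ^ m - zm y ^ m))"
    by (simp add: ebasis_even_def ebasis_def jk algebra_simps)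
  also have "cmod \<dots> \<le> cmod (chord y) * (real n * cmod (chord y) + real m * cmod (chord y))"
  proof -
    have "cmod (zm y ^ n - zp y ^ n) \<le> real n * cmod (chord y)"
      using norm_power_diff[of "zm y" "zp y" n] by (simp add: chord_def norm_minus_commute)
    moreover have "cmod (zp y ^ m - zm y ^ m) \<le> real m * cmod (chord y)"
      using norm_power_diff[of "zp y" "zm y" m] by (simp add: chord_def)
    moreover have "cmod (zp y ^ m * (zm y ^ n - zp y ^ n) + zp y ^ n * (zp y ^ m - zm y ^ m))
        \<le> cmod (zm y ^ n - zp y ^ n) + cmod (zp y ^ m - zm y ^ m)"
      using norm_triangle_ineq[of "zp y ^ m * (zm y ^ n - zp y ^ n)" "zp y ^ n * (zp y ^ m - zm y ^ m)"]
      by (simp add: norm_mult norm_power)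
    ultimately show ?thesis
      unfolding norm_mult[of "chord y"] by (intro mult_left_mono) auto
  qed
  finally show ?thesis
    by (simp add: jk power2_eq_square algebra_simps)
qed

text \<open>The conjugate of \<open>ebasis_even j k\<close> is admissible in
  \<open>I0_orthogonal\<close>: a pair of nonnegative indices is never of the form (l, -1 - i) or
  its exchange. Evenness of \<open>I0 f\<close> turns the pairing with the difference into twice a
  single coefficient.\<close>

lemma I0_inner_nonneg:
  assumes f: "f \<in> xhalf_L2" and L: "I0 f \<in> L2_GH" and jk: "j \<ge> 0" "k \<ge> 0"
  shows "inner_GH (I0 f) (ebasis j k) = 0"
proof -
  note even = I0_even[OF L]
  have "(\<integral>y. cnj (ebasis_even j k y) * I0 f y \<partial>GH_measure) = 0"
  proof (rule I0_orthogonal[OF f])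
    show "(\<lambda>y. cnj (ebasis_even j k y)) \<in> borel_measurable GH_measure"
      using L2_cnj[OF L2_ebasis_even] by (rule L2_measurable)
    show "cmod (cnj (ebasis_even j k y)) \<le> of_int (j + k) * (cmod (chord y))\<^sup>2" for y
      using norm_ebasis_even_le[OF jk] by simp
    fix l i
    have "(\<integral>y. cnj (ebasis_even j k y) * ebasis_even l (- 1 - int i) y \<partial>GH_measure)
        = inner_GH (ebasis_even l (- 1 - int i)) (ebasis_even j k)"
      unfolding inner_GH_def by (simp add: mult.commute)
    also have "\<dots> = 0"
    proof (rule spectral_orthogonal)
      show "ebasis_even l (- 1 - int i) \<in> spectral (- both_nonneg)"
        by (rule ebasis_even_spectral) auto
      show "ebasis_even j k \<in> spectral both_nonneg"
        by (rule ebasis_even_spectral) (use jk in auto)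
    qed simp
    finally show "(\<integral>y. cnj (ebasis_even j k y) * ebasis_even l (- 1 - int i) y \<partial>GH_measure) = 0" .
  qed
  then have "inner_GH (I0 f) (ebasis_even j k) = 0"
    unfolding inner_GH_def by (simp add: mult.commute)
  moreover have "inner_GH (I0 f) (ebasis_even j k) = inner_GH (I0 f) (ebasis j k) - inner_GH (I0 f) (ebasis k j)"
    using inner_GH_diff[OF L2_ebasis L2_ebasis L, of j k k j]
    unfolding inner_GH_commute[of "I0 f"] ebasis_even_def by simp
  ultimately have "2 * inner_GH (I0 f) (ebasis j k) = 0"
    unfolding spectral_anti[OF even, of k j] by simp
  then show ?thesis by simp
qed

section \<open>Density of the range of the transform\<close>

lemma xhalfI: "u \<in> L2_disk \<Longrightarrow> (\<lambda>z. complex_of_real (sqrt (bdf z)) * u z) \<in> xhalf_L2"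
  unfolding xhalf_L2_def by (rule CollectI) (rule exI[of _ u], simp)

lemma xhalf_scale: "f \<in> xhalf_L2 \<Longrightarrow> (\<lambda>z. c * f z) \<in> xhalf_L2"
  and xhalf_cnj: "f \<in> xhalf_L2 \<Longrightarrow> (\<lambda>z. cnj (f z)) \<in> xhalf_L2"
proof -
  assume "f \<in> xhalf_L2"
  then obtain u where u: "u \<in> L2_disk" and f: "f = (\<lambda>z. complex_of_real (sqrt (bdf z)) * u z)"
    unfolding xhalf_L2_def by blast
  have uL: "(\<lambda>z. c * u z) \<in> L2_disk" "(\<lambda>z. cnj (u z)) \<in> L2_disk"
    using u by (auto simp: L2_disk_def norm_mult power_mult_distrib intro!: borel_measurable_cnj)
  have eq: "(\<lambda>z. c * f z) = (\<lambda>z. complex_of_real (sqrt (bdf z)) * (c * u z))"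
    "(\<lambda>z. cnj (f z)) = (\<lambda>z. complex_of_real (sqrt (bdf z)) * cnj (u z))"
    by (simp_all add: f fun_eq_iff)
  show "(\<lambda>z. c * f z) \<in> xhalf_L2" "(\<lambda>z. cnj (f z)) \<in> xhalf_L2"
    unfolding eq by (intro xhalfI uL)+
qed

lemma xhalf_add:
  assumes "f \<in> xhalf_L2" "g \<in> xhalf_L2"
  shows "(\<lambda>z. f z + g z) \<in> xhalf_L2"
proof -
  obtain u v where u: "u \<in> L2_disk" "f = (\<lambda>z. complex_of_real (sqrt (bdf z)) * u z)"
    and v: "v \<in> L2_disk" "g = (\<lambda>z. complex_of_real (sqrt (bdf z)) * v z)"
    using assms unfolding xhalf_L2_def by blast
  have [measurable]: "u \<in> borel_measurable hyp_area" "v \<in> borel_measurable hyp_area"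
    using u v by (auto simp: L2_disk_def)
  have "integrable hyp_area (\<lambda>z. (cmod (u z + v z))\<^sup>2)"
  proof (rule Bochner_Integration.integrable_bound)
    show "integrable hyp_area (\<lambda>z. 2 * (cmod (u z))\<^sup>2 + 2 * (cmod (v z))\<^sup>2)"
      using u v by (auto simp: L2_disk_def)
    show "AE z in hyp_area. norm ((cmod (u z + v z))\<^sup>2) \<le> norm (2 * (cmod (u z))\<^sup>2 + 2 * (cmod (v z))\<^sup>2)"
      by (intro AE_I2) (simp add: norm_add_sq_le)
  qed measurable
  then have L: "(\<lambda>z. u z + v z) \<in> L2_disk"
    by (simp add: L2_disk_def)
  have eq: "(\<lambda>z. f z + g z) = (\<lambda>z. complex_of_real (sqrt (bdf z)) * (u z + v z))"
    by (simp add: u v fun_eq_iff distrib_left)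
  show ?thesis
    unfolding eq by (rule xhalfI[OF L])
qed

text \<open>Dividing by x^(1/2) leaves a function whose squared modulus is at most x^3, and x^3 has
  finite hyperbolic integral.\<close>

lemma klein_monomial_xhalf: "klein_monomial m n \<in> xhalf_L2"
proof -
  define u where "u z = klein_monomial m n z / complex_of_real (sqrt (bdf z))" for z
  have um: "u \<in> borel_measurable borel"
    unfolding u_def klein_monomial_def by measurable
  have "integrable hyp_area (\<lambda>z. (cmod (u z))\<^sup>2)"
  proof (rule Bochner_Integration.integrable_bound)
    show "integrable hyp_area (\<lambda>z. (bdf z) ^ 3)"
      using integrable_Re[OF klein_moment(1)[of 0 0]] by (simp flip: of_real_power)
    have "(\<lambda>z. (cmod (u z))\<^sup>2) \<in> borel_measurable borel"
      using um by measurable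
    then show "(\<lambda>z. (cmod (u z))\<^sup>2) \<in> borel_measurable hyp_area"
      by (rule borel_measurable_hyp)
    show "AE z in hyp_area. norm ((cmod (u z))\<^sup>2) \<le> norm ((bdf z) ^ 3)"
    proof (rule AE_I2)
      fix z assume "z \<in> space hyp_area"
      then have b: "bdf z > 0" by (simp add: hyp_area_space bdf_pos)
      have "(cmod (klein z ^ m * cnj (klein z) ^ n))\<^sup>2 \<le> 1"
        by (intro power_le_one norm_klein_powers_le) simp
      then have "(bdf z) ^ 3 * (cmod (klein z ^ m * cnj (klein z) ^ n))\<^sup>2 \<le> (bdf z) ^ 3"
        using b by (intro mult_left_le) auto
      moreover have "(cmod (u z))\<^sup>2 = (bdf z) ^ 3 * (cmod (klein z ^ m * cnj (klein z) ^ n))\<^sup>2"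
        using b by (simp add: u_def klein_monomial_def norm_divide norm_mult norm_power power_divide power_mult_distrib power2_eq_square power3_eq_cube)
      ultimately show "norm ((cmod (u z))\<^sup>2) \<le> norm ((bdf z) ^ 3)"
        using b by simp
    qed
  qed
  then have L: "u \<in> L2_disk"
    using borel_measurable_hyp[OF um] by (simp add: L2_disk_def)
  have eq: "klein_monomial m n = (\<lambda>z. complex_of_real (sqrt (bdf z)) * u z)"
    by (auto simp: u_def klein_monomial_def fun_eq_iff)
  show ?thesis
    unfolding eq by (rule xhalfI[OF L])
qed

text \<open>On this class \<open>I0\<close> is additive, since the default value for divergent
  integrals never occurs; the condition is imposed on every geodesic, so linearity holds
  pointwise.\<close>

definition nice :: "(complex \<Rightarrow> complex) set" where
  "nice = {f \<in> xhalf_L2. \<forall>b a. integrable lborel (\<lambda>t. f (geod b a t))}"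

lemma subspace_I0_nice: "subspace_fun (I0 ` nice)"
  unfolding subspace_fun_def
proof (intro conjI ballI allI)
  have "(\<lambda>z. 0 * klein_monomial 0 0 z) \<in> nice"
    using xhalf_scale[OF klein_monomial_xhalf, of 0] unfolding nice_def by simp
  moreover have "I0 (\<lambda>z. 0 * klein_monomial 0 0 z) = (\<lambda>y. 0)"
    by (simp add: I0_def fun_eq_iff)
  ultimately show "(\<lambda>y. 0) \<in> I0 ` nice"
    by (metis imageI)
next
  fix u v assume "u \<in> I0 ` nice" "v \<in> I0 ` nice"
  then obtain f g where f: "f \<in> nice" "u = I0 f" and g: "g \<in> nice" "v = I0 g" by blast
  have "(\<lambda>z. f z + g z) \<in> nice"
    using f(1) g(1) by (simp add: nice_def xhalf_add)
  moreover have "I0 (\<lambda>z. f z + g z) = (\<lambda>y. u y + v y)"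
    using f g by (simp add: I0_def fun_eq_iff nice_def)
  ultimately show "(\<lambda>y. u y + v y) \<in> I0 ` nice"
    by (metis imageI)
next
  fix c u assume "u \<in> I0 ` nice"
  then obtain f where f: "f \<in> nice" "u = I0 f" by blast
  have "(\<lambda>z. c * f z) \<in> nice"
    using f(1) by (simp add: nice_def xhalf_scale)
  moreover have "I0 (\<lambda>z. c * f z) = (\<lambda>y. c * u y)"
    using f by (simp add: I0_def fun_eq_iff)
  ultimately show "(\<lambda>y. c * u y) \<in> I0 ` nice"
    by (metis imageI)
qed

lemma I0_cnj: "I0 (\<lambda>z. cnj (f z)) = (\<lambda>y. cnj (I0 f y))"
  by (simp add: I0_def fun_eq_iff)

lemma I0_nice_cnj: "u \<in> I0 ` nice \<Longrightarrow> (\<lambda>y. cnj (u y)) \<in> I0 ` nice"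
proof -
  assume "u \<in> I0 ` nice"
  then obtain f where f: "f \<in> nice" "u = I0 f" by blast
  then have "(\<lambda>z. cnj (f z)) \<in> nice"
    by (simp add: nice_def xhalf_cnj)
  then show ?thesis
    unfolding f(2) I0_cnj[symmetric] by (rule imageI)
qed

text \<open>For fixed l the transforms of the monomials with exponents (l + n, n) form a triangular
  system with nonzero diagonal \<open>ibp_coeff n (l + n) n\<close>, solved by strong
  induction.\<close>

lemma ebasis_even_range_aux: "ebasis_even (int l + int n) (- 1 - int n) \<in> I0 ` nice"
proof (induction n rule: less_induct)
  case (less n)
  note sub = subspace_I0_nice
  define c where "c i = complex_of_real (ibp_coeff i (l + n) n)" for i
  have cn: "c n \<noteq> 0"
    using ibp_coeff_pos[of n n "l + n"] by (simp add: c_def)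
  have "klein_monomial (l + n) n \<in> nice"
    by (simp add: nice_def klein_monomial_xhalf I0_klein_monomial(1))
  then have I: "I0 (klein_monomial (l + n) n) \<in> I0 ` nice"
    by (rule imageI)
  have rest: "(\<lambda>y. \<Sum>i<n. c i * ebasis_even (int l + int i) (- 1 - int i) y) \<in> I0 ` nice"
    by (intro subspace_fun_sum[OF sub] subspace_fun_scale[OF sub] less.IH) simp
  have "ebasis_even (int l + int n) (- 1 - int n) y
      = 1 / c n * ((- 2) * I0 (klein_monomial (l + n) n) y - (\<Sum>i<n. c i * ebasis_even (int l + int i) (- 1 - int i) y))" for y
  proof -
    have "I0 (klein_monomial (l + n) n) y = - (1/2) * (\<Sum>i\<le>n. c i * ebasis_even (int l + int i) (- 1 - int i) y)"
      using I0_klein_monomial(2)[of "l + n" n "fst y" "snd y"] by (simp add: c_def)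
    then have "(- 2) * I0 (klein_monomial (l + n) n) y = (\<Sum>i\<le>n. c i * ebasis_even (int l + int i) (- 1 - int i) y)"
      by simp
    also have "\<dots>
        = (\<Sum>i<n. c i * ebasis_even (int l + int i) (- 1 - int i) y) + c n * ebasis_even (int l + int n) (- 1 - int n) y"
      by (simp only: lessThan_Suc_atMost[symmetric] sum.lessThan_Suc)
    finally show ?thesis
      using cn by simp
  qed
  then have "ebasis_even (int l + int n) (- 1 - int n)
      = (\<lambda>y. 1 / c n * ((- 2) * I0 (klein_monomial (l + n) n) y - (\<Sum>i<n. c i * ebasis_even (int l + int i) (- 1 - int i) y)))"
    by (rule ext)
  then show ?case
    by (rule ssubst) (intro subspace_fun_scale[OF sub] subspace_fun_diff[OF sub] I rest)
qed

lemma ebasis_even_range: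
  assumes "(j, k) \<in> - both_nonneg - both_neg"
  shows "ebasis_even j k \<in> I0 ` nice"
proof -
  have mixed: "ebasis_even j k \<in> I0 ` nice" if jk: "j \<ge> 0" "k < 0" for j k
  proof (cases "j + k + 1 \<ge> 0")
    case True
    have "j = int (nat (j + k + 1)) + int (nat (- 1 - k))" "k = - 1 - int (nat (- 1 - k))"
      using True jk by auto
    then show ?thesis
      using ebasis_even_range_aux by metis
  next
    \<comment> \<open>The auxiliary lemma only reaches pairs with j + k \<ge> -1; conjugation sends
      j + k to - j - k - 2 and so brings the remaining pairs into its range.\<close>
    case False
    have "- k - 1 = int (nat (- j - k - 1)) + int (nat j)" "- j - 1 = - 1 - int (nat j)"
      using False jk by auto
    then have "ebasis_even (- k - 1) (- j - 1) \<in> I0 ` nice"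
      using ebasis_even_range_aux by metis
    from I0_nice_cnj[OF this] show ?thesis
      by (simp add: cnj_ebasis_even)
  qed
  show ?thesis
  proof (cases "j \<ge> 0")
    case True
    then show ?thesis
      using assms by (intro mixed) auto
  next
    case False
    have "ebasis_even k j \<in> I0 ` nice"
      using assms False by (intro mixed) auto
    from subspace_fun_scale[OF subspace_I0_nice this, of "- 1"] show ?thesis
      by (simp add: ebasis_even_def)
  qed
qed

text \<open>Pairs of nonnegative indices are excluded by duality; for pairs of negative ones the
  same is applied to the conjugate of f.\<close>

lemma I0_spectral:
  assumes f: "f \<in> xhalf_L2" and L: "I0 f \<in> L2_GH"
  shows "I0 f \<in> spectral (- both_nonneg - both_neg)"
proof -
  note even = I0_even[OF L]
  show ?thesis
  proof (rule spectralI[OF L spectral_anti[OF even]])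
    fix j k assume jk: "(j, k) \<notin> - both_nonneg - both_neg"
    then consider "j \<ge> 0" "k \<ge> 0" | "j < 0" "k < 0" by auto
    then show "inner_GH (I0 f) (ebasis j k) = 0"
    proof cases
      case 1
      then show ?thesis by (rule I0_inner_nonneg[OF f L])
    next
      case 2
      have "inner_GH (I0 (\<lambda>z. cnj (f z))) (ebasis (- j - 1) (- k - 1)) = 0"
        by (rule I0_inner_nonneg[OF xhalf_cnj[OF f]]) (use 2 L2_cnj[OF L] in \<open>simp_all add: I0_cnj\<close>)
      then have "inner_GH (\<lambda>y. cnj (I0 f y)) (ebasis (- j - 1) (- k - 1)) = 0"
        by (simp only: I0_cnj)
      then show ?thesis
        by (simp add: inner_GH_cnj_ebasis)
    qed
  qed
qed

text \<open>The linear class \<open>nice\<close> gives density, and \<open>I0_spectral\<close>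
  confines the square integrable transforms of all of \<open>xhalf_L2\<close>.\<close>

lemma L2_closure_I0: "L2_closure (I0 ` xhalf_L2) = spectral (- both_nonneg - both_neg)"
proof (rule L2_closure_eq_spectral[OF subspace_I0_nice])
  show "I0 ` nice \<subseteq> I0 ` xhalf_L2"
    by (auto simp: nice_def)
  show "f \<in> spectral (- both_nonneg - both_neg)" if "f \<in> I0 ` xhalf_L2" "f \<in> L2_GH" for f
    using that I0_spectral by blast
qed (auto intro: ebasis_even_range)

theorem theorem2p8:
  defines "A \<equiv> L2_closure (I0 ` xhalf_L2)"
      and "B \<equiv> closed_span index_set (\<lambda>(p, q). Ipq_hat p (2 * q))"
      and "C \<equiv> closed_span index_set (\<lambda>(p, q). (\<lambda>y. cnj (Ipq_hat p (2 * q) y)))"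
  shows "L2_plus = {(\<lambda>y. f y + g y + k y) | f g k. f \<in> A \<and> g \<in> B \<and> k \<in> C}
     \<and> orthogonal_sets A B \<and> orthogonal_sets A C \<and> orthogonal_sets B C
     \<and> orthonormal_family index_set (\<lambda>(p, q). Ipq_hat p (2 * q))
     \<and> orthonormal_family index_set (\<lambda>(p, q). (\<lambda>y. cnj (Ipq_hat p (2 * q) y)))"
proof (intro conjI)
  have A: "A = spectral (- both_nonneg - both_neg)"
    unfolding A_def by (rule L2_closure_I0)
  have B: "B = spectral both_nonneg"
    unfolding B_def by (rule closed_span_Ipq)
  have C: "C = spectral both_neg"
    unfolding C_def by (rule closed_span_Ipq_cnj)
  show "L2_plus = {(\<lambda>y. f y + g y + k y) | f g k. f \<in> A \<and> g \<in> B \<and> k \<in> C}"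
    unfolding L2_plus_eq_spectral A B C by (rule spectral_decomposition) auto
  show "orthogonal_sets A B" "orthogonal_sets A C" "orthogonal_sets B C"
    unfolding orthogonal_sets_def A B C by (auto intro!: spectral_orthogonal)
  show "orthonormal_family index_set (\<lambda>(p, q). Ipq_hat p (2 * q))"
    by (rule orthonormal_Ipq_hat)
  have "(\<lambda>(p, q). (\<lambda>y. cnj (Ipq_hat p (2 * q) y))) = (\<lambda>i y. cnj (Ipq_family i y))"
    by (simp add: fun_eq_iff)
  then show "orthonormal_family index_set (\<lambda>(p, q). (\<lambda>y. cnj (Ipq_hat p (2 * q) y)))"
    using orthonormal_cnj[OF orthonormal_Ipq_hat] by simp
qed

end
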